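(* Let $k>\ell\ge1$ be integers with $k+\ell\ge5$, let $\lambda\in[0,k+\ell-5]$ be an integer, let $m$ be an integer with $$m\ge\max\Big\{5T\big(\tfrac1{k+\ell}\big),\ (k+\ell+\lambda+4)\big(1+\tfrac1{k+\ell}\big)(k+\ell)^{1/(k+\ell-2)}\Big\},$$ and suppose $p=(k+\ell)m+2+\lambda$ is prime. Let $n\ge1$. If $A\subset\mathbb F_p^n$ is a nontrivial $(k,\ell)$-sum-free set with $|A|\ge mp^{n-1}$, then $A$ is normal up to isomorphism, i.e. $A$ is of type 1 or of type 2.
   Context: For a subset $X$ of an abelian group and $h\ge1$, $hX=\{x_1+\dots+x_h:x_i\in X\}$. A nonempty $A\subseteq\mathbb F_p^n$ is $(k,\ell)$-sum-free if $kA\cap\ell A=\emptyset$. Subsets of $\mathbb F_p^n$ are isomorphic if an automorphism of the additive group $\mathbb F_p^n$ maps one onto the other. For $a,b\in\mathbb F_p$, $[a,b]=\{a,a+1,\dots,b\}\subseteq\mathbb F_p$ (cyclic interval). For $j\in[0,\lceil\frac{\lambda+1}2\rceil-1]$ let $a_j=-(km+1+j)(k-\ell)^{-1}\in\mathbb F_p$ and $A_{k,\ell,p,j}=[a_j,a_j+m]\times\mathbb F_p^{n-1}$ (extremal cuboids). A $(k,\ell)$-sum-free set is trivial if it is isomorphic to a subset of some $A_{k,\ell,p,j}$, and nontrivial otherwise. Types (for $A\subseteq\mathbb F_p^n$ with $|A|=mp^{n-1}$): $A$ is of type 1 if $A$ is isomorphic to $[a,a+m-1]\times\mathbb F_p^{n-1}$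 for some $a\in\mathbb F_p$ such that the element $\ell a-k(a+m-1)\in\mathbb F_p$ lies in $[1,\ell]$ or in $[\lambda+\ell+2,k]$ (the latter option only when $\lambda+\ell+2\le k$). $A$ is of type 2 if $\ell=1$, $n\ge2$, and $A$ is isomorphic to $(\{a\}\times(\mathbb F_p^{n-1}\setminus V))\sqcup([a+1,a+m-1]\times\mathbb F_p^{n-1})\sqcup(\{a+m\}\times V)$, where $a=mk(\ell-k)^{-1}\in\mathbb F_p$ and $V\subset\mathbb F_p^{n-1}$ is a proper linear subspace. $A$ is normal if it is of type 1 or 2. The function $T$: a finite $X\subseteq\mathbb F_p$ has the covering property if $X$ is contained in an arithmetic progression of length $|X+X|-|X|+1$. For $c\in(0,1)$, $\tau\in(0,1]$ is feasible for $c$ if (for every prime $p$) every $X\subseteq\mathbb F_p$ with $|X|\le cp$ and $|X+X|\le(2+\tau)|X|-3$ has the covering property; $\tau(c)$ is the supremum of the feasible $\tau$, and $T(c)=1/\tau(c)$. *)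

theory Defs
  imports
    "HOL-Number_Theory.Number_Theory"
    "HOL-Algebra.Product_Groups"
    "HOL-Library.Extended_Nonnegative_Real"
begin

text \<open>
  The field \<open>F\<^sub>p\<close> is \<^term>\<open>residue_ring (int p)\<close>, with carrier \<open>{0..p - 1}\<close>; an integer \<open>z\<close>
  represents the element \<open>z mod p\<close>. Vectors of \<open>F\<^sub>p\<^sup>n\<close> are the extensional functions on \<open>{..<n}\<close>,
  so \<open>F\<^sub>p\<^sup>0\<close> has exactly one element.
\<close>

definition Fp :: "nat \<Rightarrow> int ring" where
  "Fp p = residue_ring (int p)"

definition Fpn :: "nat \<Rightarrow> nat \<Rightarrow> (nat \<Rightarrow> int) monoid" where
  "Fpn p n = product_group {..<n} (\<lambda>_. add_monoid (Fp p))"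

text \<open>
  The set \<open>S \<times> B\<close> as a subset of \<open>F\<^sub>p\<^sup>n = F\<^sub>p \<times> F\<^sub>p\<^sup>n\<^sup>-\<^sup>1\<close> (for \<open>n \<ge> 1\<close>), where the factor \<open>F\<^sub>p\<close> is
  coordinate \<open>0\<close> and the coordinates \<open>1, \<dots>, n - 1\<close> are shifted down to \<open>0, \<dots>, n - 2\<close>.
\<close>

definition cuboid :: "nat \<Rightarrow> nat \<Rightarrow> int set \<Rightarrow> (nat \<Rightarrow> int) set \<Rightarrow> (nat \<Rightarrow> int) set" where
  "cuboid p n S B =
     {x \<in> carrier (Fpn p n). x 0 \<in> S \<and> (\<lambda>i\<in>{..<n - 1}. x (Suc i)) \<in> B}"

text \<open>The group is written multiplicatively here, as everywhere in the algebra library.\<close>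

definition hfold :: "('a, 'b) monoid_scheme \<Rightarrow> nat \<Rightarrow> 'a set \<Rightarrow> 'a set" where
  "hfold G h X = {finprod G x {..<h} | x. x \<in> {..<h} \<rightarrow> X}"

definition sum_free :: "nat \<Rightarrow> nat \<Rightarrow> nat \<Rightarrow> nat \<Rightarrow> (nat \<Rightarrow> int) set \<Rightarrow> bool" where
  "sum_free p n k l A \<longleftrightarrow>
     A \<noteq> {} \<and> A \<subseteq> carrier (Fpn p n) \<and> hfold (Fpn p n) k A \<inter> hfold (Fpn p n) l A = {}"

definition isomorphic_sets ::
    "nat \<Rightarrow> nat \<Rightarrow> (nat \<Rightarrow> int) set \<Rightarrow> (nat \<Rightarrow> int) set \<Rightarrow> bool" where
  "isomorphic_sets p n A B \<longleftrightarrow> (\<exists>\<phi> \<in> iso (Fpn p n) (Fpn p n). \<phi> ` A = B)"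

text \<open>The endpoints are arbitrary integers representing residues modulo \<open>p\<close>.\<close>

definition cyc_interval :: "nat \<Rightarrow> int \<Rightarrow> int \<Rightarrow> int set" where
  "cyc_interval p a b = (\<lambda>i. (a + i) mod int p) ` {0..(b - a) mod int p}"

definition extremal_start :: "nat \<Rightarrow> nat \<Rightarrow> nat \<Rightarrow> nat \<Rightarrow> nat \<Rightarrow> int" where
  "extremal_start p k l m j =
     (- (int k * int m + 1 + int j) * modular_inverse (int p) (int k - int l)) mod int p"

definition extremal_cuboid ::
    "nat \<Rightarrow> nat \<Rightarrow> nat \<Rightarrow> nat \<Rightarrow> nat \<Rightarrow> nat \<Rightarrow> (nat \<Rightarrow> int) set" where
  "extremal_cuboid p n k l m j =
     (let a = extremal_start p k l m j
      in cuboid p n (cyc_interval p a (a + int m)) (carrier (Fpn p (n - 1))))"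

definition trivial_set ::
    "nat \<Rightarrow> nat \<Rightarrow> nat \<Rightarrow> nat \<Rightarrow> nat \<Rightarrow> nat \<Rightarrow> (nat \<Rightarrow> int) set \<Rightarrow> bool" where
  "trivial_set p n k l m lam A \<longleftrightarrow>
     (\<exists>j B. int j \<le> \<lceil>(real lam + 1) / 2\<rceil> - 1 \<and> B \<subseteq> extremal_cuboid p n k l m j \<and>
            isomorphic_sets p n A B)"

definition type1 ::
    "nat \<Rightarrow> nat \<Rightarrow> nat \<Rightarrow> nat \<Rightarrow> nat \<Rightarrow> nat \<Rightarrow> (nat \<Rightarrow> int) set \<Rightarrow> bool" where
  "type1 p n k l m lam A \<longleftrightarrow>
     card A = m * p ^ (n - 1) \<and>
     (\<exists>a \<in> carrier (Fp p).
        isomorphic_sets p n A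
          (cuboid p n (cyc_interval p a (a + int m - 1)) (carrier (Fpn p (n - 1)))) \<and>
        (let d = (int l * a - int k * (a + int m - 1)) mod int p in
           d \<in> cyc_interval p 1 (int l) \<or>
           (lam + l + 2 \<le> k \<and> d \<in> cyc_interval p (int lam + int l + 2) (int k))))"

definition linear_subspace :: "nat \<Rightarrow> nat \<Rightarrow> (nat \<Rightarrow> int) set \<Rightarrow> bool" where
  "linear_subspace p d V \<longleftrightarrow>
     subgroup V (Fpn p d) \<and>
     (\<forall>c \<in> carrier (Fp p). \<forall>v \<in> V. (\<lambda>i\<in>{..<d}. c \<otimes>\<^bsub>Fp p\<^esub> v i) \<in> V)"

definition type2 ::
    "nat \<Rightarrow> nat \<Rightarrow> nat \<Rightarrow> nat \<Rightarrow> nat \<Rightarrow> (nat \<Rightarrow> int) set \<Rightarrow> bool" where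
  "type2 p n k l m A \<longleftrightarrow>
     card A = m * p ^ (n - 1) \<and> l = 1 \<and> n \<ge> 2 \<and>
     (\<exists>V. linear_subspace p (n - 1) V \<and> V \<subset> carrier (Fpn p (n - 1)) \<and>
        (let a = (int m * int k * modular_inverse (int p) (int l - int k)) mod int p in
           isomorphic_sets p n A
             (cuboid p n {a} (carrier (Fpn p (n - 1)) - V) \<union>
              cuboid p n (cyc_interval p (a + 1) (a + int m - 1)) (carrier (Fpn p (n - 1))) \<union>
              cuboid p n {(a + int m) mod int p} V)))"

definition normal_set ::
    "nat \<Rightarrow> nat \<Rightarrow> nat \<Rightarrow> nat \<Rightarrow> nat \<Rightarrow> nat \<Rightarrow> (nat \<Rightarrow> int) set \<Rightarrow> bool" where
  "normal_set p n k l m lam A \<longleftrightarrow> type1 p n k l m lam A \<or> type2 p n k l m A"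

definition arith_prog :: "nat \<Rightarrow> int \<Rightarrow> int \<Rightarrow> nat \<Rightarrow> int set" where
  "arith_prog p a d N = (\<lambda>i. (a + int i * d) mod int p) ` {..<N}"

text \<open>
  The truncated subtraction below is exact for nonempty \<open>X\<close>, as then \<open>|X| \<le> |X + X|\<close>; the
  hypothesis of \<open>feasible\<close> fails for \<open>X = {}\<close>.
\<close>

definition covering_property :: "nat \<Rightarrow> int set \<Rightarrow> bool" where
  "covering_property p X \<longleftrightarrow>
     (\<exists>a \<in> carrier (Fp p). \<exists>d \<in> carrier (Fp p) - {0}.
        X \<subseteq> arith_prog p a d (card (hfold (add_monoid (Fp p)) 2 X) - card X + 1))"

definition feasible :: "real \<Rightarrow> real \<Rightarrow> bool" where
  "feasible c \<tau> \<longleftrightarrow>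
     0 < \<tau> \<and> \<tau> \<le> 1 \<and>
     (\<forall>p X. prime p \<longrightarrow> X \<subseteq> carrier (Fp p) \<longrightarrow>
        real (card X) \<le> c * real p \<longrightarrow>
        real (card (hfold (add_monoid (Fp p)) 2 X)) \<le> (2 + \<tau>) * real (card X) - 3 \<longrightarrow>
        covering_property p X)"

text \<open>
  Values in the extended nonnegative reals make \<open>\<tau>(c) = 0\<close> and \<open>T(c) = \<infinity>\<close> in case no \<open>\<tau>\<close> is
  feasible for \<open>c\<close>; otherwise both are the usual positive real numbers.
\<close>

definition tau_sup :: "real \<Rightarrow> ennreal" where
  "tau_sup c = (SUP \<tau> \<in> {\<tau>. feasible c \<tau>}. ennreal \<tau>)"

definition T_fun :: "real \<Rightarrow> ennreal" where
  "T_fun c = 1 / tau_sup c"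

end

theory Submission
  imports Defs "HOL-Library.Set_Algebras"
begin

text \<open>
  Put \<open>q = k + l\<close> and \<open>P = p\<^sup>n\<^sup>-\<^sup>1\<close>. As the number of solutions of \<open>x\<^sub>1 + \<dots> + x\<^sub>k = y\<^sub>1 + \<dots> + y\<^sub>l\<close> in \<open>A\<close> is
  zero, \<open>A\<close> has a Fourier coefficient of size at least \<open>\<eta> |A|\<close> with \<open>\<eta> = q\<^bsup>-1/(q-2)\<^esup>\<close>, so after an
  automorphism some slice \<open>A\<^sub>x\<close> along the first coordinate is larger than the average one by the
  factor \<open>1 + \<eta>\<close>. Whenever \<open>x\<^sub>1 + \<dots> + x\<^sub>k = y\<^sub>1 + \<dots> + y\<^sub>l\<close> in the support of \<open>A\<close>, the slices at these
  positions have total size less than about \<open>P\<close>, by a weak form of Kneser's theorem, and any two of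
  them have total size at most \<open>P\<close>. Applying the Cauchy--Davenport theorem to the level sets of the
  slice sizes shows that the largest slice has size close to \<open>P\<close>, and then that at most \<open>m + 1\<close> slices
  are nonempty.

  Up to one position, the support is therefore a \<open>(k, l)\<close>-sum-free set \<open>S'\<close> of \<open>m\<close> residues. By the
  theorems of Cauchy--Davenport and Vosper, \<open>|S' + S'| \<le> 2 m + 1\<close>, and the assumption on \<open>T\<close> places
  \<open>S'\<close> in an arithmetic progression of length \<open>m + 2\<close>, without loss of generality an interval.
  Comparing \<open>k\<close>-fold and \<open>l\<close>-fold sums then leaves only an interval of length \<open>m + 1\<close> or \<open>m\<close> for the
  support, and for \<open>l = 1\<close> one further configuration, in which the two slices at the ends are a coset
  of a subspace and the complement of such a coset.
\<close>

section \<open>Sumsets in finite abelian groups\<close>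

text \<open>The constants in the hypothesis on m arise as follows. With |S'| = m and |S' + S'| at
  most 2 m + 1, the covering property needs tau m >= 4; asking for 5 leaves room for a supremum that
  is not attained. The second bound gives eta m >= k + l + lambda + 4, which excludes a largest
  slice near the average density, and m >= 14, which absorbs the losses in the estimates for the
  slices. The range of lambda says p + 3 <= (k + l)(m + 1); this reserve of 3 pays for the unpaired
  summands when the copies of S' are grouped into copies of S' + S'.

  The delicate point is the extra position of the support, whose slice may be small: sum-freeness of
  S' says nothing about it. What is kept is stronger: a solution inside the whole support has at
  most one entry in S'. Using the extra position many times together with two entries in S' then
  forces it next to the interval. For l = 1 there is a boundary relation with only one entry in S';
  it is the source of type 2.\<close>

definition lprod :: "('a, 'b) monoid_scheme \<Rightarrow> 'a list \<Rightarrow> 'a" where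
  "lprod G xs = foldr (\<otimes>\<^bsub>G\<^esub>) xs \<one>\<^bsub>G\<^esub>"

definition lset_mult :: "('a, 'b) monoid_scheme \<Rightarrow> 'a set list \<Rightarrow> 'a set" where
  "lset_mult G Xs = foldr (<#>\<^bsub>G\<^esub>) Xs {\<one>\<^bsub>G\<^esub>}"

lemma lprod_simps [simp]:
  "lprod G [] = \<one>\<^bsub>G\<^esub>" "lprod G (x # xs) = x \<otimes>\<^bsub>G\<^esub> lprod G xs"
  by (auto simp: lprod_def)

lemma lset_mult_simps [simp]:
  "lset_mult G [] = {\<one>\<^bsub>G\<^esub>}" "lset_mult G (X # Xs) = X <#>\<^bsub>G\<^esub> lset_mult G Xs"
  by (auto simp: lset_mult_def)

lemma mem_lset_mult:
  "z \<in> lset_mult G Xs \<longleftrightarrow> (\<exists>zs. list_all2 (\<in>) zs Xs \<and> lprod G zs = z)"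
proof (induction Xs arbitrary: z)
  case Nil
  then show ?case by auto
next
  case (Cons X Xs)
  show ?case
  proof
    assume "z \<in> lset_mult G (X # Xs)"
    then obtain x w where "x \<in> X" "w \<in> lset_mult G Xs" "z = x \<otimes>\<^bsub>G\<^esub> w"
      by (auto simp: set_mult_def)
    moreover from this Cons.IH obtain zs where "list_all2 (\<in>) zs Xs" "lprod G zs = w" by blast
    ultimately have "list_all2 (\<in>) (x # zs) (X # Xs) \<and> lprod G (x # zs) = z" by simp
    then show "\<exists>zs. list_all2 (\<in>) zs (X # Xs) \<and> lprod G zs = z" by blast
  next
    assume "\<exists>zs. list_all2 (\<in>) zs (X # Xs) \<and> lprod G zs = z"
    then obtain x zs where "x \<in> X" "list_all2 (\<in>) zs Xs" "z = x \<otimes>\<^bsub>G\<^esub> lprod G zs"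
      by (auto simp: list_all2_Cons2)
    then show "z \<in> lset_mult G (X # Xs)"
      using Cons.IH by (auto simp: set_mult_def)
  qed
qed

context comm_group
begin

lemma lprod_closed [simp]: "set xs \<subseteq> carrier G \<Longrightarrow> lprod G xs \<in> carrier G"
  by (induction xs) auto

lemma lprod_append:
  "set xs \<subseteq> carrier G \<Longrightarrow> set ys \<subseteq> carrier G \<Longrightarrow> lprod G (xs @ ys) = lprod G xs \<otimes> lprod G ys"
  by (induction xs) (auto simp: m_assoc)

lemma lprod_inv: "set xs \<subseteq> carrier G \<Longrightarrow> lprod G (map (m_inv G) xs) = inv (lprod G xs)"
  by (induction xs) (auto simp: inv_mult)

lemma lprod_replicate: "x \<in> carrier G \<Longrightarrow> lprod G (replicate h x) = x [^] h"
  by (induction h) (auto simp: m_comm)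

lemma lset_mult_closed: "\<forall>X\<in>set Xs. X \<subseteq> carrier G \<Longrightarrow> lset_mult G Xs \<subseteq> carrier G"
  by (induction Xs) (auto simp: set_mult_def; blast)+

lemma lset_mult_nonempty: "\<forall>X\<in>set Xs. X \<noteq> {} \<Longrightarrow> lset_mult G Xs \<noteq> {}"
  by (induction Xs) (auto simp: set_mult_def)

lemma lset_mult_append:
  assumes "\<forall>X\<in>set Xs. X \<subseteq> carrier G" "\<forall>Y\<in>set Ys. Y \<subseteq> carrier G"
  shows "lset_mult G (Xs @ Ys) = lset_mult G Xs <#> lset_mult G Ys"
  using assms(1)
proof (induction Xs)
  case Nil
  have "lset_mult G Ys \<subseteq> carrier G" using assms(2) by (rule lset_mult_closed)
  then show ?case by (auto simp: set_mult_def subset_iff)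
next
  case (Cons X Xs)
  then show ?case
    using set_mult_assoc[of X "lset_mult G Xs" "lset_mult G Ys"]
      lset_mult_closed[of Xs] lset_mult_closed[OF assms(2)] by simp
qed

lemma card_l_image: "g \<in> carrier G \<Longrightarrow> X \<subseteq> carrier G \<Longrightarrow> card ((\<lambda>x. g \<otimes> x) ` X) = card X"
  by (rule card_image) (auto simp: inj_on_def subset_iff)

lemma card_inv_image: "X \<subseteq> carrier G \<Longrightarrow> card (m_inv G ` X) = card X"
  by (rule card_image, rule inj_onI) (metis inv_inv subsetD)

lemma set_mult_commute:
  assumes "X \<subseteq> carrier G" "Y \<subseteq> carrier G"
  shows "X <#> Y = Y <#> X"
proof -
  have "A <#> B \<subseteq> B <#> A" if "A \<subseteq> carrier G" "B \<subseteq> carrier G" for A B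
    using that unfolding set_mult_def by clarsimp (metis m_comm subsetD)
  then show ?thesis using assms by blast
qed

lemma card_set_mult_ge:
  assumes "finite (carrier G)" "X \<subseteq> carrier G" "Y \<subseteq> carrier G" "Y \<noteq> {}"
  shows "card X \<le> card (X <#> Y)"
proof -
  obtain y where y: "y \<in> Y" using assms by auto
  have "(\<lambda>x. y \<otimes> x) ` X \<subseteq> X <#> Y"
    using y assms by (force simp: set_mult_def m_comm subset_iff)
  moreover have "finite (X <#> Y)"
    using assms by (meson finite_subset set_mult_closed)
  ultimately show ?thesis
    using card_l_image[of y X] y assms card_mono by (metis subsetD)
qed

section \<open>A weak form of Kneser's theorem\<close>

lemma stabilizer_subgroup:
  assumes "finite (carrier G)" "A \<subseteq> carrier G"
  shows "subgroup {g \<in> carrier G. \<forall>a\<in>A. g \<otimes> a \<in> A} G"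
proof (rule subgroupI)
  show "inv g \<in> {g \<in> carrier G. \<forall>a\<in>A. g \<otimes> a \<in> A}" if "g \<in> {g \<in> carrier G. \<forall>a\<in>A. g \<otimes> a \<in> A}" for g
  proof -
    have g: "g \<in> carrier G" "(\<lambda>a. g \<otimes> a) ` A \<subseteq> A" using that by auto
    \<comment> \<open>An injective map of a finite set into itself is onto; this provides
      inverses.\<close>
    have "(\<lambda>a. g \<otimes> a) ` A = A"
      using g assms card_l_image by (metis card_subset_eq finite_subset)
    then have "inv g \<otimes> a \<in> A" if "a \<in> A" for a
      using that g assms by (smt (verit) imageE inv_solve_left subsetD)
    then show ?thesis using g by auto
  qed
qed (use assms in \<open>auto simp: m_assoc subset_iff\<close>)

text \<open>If the e-transform never shrinks \<open>B\<close>, then \<open>A\<close> is stable under the differences of \<open>B\<close>, and \<open>B\<close>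
  lies in a coset of the stabilizer of \<open>A\<close>.\<close>

lemma card_set_mult_weak_kneser:
  fixes M :: real
  assumes fin: "finite (carrier G)"
    and M: "\<And>K. subgroup K G \<Longrightarrow> K \<noteq> carrier G \<Longrightarrow> real (card K) \<le> M"
    and "A \<subseteq> carrier G" "B \<subseteq> carrier G" "A \<noteq> {}" "B \<noteq> {}"
  shows "min (real (card (carrier G))) (real (card A) + real (card B) - M) \<le> real (card (A <#> B))"
  using assms(3-)
proof (induction "card B" arbitrary: A B rule: less_induct)
  case less
  note A = \<open>A \<subseteq> carrier G\<close> and B = \<open>B \<subseteq> carrier G\<close>
  have finA: "finite A" and finB: "finite B" and finAB: "finite (A <#> B)"
    using fin A B by (auto intro: finite_subset[OF _ fin] dest: set_mult_closed)
  show ?case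
  proof (cases "\<exists>a\<in>A. \<exists>b\<in>B. \<exists>x\<in>B. a \<otimes> inv b \<otimes> x \<notin> A")
    case True
    then obtain a b x where abx: "a \<in> A" "b \<in> B" "x \<in> B" "a \<otimes> inv b \<otimes> x \<notin> A" by blast
    \<comment> \<open>The transform replaces \<open>A\<close> by its union with \<open>e B\<close>,
      and \<open>B\<close> by the part that \<open>e\<close> moves into \<open>A\<close>. The
      product set does not grow, the total size is preserved, \<open>b\<close> survives and
      \<open>x\<close> is lost.\<close>
    define e where "e = a \<otimes> inv b"
    have e: "e \<in> carrier G" using abx A B by (auto simp: e_def)
    define B' where "B' = {y \<in> B. e \<otimes> y \<in> A}"
    define A' where "A' = A \<union> (\<lambda>y. e \<otimes> y) ` B"
    have "b \<in> B'" using abx A B by (auto simp: B'_def e_def m_assoc subset_iff)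
    have "B' \<subset> B" using abx by (auto simp: B'_def e_def)
    have A': "A' \<subseteq> carrier G" "A' \<noteq> {}" using A B e abx by (auto simp: A'_def)
    have less': "card B' < card B" using \<open>B' \<subset> B\<close> finB by (rule psubset_card_mono[rotated])
    have sub: "A' <#> B' \<subseteq> A <#> B"
    proof
      fix z assume "z \<in> A' <#> B'"
      then obtain s y where sy: "s \<in> A'" "y \<in> B'" "z = s \<otimes> y" by (auto simp: set_mult_def)
      show "z \<in> A <#> B"
      proof (cases "s \<in> A")
        case True
        then show ?thesis using sy by (auto simp: set_mult_def B'_def)
      next
        case False
        then obtain u where "u \<in> B" "s = e \<otimes> u" using sy by (auto simp: A'_def)
        then have "z = (e \<otimes> y) \<otimes> u" "e \<otimes> y \<in> A"
          using sy e B by (auto simp: B'_def m_assoc m_comm m_lcomm subset_iff)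
        then show ?thesis using \<open>u \<in> B\<close> by (auto simp: set_mult_def)
      qed
    qed
    have "card A' = card A + card ((\<lambda>y. e \<otimes> y) ` (B - B'))"
    proof -
      have "A' = A \<union> (\<lambda>y. e \<otimes> y) ` (B - B')" by (auto simp: A'_def B'_def)
      moreover have "A \<inter> (\<lambda>y. e \<otimes> y) ` (B - B') = {}" by (auto simp: B'_def)
      ultimately show ?thesis using finA finB by (simp add: card_Un_disjoint)
    qed
    also have "card ((\<lambda>y. e \<otimes> y) ` (B - B')) = card (B - B')"
      using e B by (intro card_l_image) auto
    also have "\<dots> = card B - card B'"
      using \<open>B' \<subset> B\<close> finB by (intro card_Diff_subset) (auto intro: finite_subset)
    finally have "card A' + card B' = card A + card B" using less' by simp
    moreover have "min (real (card (carrier G))) (real (card A') + real (card B') - M) \<le> real (card (A' <#> B'))"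
      using less' A' \<open>b \<in> B'\<close> \<open>B' \<subset> B\<close> B by (intro less.hyps) auto
    moreover have "card (A' <#> B') \<le> card (A <#> B)" using sub finAB by (rule card_mono[rotated])
    ultimately show ?thesis by linarith
  next
    case False
    \<comment> \<open>A proper stabilizer bounds \<open>|B|\<close> by \<open>M\<close>, and then
      \<open>|A| <= |A B|\<close> suffices; if the stabilizer is everything, \<open>A\<close> is the
      whole group.\<close>
    define K where "K = {g \<in> carrier G. \<forall>a\<in>A. g \<otimes> a \<in> A}"
    have K: "subgroup K G" unfolding K_def using fin A by (rule stabilizer_subgroup)
    obtain b where b: "b \<in> B" using less by auto
    have AB: "card A \<le> card (A <#> B)" using less fin by (intro card_set_mult_ge) auto
    show ?thesis
    proof (cases "K = carrier G")
      case True
      obtain a where a: "a \<in> A" using less by auto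
      have "carrier G \<subseteq> A"
      proof
        fix g assume g: "g \<in> carrier G"
        then have "g \<otimes> inv a \<in> K" using True a A by auto
        then have "g \<otimes> inv a \<otimes> a \<in> A" using a by (auto simp: K_def)
        then show "g \<in> A" using g a A by (auto simp: m_assoc subset_iff)
      qed
      then have "card (carrier G) \<le> card A" using finA by (rule card_mono[rotated])
      then show ?thesis using AB by simp
    next
      case False': False
      have "(\<lambda>x. inv b \<otimes> x) ` B \<subseteq> K"
      proof
        fix g assume "g \<in> (\<lambda>x. inv b \<otimes> x) ` B"
        then obtain x where x: "x \<in> B" "g = inv b \<otimes> x" by blast
        have "g \<otimes> a \<in> A" if "a \<in> A" for a
        proof -
          have "a \<otimes> inv b \<otimes> x \<in> A" using False that x b by blast
          also have "a \<otimes> inv b \<otimes> x = g \<otimes> a"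
            using that x b A B by (auto simp: m_ac subset_iff)
          finally show ?thesis .
        qed
        then show "g \<in> K" using x b B by (auto simp: K_def)
      qed
      moreover have "finite K" using K fin by (meson finite_subset subgroup.subset)
      ultimately have "card B \<le> card K"
        using b B card_l_image[of "inv b" B] by (metis card_mono inv_closed subsetD)
      then show ?thesis using M[OF K False'] AB by linarith
    qed
  qed
qed

text \<open>Each multiplication costs at most \<open>M\<close> by the preceding bound. Once the
  product of the tail is as large as the group, only monotonicity helps, hence the second estimate
  for \<open>X <#> ?Y\<close> in the proof.\<close>

lemma card_lset_mult_ge:
  fixes M :: real
  assumes fin: "finite (carrier G)"
    and M: "\<And>K. subgroup K G \<Longrightarrow> K \<noteq> carrier G \<Longrightarrow> real (card K) \<le> M"
    and "\<forall>X\<in>set Xs. X \<subseteq> carrier G \<and> X \<noteq> {}" and "Xs \<noteq> []" and "0 \<le> M"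
  shows "min (real (card (carrier G))) ((\<Sum>X\<leftarrow>Xs. real (card X)) - (real (length Xs) - 1) * M)
           \<le> real (card (lset_mult G Xs))"
  using assms(3,4)
proof (induction Xs)
  case (Cons X Xs)
  show ?case
  proof (cases "Xs = []")
    case True
    have "X <#> {\<one>} = X" using Cons.prems by (auto simp: set_mult_def subset_iff)
    then show ?thesis using True by simp
  next
    case False
    let ?Y = "lset_mult G Xs"
  have Y: "?Y \<subseteq> carrier G" "?Y \<noteq> {}"
    using Cons.prems lset_mult_closed[of Xs] lset_mult_nonempty[of Xs] by simp_all
    have X: "X \<subseteq> carrier G" "X \<noteq> {}" using Cons.prems by auto
    have "min (real (card (carrier G))) (real (card X) + real (card ?Y) - M) \<le> real (card (X <#> ?Y))"
      using fin M X(1) Y(1) X(2) Y(2) by (rule card_set_mult_weak_kneser)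
    moreover have "min (real (card (carrier G))) ((\<Sum>X\<leftarrow>Xs. real (card X)) - (real (length Xs) - 1) * M)
           \<le> real (card ?Y)" using Cons False by simp
    moreover have "real (card ?Y) \<le> real (card (X <#> ?Y))"
    proof -
      have "X <#> ?Y = ?Y <#> X" using X(1) Y(1) by (rule set_mult_commute)
      then show ?thesis using card_set_mult_ge[OF fin Y(1) X] by simp
    qed
    ultimately show ?thesis by (simp add: algebra_simps min_def split: if_splits)
  qed
qed simp

section \<open>Product sets that fill the group\<close>

lemma lset_mult_eq_carrier:
  fixes M :: real
  assumes "finite (carrier G)"
    and "\<And>K. subgroup K G \<Longrightarrow> K \<noteq> carrier G \<Longrightarrow> real (card K) \<le> M"
    and "\<forall>X\<in>set Xs. X \<subseteq> carrier G \<and> X \<noteq> {}" and "Xs \<noteq> []" and "0 \<le> M"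
    and "real (card (carrier G)) \<le> (\<Sum>X\<leftarrow>Xs. real (card X)) - (real (length Xs) - 1) * M"
  shows "lset_mult G Xs = carrier G"
proof (rule card_subset_eq[OF assms(1)])
  show *: "lset_mult G Xs \<subseteq> carrier G" using assms(3) by (intro lset_mult_closed) auto
  have "card (carrier G) \<le> card (lset_mult G Xs)"
    using card_lset_mult_ge[OF assms(1-5)] assms(6) by linarith
  then show "card (lset_mult G Xs) = card (carrier G)"
    using card_mono[OF assms(1) *] by simp
qed

text \<open>Pigeonhole: for each \<open>g\<close> the sets \<open>g X^-1\<close> and
  \<open>Y\<close> are too large to be disjoint.\<close>

lemma set_mult_eq_carrier:
  assumes fin: "finite (carrier G)" and X: "X \<subseteq> carrier G" and Y: "Y \<subseteq> carrier G"
    and "card (carrier G) < card X + card Y"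
  shows "X <#> Y = carrier G"
proof
  show "X <#> Y \<subseteq> carrier G" using X Y by (rule set_mult_closed)
  show "carrier G \<subseteq> X <#> Y"
  proof
    fix g assume g: "g \<in> carrier G"
    let ?Z = "(\<lambda>x. g \<otimes> inv x) ` X"
    have "card ?Z = card X"
      using g X by (intro card_image inj_onI) (auto simp: subset_iff)
    moreover have "?Z \<subseteq> carrier G" using g X by auto
    ultimately have "?Z \<inter> Y \<noteq> {}"
      using assms card_Un_disjoint[of ?Z Y] card_mono[of "carrier G" "?Z \<union> Y"] finite_subset[OF _ fin]
      by (metis Un_least not_le)
    then obtain x where x: "x \<in> X" "g \<otimes> inv x \<in> Y" by blast
    then have "g = x \<otimes> (g \<otimes> inv x)" using g X by (auto simp: m_ac subset_iff)
    then show "g \<in> X <#> Y" using x by (auto simp: set_mult_def)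
  qed
qed

lemma card_lset_mult_mem_ge:
  assumes fin: "finite (carrier G)" and "\<forall>X\<in>set Xs. X \<subseteq> carrier G \<and> X \<noteq> {}" "Y \<in> set Xs"
  shows "card Y \<le> card (lset_mult G Xs)"
  using assms(2,3)
proof (induction Xs)
  case (Cons X Xs)
  let ?Z = "lset_mult G Xs"
  have Z: "?Z \<subseteq> carrier G" "?Z \<noteq> {}"
    using Cons.prems lset_mult_closed[of Xs] lset_mult_nonempty[of Xs] by simp_all
  have X: "X \<subseteq> carrier G" "X \<noteq> {}" using Cons.prems by auto
  have "X <#> ?Z = ?Z <#> X" using X(1) Z(1) by (rule set_mult_commute)
  then have "card ?Z \<le> card (X <#> ?Z)" using card_set_mult_ge[OF fin Z(1) X] by simp
  moreover have "card X \<le> card (X <#> ?Z)" using card_set_mult_ge[OF fin X(1) Z] .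
  ultimately show ?case using Cons by auto
qed simp

lemma lset_mult_eq_carrier_pair:
  assumes fin: "finite (carrier G)"
    and 1: "\<forall>X\<in>set Xs. X \<subseteq> carrier G \<and> X \<noteq> {}" and 2: "\<forall>X\<in>set Ys. X \<subseteq> carrier G \<and> X \<noteq> {}"
    and "X \<in> set Xs" "Y \<in> set Ys" "card (carrier G) < card X + card Y"
  shows "lset_mult G (Xs @ Ys) = carrier G"
proof -
  have "lset_mult G (Xs @ Ys) = lset_mult G Xs <#> lset_mult G Ys"
    using 1 2 by (intro lset_mult_append) auto
  moreover have "card X \<le> card (lset_mult G Xs)" "card Y \<le> card (lset_mult G Ys)"
    using assms by (auto intro: card_lset_mult_mem_ge)
  ultimately show ?thesis
    using set_mult_eq_carrier[OF fin, of "lset_mult G Xs" "lset_mult G Ys"] assms(6)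
      lset_mult_closed[of Xs] lset_mult_closed[of Ys] 1 2 by simp
qed

text \<open>Moving the right-hand factors to the left turns an equation between two products into a
  covering problem: the unit has to lie in a single product of sets.\<close>

lemma lprod_eq_if_one_mem:
  assumes "\<forall>X\<in>set Xs. X \<subseteq> carrier G" "\<forall>Y\<in>set Ys. Y \<subseteq> carrier G"
    and "\<one> \<in> lset_mult G (Xs @ map ((`) (m_inv G)) Ys)"
  shows "\<exists>xs ys. list_all2 (\<in>) xs Xs \<and> list_all2 (\<in>) ys Ys \<and> lprod G xs = lprod G ys"
proof -
  obtain zs where "list_all2 (\<in>) zs (Xs @ map ((`) (m_inv G)) Ys)" "lprod G zs = \<one>"
    using assms(3) unfolding mem_lset_mult by blast
  then obtain xs us where zs: "zs = xs @ us" "list_all2 (\<in>) xs Xs"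
      "list_all2 (\<in>) us (map ((`) (m_inv G)) Ys)"
    by (auto simp: list_all2_append2)
  have xs: "set xs \<subseteq> carrier G"
    using zs(2) assms(1) by (auto simp: list_all2_conv_all_nth in_set_conv_nth) (meson nth_mem subsetD)
  have us: "us ! i \<in> m_inv G ` (Ys ! i)" if "i < length Ys" for i
    using zs(3) that by (auto simp: list_all2_conv_all_nth)
  have len: "length us = length Ys" using zs(3) by (auto dest: list_all2_lengthD)
  have us': "us ! i \<in> carrier G \<and> inv (us ! i) \<in> Ys ! i" if "i < length Ys" for i
  proof -
    from us[OF that] obtain y where "y \<in> Ys ! i" "us ! i = inv y" by blast
    moreover have "Ys ! i \<subseteq> carrier G" using assms(2) that by auto
    ultimately show ?thesis by auto
  qed
  then have usc: "set us \<subseteq> carrier G" using len by (auto simp: in_set_conv_nth)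
  let ?ys = "map (m_inv G) us"
  have "lprod G xs \<otimes> lprod G us = \<one>"
    using \<open>lprod G zs = \<one>\<close> zs(1) xs usc by (simp add: lprod_append)
  then have "lprod G xs = lprod G ?ys"
    using xs usc by (simp add: lprod_inv inv_equality[symmetric])
  moreover have "list_all2 (\<in>) ?ys Ys"
    using us' len by (auto simp: list_all2_conv_all_nth)
  ultimately show ?thesis using zs(2) by blast
qed

text \<open>Inversion preserves cardinalities, so the factors on either side of the equation count
  equally and only their total size matters.\<close>

lemma exists_equal_lprod:
  fixes M :: real
  assumes "finite (carrier G)"
    and "\<And>K. subgroup K G \<Longrightarrow> K \<noteq> carrier G \<Longrightarrow> real (card K) \<le> M" and "0 \<le> M"
    and "\<forall>X\<in>set Xs. X \<subseteq> carrier G \<and> X \<noteq> {}" and "\<forall>Y\<in>set Ys. Y \<subseteq> carrier G \<and> Y \<noteq> {}"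
    and "Xs \<noteq> []"
    and "real (card (carrier G)) \<le>
      (\<Sum>X\<leftarrow>Xs @ Ys. real (card X)) - (real (length (Xs @ Ys)) - 1) * M"
  shows "\<exists>xs ys. list_all2 (\<in>) xs Xs \<and> list_all2 (\<in>) ys Ys \<and> lprod G xs = lprod G ys"
proof (rule lprod_eq_if_one_mem)
  let ?L = "Xs @ map ((`) (m_inv G)) Ys"
  have "map (\<lambda>Y. card (m_inv G ` Y)) Ys = map card Ys"
    using assms(5) by (auto intro!: card_inv_image)
  then have "(\<Sum>X\<leftarrow>?L. real (card X)) = (\<Sum>X\<leftarrow>Xs @ Ys. real (card X))"
    by (simp add: o_def) (metis (no_types, lifting) map_eq_conv)
  then have "lset_mult G ?L = carrier G"
    using assms by (intro lset_mult_eq_carrier[of M]) (auto simp: subset_iff)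
  then show "\<one> \<in> lset_mult G ?L" by simp
qed (use assms in auto)

text \<open>The two large sets may occupy any two positions, on the same side of the equation or on
  opposite ones. The combined list is therefore cut between them, at a place unrelated to the
  boundary between \<open>Xs\<close> and \<open>Ys\<close>; the products of the two pieces are at
  least as large as \<open>U\<close> and \<open>V\<close>, and together they fill the group.\<close>

lemma exists_equal_lprod_pair:
  assumes fin: "finite (carrier G)"
    and Xs: "\<forall>X\<in>set Xs. X \<subseteq> carrier G \<and> X \<noteq> {}" and Ys: "\<forall>Y\<in>set Ys. Y \<subseteq> carrier G \<and> Y \<noteq> {}"
    and zs: "Xs @ Ys = Us @ Vs" "U \<in> set Us" "V \<in> set Vs" "card (carrier G) < card U + card V"
  shows "\<exists>xs ys. list_all2 (\<in>) xs Xs \<and> list_all2 (\<in>) ys Ys \<and> lprod G xs = lprod G ys"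
proof (rule lprod_eq_if_one_mem)
  let ?L = "Xs @ map ((`) (m_inv G)) Ys"
  let ?Us = "take (length Us) ?L" and ?Vs = "drop (length Us) ?L"
  have *: "\<exists>j<length ?L. j = i \<and> card (?L ! j) = card ((Xs @ Ys) ! i)" if "i < length (Xs @ Ys)" for i
    using that Ys by (auto simp: nth_append intro!: card_inv_image)
  obtain i where i: "i < length Us" "U = Us ! i" using zs by (metis in_set_conv_nth)
  obtain j where j: "j < length Vs" "V = Vs ! j" using zs by (metis in_set_conv_nth)
  have len: "length Xs + length Ys = length Us + length Vs" using zs(1) by (metis length_append)
  have "(Xs @ Ys) ! i = U" using i zs(1) by (simp add: nth_append)
  moreover have "(Xs @ Ys) ! (length Us + j) = V" using j zs(1) by (simp add: nth_append)
  ultimately have c: "card (?L ! i) = card U" "card (?L ! (length Us + j)) = card V"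
    using *[of i] *[of "length Us + j"] i j len by auto
  have "?Us ! i = ?L ! i" "i < length ?Us"
    using i len by (simp_all only: nth_take length_take length_append length_map)
  then have "?L ! i \<in> set ?Us" by (metis nth_mem)
  moreover have "?Vs ! j = ?L ! (length Us + j)" "j < length ?Vs"
    using j len by (simp_all only: nth_drop length_drop length_append length_map)
  then have "?L ! (length Us + j) \<in> set ?Vs" by (metis nth_mem)
  moreover have "\<forall>X\<in>set ?L. X \<subseteq> carrier G \<and> X \<noteq> {}" using Xs Ys by (auto simp: subset_iff)
  moreover from this have "\<forall>X\<in>set ?Us. X \<subseteq> carrier G \<and> X \<noteq> {}" "\<forall>X\<in>set ?Vs. X \<subseteq> carrier G \<and> X \<noteq> {}"
    by (metis in_set_takeD, metis in_set_dropD)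
  ultimately have "lset_mult G (?Us @ ?Vs) = carrier G"
    using zs(4) c lset_mult_eq_carrier_pair[OF fin, of ?Us ?Vs "?L ! i" "?L ! (length Us + j)"] by metis
  then show "\<one> \<in> lset_mult G ?L" by (simp only: append_take_drop_id one_closed)
qed (use assms in auto)

text \<open>Functions on an index set become lists, which can be concatenated, cut and used in
  inductions.\<close>

lemma hfold_eq_lprod:
  assumes "X \<subseteq> carrier G"
  shows "hfold G h X = lprod G ` {xs. set xs \<subseteq> X \<and> length xs = h}"
proof (induction h)
  case 0
  have *: "{xs. set xs \<subseteq> X \<and> length xs = 0} = {[]}" by auto
  show ?case unfolding * by (auto simp: hfold_def)
next
  case (Suc h)
  have "hfold G (Suc h) X = X <#> hfold G h X"
  proof
    show "hfold G (Suc h) X \<subseteq> X <#> hfold G h X"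
    proof
      fix z assume "z \<in> hfold G (Suc h) X"
      then obtain x where x: "z = finprod G x {..<Suc h}" "x \<in> {..<Suc h} \<rightarrow> X"
        by (auto simp: hfold_def)
      then have "z = x h \<otimes> finprod G x {..<h}"
        using assms by (subst x(1), subst lessThan_Suc, subst finprod_insert) (auto simp: Pi_iff subset_iff)
      moreover have "x h \<in> X" "x \<in> {..<h} \<rightarrow> X" using x(2) by auto
      ultimately show "z \<in> X <#> hfold G h X" unfolding set_mult_def hfold_def by blast
    qed
    show "X <#> hfold G h X \<subseteq> hfold G (Suc h) X"
    proof
      fix z assume "z \<in> X <#> hfold G h X"
      then obtain u x where u: "u \<in> X" "x \<in> {..<h} \<rightarrow> X" "z = u \<otimes> finprod G x {..<h}"
        by (auto simp: set_mult_def hfold_def)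
      define y where "y = x(h := u)"
      have y: "y \<in> {..<Suc h} \<rightarrow> X" using u by (auto simp: y_def Pi_iff)
      have "finprod G y {..<h} = finprod G x {..<h}"
        using u assms by (intro finprod_cong') (auto simp: y_def Pi_iff subset_iff)
      then have "finprod G y {..<Suc h} = z"
        using y u assms by (subst lessThan_Suc, subst finprod_insert) (auto simp: Pi_iff subset_iff y_def)
      then show "z \<in> hfold G (Suc h) X" using y by (auto simp: hfold_def)
    qed
  qed
  also have "\<dots> = lprod G ` {xs. set xs \<subseteq> X \<and> length xs = Suc h}"
  proof -
    have "{xs. set xs \<subseteq> X \<and> length xs = Suc h}
        = (\<lambda>(x, xs). x # xs) ` (X \<times> {xs. set xs \<subseteq> X \<and> length xs = h})"
      by (auto simp: length_Suc_conv image_iff)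
    then have "lprod G ` {xs. set xs \<subseteq> X \<and> length xs = Suc h}
        = (\<lambda>(x, xs). x \<otimes> lprod G xs) ` (X \<times> {xs. set xs \<subseteq> X \<and> length xs = h})"
      by (simp only: image_image case_prod_unfold lprod_simps)
    also have "\<dots> = X <#> lprod G ` {xs. set xs \<subseteq> X \<and> length xs = h}"
      unfolding set_mult_def by auto
    finally show ?thesis unfolding Suc ..
  qed
  finally show ?case .
qed

end

section \<open>Slices of subsets of \<open>F\<^sub>p\<^sup>n\<close>\<close>

lemma carrier_Fp [simp]: "carrier (Fp p) = {0..int p - 1}"
  and add_Fp [simp]: "x \<oplus>\<^bsub>Fp p\<^esub> y = (x + y) mod int p"
  and zero_Fp [simp]: "\<zero>\<^bsub>Fp p\<^esub> = 0"
  and mult_Fp [simp]: "x \<otimes>\<^bsub>Fp p\<^esub> y = (x * y) mod int p"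
  by (simp_all add: Fp_def residue_ring_def)

lemma comm_group_Fp:
  assumes "prime p"
  shows "comm_group (add_monoid (Fp p))"
proof -
  interpret residues_prime p "Fp p" using assms by unfold_locales (simp_all add: Fp_def)
  show ?thesis by (rule a_comm_group)
qed

lemma lprod_Fp: "lprod (add_monoid (Fp p)) xs = sum_list xs mod int p"
  by (induction xs) (auto simp: mod_simps)

lemma carrier_Fpn [simp]: "carrier (Fpn p n) = (\<Pi>\<^sub>E i\<in>{..<n}. {0..int p - 1})"
  and mult_Fpn [simp]: "x \<otimes>\<^bsub>Fpn p n\<^esub> y = (\<lambda>i\<in>{..<n}. (x i + y i) mod int p)"
  and one_Fpn [simp]: "\<one>\<^bsub>Fpn p n\<^esub> = (\<lambda>i\<in>{..<n}. 0)"
  by (simp_all add: Fpn_def)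

lemma comm_group_Fpn:
  assumes "prime p"
  shows "comm_group (Fpn p n)"
proof -
  interpret F: comm_group "add_monoid (Fp p)" using assms by (rule comm_group_Fp)
  have "group (Fpn p n)" unfolding Fpn_def by (rule product_group) (rule F.group_axioms)
  then show ?thesis
    by (rule group.group_comm_groupI) (auto simp: add.commute intro: restrict_ext)
qed

lemma finite_Fpn: "finite (carrier (Fpn p n))"
  by (auto intro: finite_PiE)

lemma card_Fpn: "card (carrier (Fpn p n)) = p ^ n"
  by (simp add: card_PiE)

lemma lprod_Fpn:
  "lprod (Fpn p n) xs = (\<lambda>i\<in>{..<n}. (\<Sum>x\<leftarrow>xs. x i) mod int p)"
  by (induction xs) (auto simp: mod_simps intro!: restrict_ext)

text \<open>By Lagrange's theorem the order of a subgroup is a power of \<open>p\<close>, so a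
  proper subgroup loses at least one factor \<open>p\<close>.\<close>

lemma card_proper_subgroup_le:
  assumes "comm_group G" "finite (carrier G)" "card (carrier G) = p ^ d" "prime p"
    and "subgroup K G" "K \<noteq> carrier G"
  shows "real (card K) \<le> real (p ^ d) / real p"
proof -
  interpret comm_group G by fact
  have "card K dvd p ^ d"
    using lagrange[OF assms(5)] assms(3) by (metis dvd_triv_right order_def)
  then obtain i where i: "i \<le> d" "card K = p ^ i"
    using assms(4) divides_primepow_nat by blast
  have "i \<noteq> d"
    using i assms card_subset_eq[OF assms(2), of K] subgroup.subset[OF assms(5)] by auto
  then have "card K * p dvd p ^ d"
    using i by (metis Suc_leI le_eq_less_or_eq le_imp_power_dvd power_Suc2)
  then have "card K * p \<le> p ^ d" using assms(4) by (simp add: dvd_imp_le prime_gt_0_nat)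
  then have "real (card K) * real p \<le> real (p ^ d)"
    by (metis of_nat_le_iff of_nat_mult)
  then show ?thesis using assms(4) by (simp add: field_simps prime_gt_0_nat)
qed

lemma card_proper_subgroup_Fp:
  assumes "prime p" "subgroup K (add_monoid (Fp p))" "K \<noteq> carrier (add_monoid (Fp p))"
  shows "real (card K) \<le> 1"
  using card_proper_subgroup_le[OF comm_group_Fp[OF assms(1)], of p 1] assms
  by (auto simp: prime_gt_0_nat)

text \<open>In a group of prime order the proper subgroups are trivial, so the covering statement
  with \<open>M = 1\<close> is the Cauchy--Davenport theorem for many summands.\<close>

lemma exists_equal_sums:
  assumes "prime p"
    and "\<forall>X\<in>set (Xs @ Ys). X \<subseteq> {0..<int p} \<and> X \<noteq> {}" and "Xs \<noteq> []"
    and "int p - 1 \<le> (\<Sum>X\<leftarrow>Xs @ Ys. int (card X) - 1)"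
  shows "\<exists>xs ys. list_all2 (\<in>) xs Xs \<and> list_all2 (\<in>) ys Ys \<and>
    sum_list xs mod int p = sum_list ys mod int p"
proof -
  interpret F: comm_group "add_monoid (Fp p)" using assms(1) by (rule comm_group_Fp)
  have c: "carrier (add_monoid (Fp p)) = {0..<int p}" by auto
  have "(\<Sum>X\<leftarrow>L. int (card X) - 1) = (\<Sum>X\<leftarrow>L. int (card X)) - int (length L)" for L :: "int set list"
    by (induction L) auto
  moreover have "real_of_int (\<Sum>X\<leftarrow>L. int (card X)) = (\<Sum>X\<leftarrow>L. real (card X))" for L :: "int set list"
    by (induction L) auto
  ultimately have "real p \<le> (\<Sum>X\<leftarrow>Xs @ Ys. real (card X)) - (real (length (Xs @ Ys)) - 1) * 1"
    using assms(4) by (smt (verit) of_int_diff of_int_le_iff of_int_of_nat_eq of_int_1 mult.right_neutral)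
  then show ?thesis
    using F.exists_equal_lprod[of 1 Xs Ys] card_proper_subgroup_Fp[OF assms(1)] assms(2,3)
    unfolding c lprod_Fp by auto
qed

section \<open>Splitting off the first coordinate\<close>

definition vcons :: "nat \<Rightarrow> int \<Rightarrow> (nat \<Rightarrow> int) \<Rightarrow> nat \<Rightarrow> int" where
  "vcons n x v = (\<lambda>i\<in>{..<n}. case i of 0 \<Rightarrow> x | Suc j \<Rightarrow> v j)"

definition vtail :: "nat \<Rightarrow> (nat \<Rightarrow> int) \<Rightarrow> nat \<Rightarrow> int" where
  "vtail n z = (\<lambda>i\<in>{..<n - 1}. z (Suc i))"

definition slice :: "nat \<Rightarrow> nat \<Rightarrow> (nat \<Rightarrow> int) set \<Rightarrow> int \<Rightarrow> (nat \<Rightarrow> int) set" where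
  "slice p n A x = {v \<in> carrier (Fpn p (n - 1)). vcons n x v \<in> A}"

definition supp :: "(nat \<Rightarrow> int) set \<Rightarrow> int set" where
  "supp A = (\<lambda>z. z 0) ` A"

lemma vcons_0 [simp]: "n \<ge> 1 \<Longrightarrow> vcons n x v 0 = x"
  by (simp add: vcons_def)

lemma vtail_vcons: "v \<in> carrier (Fpn p (n - 1)) \<Longrightarrow> vtail n (vcons n x v) = v"
  by (rule extensionalityI[of _ "{..<n - 1}"])
     (auto simp: vtail_def vcons_def PiE_iff)

lemma vcons_vtail: "n \<ge> 1 \<Longrightarrow> z \<in> carrier (Fpn p n) \<Longrightarrow> vcons n (z 0) (vtail n z) = z"
  by (rule extensionalityI[of _ "{..<n}"])
     (auto simp: vtail_def vcons_def PiE_iff split: nat.split)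

lemma vtail_closed: "n \<ge> 1 \<Longrightarrow> z \<in> carrier (Fpn p n) \<Longrightarrow> vtail n z \<in> carrier (Fpn p (n - 1))"
  by (auto simp: vtail_def PiE_iff)

lemma vcons_closed:
  "n \<ge> 1 \<Longrightarrow> x \<in> {0..<int p} \<Longrightarrow> v \<in> carrier (Fpn p (n - 1)) \<Longrightarrow> vcons n x v \<in> carrier (Fpn p n)"
  by (auto simp: vcons_def PiE_iff split: nat.split)

lemma mem_slice:
  assumes "n \<ge> 1" "A \<subseteq> carrier (Fpn p n)" "z \<in> A"
  shows "vtail n z \<in> slice p n A (z 0)"
  using assms vcons_vtail[of n z p] vtail_closed[of n z p] by (auto simp: slice_def simp del: carrier_Fpn)

lemma slice_subset: "slice p n A x \<subseteq> carrier (Fpn p (n - 1))"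
  by (auto simp: slice_def)

lemma finite_slice: "finite (slice p n A x)"
  using slice_subset finite_Fpn by (rule finite_subset)

lemma card_slice_le: "card (slice p n A x) \<le> p ^ (n - 1)"
  using card_mono[OF finite_Fpn slice_subset] by (simp only: card_Fpn)

lemma slice_nonempty_iff:
  assumes "n \<ge> 1" "A \<subseteq> carrier (Fpn p n)"
  shows "slice p n A x \<noteq> {} \<longleftrightarrow> x \<in> supp A"
proof
  assume "slice p n A x \<noteq> {}"
  then obtain v where "vcons n x v \<in> A" by (auto simp: slice_def)
  then have "vcons n x v 0 \<in> supp A" unfolding supp_def by (rule imageI)
  then show "x \<in> supp A" using assms by simp
next
  assume "x \<in> supp A"
  then show "slice p n A x \<noteq> {}" using mem_slice[OF assms] by (auto simp: supp_def)
qed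

lemma supp_subset:
  assumes "n \<ge> 1" "A \<subseteq> carrier (Fpn p n)"
  shows "supp A \<subseteq> {0..<int p}"
  using assms by (force simp: supp_def PiE_iff)

lemma finite_supp: "n \<ge> 1 \<Longrightarrow> A \<subseteq> carrier (Fpn p n) \<Longrightarrow> finite (supp A)"
  using supp_subset by (rule finite_subset) auto

lemma card_eq_sum_slices:
  assumes n: "n \<ge> 1" and A: "A \<subseteq> carrier (Fpn p n)"
  shows "card A = (\<Sum>x\<in>supp A. card (slice p n A x))"
proof -
  have "bij_betw (\<lambda>z. (z 0, vtail n z)) A (SIGMA x:supp A. slice p n A x)"
  proof (rule bij_betwI[where g = "\<lambda>(x, v). vcons n x v"])
    show "(\<lambda>z. (z 0, vtail n z)) \<in> A \<rightarrow> (SIGMA x:supp A. slice p n A x)"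
      using mem_slice[OF n A] by (auto simp: supp_def)
  qed (use n A vcons_vtail vtail_vcons in \<open>auto simp: slice_def simp del: carrier_Fpn\<close>)
  then have "card A = card (SIGMA x:supp A. slice p n A x)" by (rule bij_betw_same_card)
  then show ?thesis using finite_slice by (simp add: finite_supp[OF n A])
qed

lemma lprod_vcons:
  assumes "n \<ge> 1" "length xs = length vs"
  shows "lprod (Fpn p n) (map2 (vcons n) xs vs)
    = vcons n (sum_list xs mod int p) (lprod (Fpn p (n - 1)) vs)"
proof -
  have "(\<Sum>z\<leftarrow>map2 (vcons n) xs vs. z i) = (case i of 0 \<Rightarrow> sum_list xs | Suc j \<Rightarrow> (\<Sum>v\<leftarrow>vs. v j))"
    if "i < n" for i
    using assms(2) that by (induction xs vs rule: list_induct2) (auto simp: vcons_def split: nat.splits)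
  then have "lprod (Fpn p n) (map2 (vcons n) xs vs)
    = (\<lambda>i\<in>{..<n}. (case i of 0 \<Rightarrow> sum_list xs | Suc j \<Rightarrow> (\<Sum>v\<leftarrow>vs. v j)) mod int p)"
    unfolding lprod_Fpn by (intro restrict_ext) simp
  then show ?thesis
    unfolding lprod_Fpn by (auto simp: vcons_def restrict_def fun_eq_iff split: nat.split)
qed

lemma sum_free_lists:
  assumes "prime p"
  shows "sum_free p n k l A \<longleftrightarrow> A \<noteq> {} \<and> A \<subseteq> carrier (Fpn p n) \<and>
    \<not> (\<exists>xs ys. set xs \<subseteq> A \<and> set ys \<subseteq> A \<and> length xs = k \<and> length ys = l \<and>
      lprod (Fpn p n) xs = lprod (Fpn p n) ys)"
proof -
  interpret G: comm_group "Fpn p n" using assms by (rule comm_group_Fpn)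
  show ?thesis
    unfolding sum_free_def using G.hfold_eq_lprod[of A] by (auto simp del: carrier_Fpn) blast
qed

lemma sum_free_slices:
  assumes p: "prime p" and n: "n \<ge> 1" and sf: "sum_free p n k l A"
    and xs: "length xs = k" "set xs \<subseteq> supp A" and ys: "length ys = l" "set ys \<subseteq> supp A"
    and eq: "sum_list xs mod int p = sum_list ys mod int p"
    and vs: "list_all2 (\<in>) vs (map (slice p n A) xs)" and ws: "list_all2 (\<in>) ws (map (slice p n A) ys)"
  shows "lprod (Fpn p (n - 1)) vs \<noteq> lprod (Fpn p (n - 1)) ws"
proof
  assume *: "lprod (Fpn p (n - 1)) vs = lprod (Fpn p (n - 1)) ws"
  have len: "length xs = length vs" "length ys = length ws"
    using vs ws by (auto dest: list_all2_lengthD)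
  have "set (map2 (vcons n) xs vs) \<subseteq> A" "set (map2 (vcons n) ys ws) \<subseteq> A"
    using vs ws by (auto simp: list_all2_conv_all_nth set_zip slice_def)
  moreover have "lprod (Fpn p n) (map2 (vcons n) xs vs) = lprod (Fpn p n) (map2 (vcons n) ys ws)"
    using * eq len n by (simp only: lprod_vcons)
  moreover have "length (map2 (vcons n) xs vs) = k" "length (map2 (vcons n) ys ws) = l"
    using len xs ys by auto
  ultimately show False using sf unfolding sum_free_lists[OF p] by blast
qed

text \<open>Proper subgroups of the group that contains the slices have index at least
  \<open>p\<close>, so each of the \<open>k + l - 1\<close> additions loses at most the fraction
  \<open>1 / p\<close> of its order. Slices of a larger total size would contain a solution.\<close>

lemma sum_card_slices_less:
  assumes p: "prime p" and n: "n \<ge> 1" and sf: "sum_free p n k l A" and k: "k \<ge> 1"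
    and xs: "length xs = k" "set xs \<subseteq> supp A" and ys: "length ys = l" "set ys \<subseteq> supp A"
    and eq: "sum_list xs mod int p = sum_list ys mod int p"
  shows "(\<Sum>x\<leftarrow>xs @ ys. real (card (slice p n A x)))
    < real (p ^ (n - 1)) * (1 + (real (k + l) - 1) / real p)"
proof (rule ccontr)
  assume *: "\<not> ?thesis"
  let ?H = "Fpn p (n - 1)"
  interpret H: comm_group ?H using p by (rule comm_group_Fpn)
  let ?M = "real (p ^ (n - 1)) / real p"
  have A: "A \<subseteq> carrier (Fpn p n)" using sf by (simp only: sum_free_def)
  have sl: "\<forall>X\<in>set (map (slice p n A) zs). X \<subseteq> carrier ?H \<and> X \<noteq> {}" if "set zs \<subseteq> supp A" for zs
    using that slice_nonempty_iff[OF n A] slice_subset by (auto simp del: carrier_Fpn)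
  have "\<exists>vs ws. list_all2 (\<in>) vs (map (slice p n A) xs) \<and> list_all2 (\<in>) ws (map (slice p n A) ys)
      \<and> lprod ?H vs = lprod ?H ws"
  proof (rule H.exists_equal_lprod[of ?M])
    show "real (card (carrier ?H)) \<le> (\<Sum>X\<leftarrow>map (slice p n A) xs @ map (slice p n A) ys. real (card X)) -
        (real (length (map (slice p n A) xs @ map (slice p n A) ys)) - 1) * ?M"
      using * xs ys by (simp add: card_Fpn o_def algebra_simps del: carrier_Fpn)
  qed (use sl xs ys k card_proper_subgroup_le[OF H.comm_group_axioms finite_Fpn card_Fpn p] finite_Fpn
       in \<open>auto simp del: carrier_Fpn\<close>)
  then show False using sum_free_slices[OF p n sf xs ys eq] by blast
qed

lemma card_slices_pair_le:
  assumes p: "prime p" and n: "n \<ge> 1" and sf: "sum_free p n k l A"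
    and xs: "length xs = k" "set xs \<subseteq> supp A" and ys: "length ys = l" "set ys \<subseteq> supp A"
    and eq: "sum_list xs mod int p = sum_list ys mod int p"
    and uv: "xs @ ys = us @ vs" "x \<in> set us" "y \<in> set vs"
  shows "card (slice p n A x) + card (slice p n A y) \<le> p ^ (n - 1)"
proof (rule ccontr)
  assume *: "\<not> ?thesis"
  let ?H = "Fpn p (n - 1)"
  interpret H: comm_group ?H using p by (rule comm_group_Fpn)
  have A: "A \<subseteq> carrier (Fpn p n)" using sf by (simp only: sum_free_def)
  have sl: "\<forall>X\<in>set (map (slice p n A) zs). X \<subseteq> carrier ?H \<and> X \<noteq> {}" if "set zs \<subseteq> supp A" for zs
    using that slice_nonempty_iff[OF n A] slice_subset by (auto simp del: carrier_Fpn)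
  have "map (slice p n A) xs @ map (slice p n A) ys = map (slice p n A) us @ map (slice p n A) vs"
    using uv(1) by (metis map_append)
  then have "\<exists>vs ws. list_all2 (\<in>) vs (map (slice p n A) xs) \<and> list_all2 (\<in>) ws (map (slice p n A) ys)
      \<and> lprod ?H vs = lprod ?H ws"
    by (rule H.exists_equal_lprod_pair[OF finite_Fpn sl[OF xs(2)] sl[OF ys(2)],
        of _ _ "slice p n A x" "slice p n A y"])
       (use uv * in \<open>auto simp: card_Fpn simp del: carrier_Fpn\<close>)
  then show False using sum_free_slices[OF p n sf xs ys eq] by blast
qed

section \<open>Automorphisms of the vector space and transport of sum-freeness\<close>

lemma iso_FpnI:
  assumes p: "prime p"
    and "\<And>z. z \<in> carrier (Fpn p n) \<Longrightarrow> \<phi> z = (\<lambda>t\<in>{..<n}. (\<Sum>s<n. M t s * z s) mod int p)"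
    and "\<And>z w. z \<in> carrier (Fpn p n) \<Longrightarrow> w \<in> carrier (Fpn p n) \<Longrightarrow> \<phi> z = \<phi> w \<Longrightarrow> z = w"
  shows "\<phi> \<in> iso (Fpn p n) (Fpn p n)"
proof -
  interpret G: comm_group "Fpn p n" using p by (rule comm_group_Fpn)
  have p0: "int p > 0" using p prime_gt_0_nat by simp
  have closed: "\<phi> z \<in> carrier (Fpn p n)" if "z \<in> carrier (Fpn p n)" for z
    using assms(2)[OF that] p0 by auto
  have "\<phi> (z \<otimes>\<^bsub>Fpn p n\<^esub> w) = \<phi> z \<otimes>\<^bsub>Fpn p n\<^esub> \<phi> w" if zw: "z \<in> carrier (Fpn p n)" "w \<in> carrier (Fpn p n)" for z w
  proof -
    have "(\<Sum>s<n. M t s * ((z s + w s) mod int p)) mod int p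
      = ((\<Sum>s<n. M t s * z s) mod int p + (\<Sum>s<n. M t s * w s) mod int p) mod int p" for t
    proof -
      have "(\<Sum>s<n. M t s * ((z s + w s) mod int p)) mod int p
        = (\<Sum>s<n. (M t s * ((z s + w s) mod int p)) mod int p) mod int p"
        by (rule mod_sum_eq[symmetric])
      also have "\<dots> = (\<Sum>s<n. (M t s * (z s + w s)) mod int p) mod int p"
        by (simp add: mod_simps)
      also have "\<dots> = (\<Sum>s<n. M t s * (z s + w s)) mod int p" by (rule mod_sum_eq)
      also have "\<dots> = ((\<Sum>s<n. M t s * z s) + (\<Sum>s<n. M t s * w s)) mod int p"
        by (simp add: sum.distrib algebra_simps)
      finally show ?thesis by (simp add: mod_simps)
    qed
    then show ?thesis
      using assms(2)[OF G.m_closed[OF zw]] assms(2)[OF zw(1)] assms(2)[OF zw(2)]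
      by (simp only: mult_Fpn) (simp add: restrict_def fun_eq_iff)
  qed
  then have "\<phi> \<in> hom (Fpn p n) (Fpn p n)" unfolding hom_def using closed by blast
  moreover have "inj_on \<phi> (carrier (Fpn p n))" using assms(3) by (rule inj_onI)
  \<comment> \<open>An injective endomorphism of a finite group is onto, so no inverse matrix has to
    be exhibited.\<close>
  moreover have "\<phi> ` carrier (Fpn p n) = carrier (Fpn p n)"
    using closed \<open>inj_on \<phi> (carrier (Fpn p n))\<close>
    by (intro endo_inj_surj[OF finite_Fpn]) (simp_all only: image_subset_iff, blast)
  ultimately show ?thesis by (simp add: iso_def bij_betw_def del: carrier_Fpn)
qed

lemma isomorphic_sets_trans:
  assumes "isomorphic_sets p n A B" "isomorphic_sets p n B C"
  shows "isomorphic_sets p n A C"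
proof -
  obtain \<phi> \<psi> where "\<phi> \<in> iso (Fpn p n) (Fpn p n)" "\<phi> ` A = B" "\<psi> \<in> iso (Fpn p n) (Fpn p n)" "\<psi> ` B = C"
    using assms unfolding isomorphic_sets_def by blast
  then have "\<psi> \<circ> \<phi> \<in> iso (Fpn p n) (Fpn p n)" "(\<psi> \<circ> \<phi>) ` A = C"
    by (blast intro: iso_set_trans, auto)
  then show ?thesis unfolding isomorphic_sets_def by blast
qed

lemma iso_card:
  assumes "\<phi> \<in> iso (Fpn p n) (Fpn p n)" "A \<subseteq> carrier (Fpn p n)"
  shows "card (\<phi> ` A) = card A"
proof (rule card_image)
  have "inj_on \<phi> (carrier (Fpn p n))" using assms(1) unfolding iso_def bij_betw_def by blast
  then show "inj_on \<phi> A" using assms(2) by (rule inj_on_subset)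
qed

lemma iso_sum_free:
  assumes p: "prime p" and iso: "\<phi> \<in> iso (Fpn p n) (Fpn p n)" and sf: "sum_free p n k l A"
  shows "sum_free p n k l (\<phi> ` A)"
proof -
  let ?G = "Fpn p n"
  interpret G: comm_group ?G using p by (rule comm_group_Fpn)
  have A: "A \<noteq> {}" "A \<subseteq> carrier ?G" using sf by (auto simp only: sum_free_def)
  have hom: "\<phi> \<in> hom ?G ?G" and inj: "inj_on \<phi> (carrier ?G)" and closed: "\<phi> ` carrier ?G = carrier ?G"
    using iso by (auto simp: iso_def bij_betw_def simp del: carrier_Fpn)
  have hom_lprod: "\<phi> (lprod ?G xs) = lprod ?G (map \<phi> xs)" if "set xs \<subseteq> A" for xs
    using that
  proof (induction xs)
    case Nil
    have "\<phi> \<one>\<^bsub>?G\<^esub> = \<one>\<^bsub>?G\<^esub>" using hom G.group_axioms G.group_axioms by (rule hom_one)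
    then show ?case by (simp del: one_Fpn)
  next
    case (Cons x xs)
    then have "x \<in> carrier ?G" "lprod ?G xs \<in> carrier ?G" using A by (auto simp del: carrier_Fpn intro!: G.lprod_closed)
    then show ?case using Cons hom by (simp add: hom_def del: carrier_Fpn mult_Fpn)
  qed
  have ex: "\<exists>us. xs = map \<phi> us \<and> set us \<subseteq> A" if "set xs \<subseteq> \<phi> ` A" for xs
    using that
  proof (induction xs)
    case (Cons x xs)
    then obtain u us where "x = \<phi> u" "u \<in> A" "xs = map \<phi> us" "set us \<subseteq> A" by auto
    then show ?case by (intro exI[of _ "u # us"]) simp
  qed simp
  show ?thesis unfolding sum_free_lists[OF p]
  proof (intro conjI notI)
    show "\<phi> ` A \<subseteq> carrier ?G" using A closed by blast
    assume "\<exists>xs ys. set xs \<subseteq> \<phi> ` A \<and> set ys \<subseteq> \<phi> ` A \<and> length xs = k \<and> length ys = l \<and> lprod ?G xs = lprod ?G ys"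
    then obtain us vs where uv: "set us \<subseteq> A" "set vs \<subseteq> A" "length us = k" "length vs = l"
        "lprod ?G (map \<phi> us) = lprod ?G (map \<phi> vs)"
      using ex by (metis length_map)
    then have "\<phi> (lprod ?G us) = \<phi> (lprod ?G vs)" using hom_lprod by simp
    then have "lprod ?G us = lprod ?G vs"
      using inj uv A by (meson G.lprod_closed inj_onD order_trans)
    then show False using sf uv unfolding sum_free_lists[OF p] by blast
  qed (use A in simp)
qed

section \<open>Fourier coefficients of sum-free sets\<close>

definition chr :: "nat \<Rightarrow> int \<Rightarrow> complex" where
  "chr p t = cis (2 * pi * real_of_int t / real p)"

definition dot :: "nat \<Rightarrow> (nat \<Rightarrow> int) \<Rightarrow> (nat \<Rightarrow> int) \<Rightarrow> int" where
  "dot n c z = (\<Sum>s<n. c s * z s)"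

lemma chr_0 [simp]: "chr p 0 = 1"
  by (simp add: chr_def)

lemma norm_chr [simp]: "norm (chr p t) = 1"
  by (simp add: chr_def)

lemma chr_add: "chr p (s + t) = chr p s * chr p t"
  by (simp add: chr_def cis_mult ring_distribs add_divide_distrib)

lemma cnj_chr: "cnj (chr p t) = chr p (- t)"
  by (simp add: chr_def cis_cnj)

lemma chr_mult_p: "p > 0 \<Longrightarrow> chr p (int p * t) = 1"
proof -
  assume "p > 0"
  then have "2 * pi * real_of_int (int p * t) / real p = 2 * pi * real_of_int t" by simp
  then show ?thesis by (simp add: chr_def cis_multiple_2pi)
qed

lemma chr_mod: "p > 0 \<Longrightarrow> chr p (t mod int p) = chr p t"
  by (metis chr_add chr_mult_p mod_mult_div_eq mult.right_neutral)

lemma chr_cong: "p > 0 \<Longrightarrow> s mod int p = t mod int p \<Longrightarrow> chr p s = chr p t"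
  by (metis chr_mod)

lemma chr_mult_nat: "chr p (t * int i) = chr p t ^ i"
  by (induction i) (auto simp: chr_add ring_distribs)

lemma chr_eq_1: 
  assumes "p > 0" "chr p t = 1"
  shows "int p dvd t"
proof -
  have "cos (2 * pi * real_of_int t / real p) = 1"
    using arg_cong[OF assms(2), of Re] by (simp add: chr_def)
  then obtain i :: int where "2 * pi * real_of_int t / real p = real_of_int i * 2 * pi"
    by (auto simp: cos_one_2pi_int)
  then have "real_of_int t = real_of_int (i * int p)"
    using assms(1) by (simp add: field_simps)
  then have "t = i * int p" by (simp only: of_int_eq_iff)
  then show ?thesis by simp
qed

lemma sum_chr:
  assumes "p > 0"
  shows "(\<Sum>t\<in>{0..int p - 1}. chr p (t * w)) = (if int p dvd w then of_nat p else 0)"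
proof -
  have "{0..int p - 1} = int ` {..<p}"
    by (auto simp: image_iff) (metis nat_less_iff lessThan_iff nat_0_le zle_diff1_eq)
  then have "(\<Sum>t\<in>{0..int p - 1}. chr p (t * w)) = (\<Sum>i<p. chr p w ^ i)"
    by (simp add: sum.reindex mult.commute chr_mult_nat)
  also have "\<dots> = (if int p dvd w then of_nat p else 0)"
  proof (cases "chr p w = 1")
    case True
    then show ?thesis using chr_eq_1[OF assms True] by simp
  next
    case False
    have "chr p w ^ p = 1" using chr_mult_nat[of p w p] chr_mult_p[OF assms, of w] by (simp add: mult.commute)
    moreover have "\<not> int p dvd w" using False chr_mult_p[OF assms] by (auto simp: dvd_def)
    ultimately show ?thesis using False geometric_sum[OF False, of p] by simp
  qed
  finally show ?thesis .
qed

lemma chr_dot: "chr p (dot n c w) = (\<Prod>s<n. chr p (c s * w s))"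
proof -
  have "chr p (\<Sum>s\<in>I. f s) = (\<Prod>s\<in>I. chr p (f s))" if "finite I" for I :: "nat set" and f
    using that by induction (auto simp: chr_add)
  then show ?thesis by (simp add: dot_def)
qed

lemma sum_chr_dot:
  assumes "p > 0"
  shows "(\<Sum>c\<in>carrier (Fpn p n). chr p (dot n c w)) = (if \<forall>s<n. int p dvd w s then of_nat (p ^ n) else 0)"
proof -
  have "(\<Sum>c\<in>carrier (Fpn p n). chr p (dot n c w)) = (\<Prod>s<n. \<Sum>t\<in>{0..int p - 1}. chr p (t * w s))"
    unfolding chr_dot carrier_Fpn by (subst prod_sum_PiE) auto
  also have "\<dots> = (\<Prod>s<n. if int p dvd w s then of_nat p else 0)"
    using sum_chr[OF assms] by simp
  also have "\<dots> = (if \<forall>s<n. int p dvd w s then of_nat (p ^ n) else 0)"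
    by (auto intro: prod_zero)
  finally show ?thesis .
qed

lemma Fpn_eqI:
  assumes "u \<in> carrier (Fpn p n)" "v \<in> carrier (Fpn p n)" "\<forall>s<n. int p dvd u s - v s"
  shows "u = v"
proof (rule extensionalityI[of _ "{..<n}"])
  show "u s = v s" if "s \<in> {..<n}" for s
  proof -
    have "u s mod int p = v s mod int p" using assms(3) that by (simp add: mod_eq_dvd_iff)
    moreover have "0 \<le> u s" "u s < int p" "0 \<le> v s" "v s < int p" using assms that by (auto simp: PiE_iff)
    ultimately show ?thesis by simp
  qed
qed (use assms in \<open>auto simp: PiE_iff\<close>)

text \<open>Summing over all characters counts the coincidences \<open>u i = v j\<close>. Indexed
  families allow two uses: with tuples from \<open>A\<close> it counts the solutions of the
  equation, with \<open>A\<close> itself it evaluates the sum of the squared coefficients.\<close>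

lemma parseval:
  assumes "p > 0" "finite I" "finite J"
    and u: "\<And>i. i \<in> I \<Longrightarrow> u i \<in> carrier (Fpn p n)" and v: "\<And>j. j \<in> J \<Longrightarrow> v j \<in> carrier (Fpn p n)"
  shows "(\<Sum>c\<in>carrier (Fpn p n). (\<Sum>i\<in>I. chr p (dot n c (u i))) * cnj (\<Sum>j\<in>J. chr p (dot n c (v j))))
    = of_nat (p ^ n) * of_nat (\<Sum>i\<in>I. card {j\<in>J. u i = v j})"
proof -
  let ?C = "carrier (Fpn p n)"
  have *: "(\<Sum>c\<in>?C. chr p (dot n c (u i)) * cnj (chr p (dot n c (v j))))
      = (if u i = v j then of_nat (p ^ n) else 0)" if "i \<in> I" "j \<in> J" for i j
  proof -
    have "chr p (dot n c (u i)) * cnj (chr p (dot n c (v j))) = chr p (dot n c (\<lambda>s. u i s - v j s))" for c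
      by (simp add: cnj_chr chr_add[symmetric] dot_def sum_subtractf[symmetric] right_diff_distrib)
    then have "(\<Sum>c\<in>?C. chr p (dot n c (u i)) * cnj (chr p (dot n c (v j))))
      = (if \<forall>s<n. int p dvd u i s - v j s then of_nat (p ^ n) else 0)"
      by (simp only: sum_chr_dot[OF assms(1)])
    then show ?thesis using Fpn_eqI[OF u[OF that(1)] v[OF that(2)]] by auto
  qed
  have "(\<Sum>c\<in>?C. (\<Sum>i\<in>I. chr p (dot n c (u i))) * cnj (\<Sum>j\<in>J. chr p (dot n c (v j))))
    = (\<Sum>c\<in>?C. \<Sum>i\<in>I. \<Sum>j\<in>J. chr p (dot n c (u i)) * cnj (chr p (dot n c (v j))))"
    by (simp add: sum_product)
  also have "\<dots> = (\<Sum>i\<in>I. \<Sum>j\<in>J. \<Sum>c\<in>?C. chr p (dot n c (u i)) * cnj (chr p (dot n c (v j))))"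
    by (subst sum.swap, rule sum.cong[OF refl], rule sum.swap)
  also have "\<dots> = (\<Sum>i\<in>I. \<Sum>j\<in>J. if u i = v j then of_nat (p ^ n) else 0)"
    using * by (intro sum.cong) auto
  also have "\<dots> = (\<Sum>i\<in>I. of_nat (p ^ n) * of_nat (card {j\<in>J. u i = v j}))"
    using assms(3) by (simp add: sum.If_cases Int_def conj_commute mult.commute)
  finally show ?thesis by (simp add: sum_distrib_left)
qed

definition fourier :: "nat \<Rightarrow> nat \<Rightarrow> (nat \<Rightarrow> int) set \<Rightarrow> (nat \<Rightarrow> int) \<Rightarrow> complex" where
  "fourier p n A c = (\<Sum>z\<in>A. chr p (dot n c z))"

lemma chr_dot_mult:
  assumes "p > 0"
  shows "chr p (dot n c (x \<otimes>\<^bsub>Fpn p n\<^esub> y)) = chr p (dot n c x) * chr p (dot n c y)"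
proof -
  have "dot n c (x \<otimes>\<^bsub>Fpn p n\<^esub> y) mod int p = (\<Sum>s<n. c s * ((x s + y s) mod int p)) mod int p"
    by (simp add: dot_def)
  also have "\<dots> = (\<Sum>s<n. (c s * ((x s + y s) mod int p)) mod int p) mod int p"
    by (rule mod_sum_eq[symmetric])
  also have "\<dots> = (\<Sum>s<n. (c s * (x s + y s)) mod int p) mod int p"
    by (simp add: mod_simps)
  also have "\<dots> = (\<Sum>s<n. c s * (x s + y s)) mod int p" by (rule mod_sum_eq)
  also have "\<dots> = (dot n c x + dot n c y) mod int p"
    by (simp add: dot_def sum.distrib ring_distribs)
  finally show ?thesis using chr_cong[OF assms] chr_add by metis
qed

lemma fourier_power:
  assumes "p > 0" "finite A"
  shows "fourier p n A c ^ h = (\<Sum>xs\<in>{xs. set xs \<subseteq> A \<and> length xs = h}. chr p (dot n c (lprod (Fpn p n) xs)))"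
proof (induction h)
  case 0
  have *: "{xs. set xs \<subseteq> A \<and> length xs = 0} = {[]}" by auto
  have "dot n c (lprod (Fpn p n) []) = 0" by (simp add: dot_def)
  then show ?case unfolding * by (simp del: lprod_simps)
next
  case (Suc h)
  let ?L = "{xs. set xs \<subseteq> A \<and> length xs = h}"
  have L: "{xs. set xs \<subseteq> A \<and> length xs = Suc h} = (\<lambda>(x, xs). x # xs) ` (A \<times> ?L)"
    by (auto simp: length_Suc_conv image_iff)
  have inj: "inj_on (\<lambda>(x, xs). x # xs) (A \<times> ?L)" by (auto simp: inj_on_def)
  have "fourier p n A c ^ Suc h = (\<Sum>x\<in>A. \<Sum>xs\<in>?L. chr p (dot n c x) * chr p (dot n c (lprod (Fpn p n) xs)))"
    unfolding power_Suc Suc unfolding fourier_def sum_product ..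
  also have "\<dots> = (\<Sum>(x, xs)\<in>A \<times> ?L. chr p (dot n c (lprod (Fpn p n) (x # xs))))"
    by (simp only: sum.cartesian_product lprod_simps chr_dot_mult[OF assms(1)])
  also have "\<dots> = (\<Sum>xs\<in>{xs. set xs \<subseteq> A \<and> length xs = Suc h}. chr p (dot n c (lprod (Fpn p n) xs)))"
    unfolding L by (subst sum.reindex[OF inj]) (simp add: case_prod_unfold)
  finally show ?case .
qed

text \<open>In the absence of solutions the nontrivial coefficients must cancel the contribution
  \<open>|A|^(k+l)\<close> of the trivial one. Taking out the largest of them
  \<open>k + l - 2\<close> times leaves a sum of squares of at most \<open>|A| (p^n - |A|)\<close>,
  which \<open>dense\<close> bounds by \<open>(k + l) |A|^2\<close>. This yields a coefficient of
  size at least \<open>(k + l)^(-1/(k+l-2)) |A|\<close>; the root is expressed by the inequality for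
  \<eta>.\<close>

lemma exists_large_fourier:
  assumes p: "prime p" and n: "n \<ge> 1" and sf: "sum_free p n k l A" and q: "k + l \<ge> 3"
    and dense: "real (p ^ n) - real (card A) \<le> real (k + l) * real (card A)"
    and eta: "\<eta> \<ge> 0" "real (k + l) * \<eta> ^ (k + l - 2) \<le> 1"
  shows "\<exists>c\<in>carrier (Fpn p n) - {\<one>\<^bsub>Fpn p n\<^esub>}. \<eta> * real (card A) \<le> norm (fourier p n A c)"
proof -
  let ?G = "Fpn p n"
  interpret G: comm_group ?G using p by (rule comm_group_Fpn)
  have p0: "p > 0" using p prime_gt_0_nat by simp
  have A: "A \<noteq> {}" "A \<subseteq> carrier ?G" using sf by (auto simp only: sum_free_def)
  have finA: "finite A" using A finite_Fpn finite_subset by blast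
  have A0: "card A > 0" using A finA by (simp add: card_gt_0_iff)
  let ?F = "fourier p n A"
  have F1: "?F \<one>\<^bsub>?G\<^esub> = of_nat (card A)"
    by (simp add: fourier_def dot_def)
  let ?C = "carrier ?G - {\<one>\<^bsub>?G\<^esub>}"
  have finC: "finite ?C" using finite_Fpn by blast
  have split: "(\<Sum>c\<in>carrier ?G. f c) = f \<one>\<^bsub>?G\<^esub> + (\<Sum>c\<in>?C. f c)" for f :: "(nat \<Rightarrow> int) \<Rightarrow> complex"
    using finite_Fpn G.one_closed by (rule sum.remove)
  have closed: "lprod ?G xs \<in> carrier ?G" if "xs \<in> {xs. set xs \<subseteq> A \<and> length xs = h}" for xs h
    using that A by (intro G.lprod_closed) auto
  have fin: "finite {xs. set xs \<subseteq> A \<and> length xs = h}" for h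
    using finA by (rule finite_lists_length_eq)
  have "(\<Sum>c\<in>carrier ?G. ?F c ^ k * cnj (?F c ^ l)) = of_nat (p ^ n) *
      of_nat (\<Sum>xs\<in>{xs. set xs \<subseteq> A \<and> length xs = k}.
        card {ys \<in> {ys. set ys \<subseteq> A \<and> length ys = l}. lprod ?G xs = lprod ?G ys})"
    unfolding fourier_power[OF p0 finA] using closed by (intro parseval[OF p0 fin fin])
  also have "(\<Sum>xs\<in>{xs. set xs \<subseteq> A \<and> length xs = k}.
        card {ys \<in> {ys. set ys \<subseteq> A \<and> length ys = l}. lprod ?G xs = lprod ?G ys}) = 0"
  proof (rule sum.neutral, rule ballI)
    fix xs assume "xs \<in> {xs. set xs \<subseteq> A \<and> length xs = k}"
    then have "{ys \<in> {ys. set ys \<subseteq> A \<and> length ys = l}. lprod ?G xs = lprod ?G ys} = {}"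
      using sf unfolding sum_free_lists[OF p] by blast
    then show "card {ys \<in> {ys. set ys \<subseteq> A \<and> length ys = l}. lprod ?G xs = lprod ?G ys} = 0"
      by (simp only: card.empty)
  qed
  finally have "of_nat (card A) ^ (k + l) = - (\<Sum>c\<in>?C. ?F c ^ k * cnj (?F c ^ l))"
    unfolding split F1 by (simp add: power_add eq_neg_iff_add_eq_0)
  then have "norm ((of_nat (card A) :: complex) ^ (k + l)) = norm (\<Sum>c\<in>?C. ?F c ^ k * cnj (?F c ^ l))"
    by simp
  then have "real (card A) ^ (k + l) \<le> (\<Sum>c\<in>?C. norm (?F c ^ k * cnj (?F c ^ l)))"
    using norm_sum[of "\<lambda>c. ?F c ^ k * cnj (?F c ^ l)" ?C] by (simp add: norm_power)
  also have "\<dots> = (\<Sum>c\<in>?C. norm (?F c) ^ (k + l - 2) * norm (?F c) ^ 2)"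
  proof (rule sum.cong)
    fix c
    have "norm (?F c ^ k * cnj (?F c ^ l)) = norm (?F c) ^ (k + l)"
      by (simp only: norm_mult complex_mod_cnj norm_power power_add)
    also have "k + l = (k + l - 2) + 2" using q by simp
    finally show "norm (?F c ^ k * cnj (?F c ^ l)) = norm (?F c) ^ (k + l - 2) * norm (?F c) ^ 2"
      by (simp only: power_add)
  qed simp
  finally have 1: "real (card A) ^ (k + l) \<le> (\<Sum>c\<in>?C. norm (?F c) ^ (k + l - 2) * norm (?F c) ^ 2)" .
  have "(\<Sum>c\<in>carrier ?G. ?F c * cnj (?F c)) = of_nat (p ^ n) * of_nat (\<Sum>i\<in>A. card {j\<in>A. i = j})"
    unfolding fourier_def using A by (intro parseval[OF p0 finA finA]) auto
  also have "(\<Sum>i\<in>A. card {j\<in>A. i = j}) = (\<Sum>i\<in>A. 1)"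
  proof (rule sum.cong)
    fix i assume "i \<in> A"
    then have "{j\<in>A. i = j} = {i}" by blast
    then show "card {j\<in>A. i = j} = 1" by simp
  qed simp
  finally have "(\<Sum>c\<in>?C. ?F c * cnj (?F c)) = of_nat (p ^ n) * of_nat (card A) - of_nat (card A) * of_nat (card A)"
    unfolding split F1 by (simp add: algebra_simps)
  moreover have "(\<Sum>c\<in>?C. ?F c * cnj (?F c)) = of_real (\<Sum>c\<in>?C. norm (?F c) ^ 2)"
    by (simp add: complex_norm_square[symmetric])
  ultimately have "complex_of_real (\<Sum>c\<in>?C. norm (?F c) ^ 2)
      = complex_of_real (real (p ^ n) * real (card A) - real (card A) * real (card A))"
    by (simp only: of_real_diff of_real_mult of_real_of_nat_eq)
  then have 2: "(\<Sum>c\<in>?C. norm (?F c) ^ 2) = real (p ^ n) * real (card A) - real (card A) * real (card A)"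
    by (simp only: of_real_eq_iff)
  have "?C \<noteq> {}"
  proof
    assume "?C = {}"
    then have "card (carrier ?G) \<le> card {\<one>\<^bsub>?G\<^esub>}" by (intro card_mono) (simp, blast)
    moreover have "p ^ 1 \<le> p ^ n" using n p0 by (intro power_increasing) auto
    ultimately show False using prime_gt_1_nat[OF p] unfolding card_Fpn by simp
  qed
  define Mx where "Mx = Max ((\<lambda>c. norm (?F c)) ` ?C)"
  have "Mx \<in> (\<lambda>c. norm (?F c)) ` ?C"
    unfolding Mx_def using finC \<open>?C \<noteq> {}\<close> by (intro Max_in finite_imageI) (simp_all only: image_is_empty not_False_eq_True)
  then obtain c where c: "c \<in> ?C" "norm (?F c) = Mx" by blast
  have le: "norm (?F c) \<le> Mx" if "c \<in> ?C" for c
    unfolding Mx_def using finC that by (intro Max_ge finite_imageI imageI)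
  have Mx0: "Mx \<ge> 0" using c by (metis norm_ge_zero)
  have "real (card A) ^ (k + l) \<le> (\<Sum>c\<in>?C. Mx ^ (k + l - 2) * norm (?F c) ^ 2)"
    using 1 by (rule order_trans) (intro sum_mono mult_right_mono power_mono le, auto)
  also have "\<dots> = Mx ^ (k + l - 2) * (real (p ^ n) * real (card A) - real (card A) * real (card A))"
    by (simp only: 2 sum_distrib_left[symmetric])
  also have "\<dots> = (Mx ^ (k + l - 2) * real (card A)) * (real (p ^ n) - real (card A))"
    by (simp add: algebra_simps)
  also have "\<dots> \<le> (Mx ^ (k + l - 2) * real (card A)) * (real (k + l) * real (card A))"
    using dense Mx0 by (intro mult_left_mono) auto
  also have "\<dots> = (real (k + l) * Mx ^ (k + l - 2)) * real (card A) ^ 2"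
    by (simp add: power2_eq_square)
  finally have "real (card A) ^ (k + l) \<le> (real (k + l) * Mx ^ (k + l - 2)) * real (card A) ^ 2" .
  moreover have "real (card A) ^ (k + l) = real (card A) ^ (k + l - 2) * real (card A) ^ 2"
    using q le_add_diff_inverse2[of 2 "k + l"] power_add[of "real (card A)" "k + l - 2" 2] by simp
  ultimately have "real (card A) ^ (k + l - 2) * real (card A) ^ 2 \<le> (real (k + l) * Mx ^ (k + l - 2)) * real (card A) ^ 2"
    by simp
  then have 3: "real (card A) ^ (k + l - 2) \<le> real (k + l) * Mx ^ (k + l - 2)"
    by (rule mult_right_le_imp_le) (use A0 in simp)
  have "real (k + l) * (\<eta> * real (card A)) ^ (k + l - 2) \<le> 1 * real (card A) ^ (k + l - 2)"
    unfolding power_mult_distrib mult.assoc[symmetric] using eta(2) by (intro mult_right_mono) auto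
  then have "real (k + l) * (\<eta> * real (card A)) ^ (k + l - 2) \<le> real (k + l) * Mx ^ (k + l - 2)"
    using 3 by linarith
  then have "(\<eta> * real (card A)) ^ (k + l - 2) \<le> Mx ^ (k + l - 2)"
    by (rule mult_left_le_imp_le) (use q in simp)
  then have "\<eta> * real (card A) \<le> Mx"
    using power_le_imp_le_base[of _ "k + l - 3" Mx] q Mx0 by (metis Suc_diff_le diff_Suc_Suc numeral_2_eq_2 numeral_3_eq_3)
  then show ?thesis using c by auto
qed

text \<open>Replacing the weights \<open>|A \<inter> {c \<sqdot> z = x}|\<close> by their distance from the maximal one changes the Fourier
  coefficient only by a sign, as the characters sum to zero.\<close>

lemma exists_large_hyperplane_section:
  assumes p: "prime p" and A: "A \<subseteq> carrier (Fpn p n)" 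
    and c: "c \<in> carrier (Fpn p n)" "c \<noteq> \<one>\<^bsub>Fpn p n\<^esub>"
    and eta: "\<eta> * real (card A) \<le> norm (fourier p n A c)"
  shows "\<exists>x\<in>{0..<int p}. (1 + \<eta>) * real (card A) \<le> real p * real (card {z \<in> A. dot n c z mod int p = x})"
proof -
  have p0: "p > 0" using p prime_gt_0_nat by simp
  have finA: "finite A" using A finite_Fpn finite_subset by blast
  let ?X = "{0..int p - 1}"
  define a where "a x = card {z \<in> A. dot n c z mod int p = x}" for x
  have X: "finite ?X" "?X \<noteq> {}" "card ?X = p" using p0 by auto
  define M where "M = Max (a ` ?X)"
  have "M \<in> a ` ?X" unfolding M_def using X by (intro Max_in) simp_all
  then obtain x where x: "x \<in> ?X" "a x = M" by blast
  have le: "a x \<le> M" if "x \<in> ?X" for x using that X by (auto simp: M_def)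
  have img: "(\<lambda>z. dot n c z mod int p) ` A \<subseteq> ?X" using p0 by auto
  have "(\<Sum>x\<in>?X. of_nat (a x) * chr p x) = (\<Sum>x\<in>?X. \<Sum>z\<in>{z \<in> A. dot n c z mod int p = x}. chr p (dot n c z))"
  proof (rule sum.cong)
    fix x
    have "chr p (dot n c z) = chr p x" if "z \<in> {z \<in> A. dot n c z mod int p = x}" for z
      using that chr_mod[OF p0, of "dot n c z"] by auto
    then show "of_nat (a x) * chr p x = (\<Sum>z\<in>{z \<in> A. dot n c z mod int p = x}. chr p (dot n c z))"
      by (simp add: a_def)
  qed simp
  also have "\<dots> = fourier p n A c"
    unfolding fourier_def using sum.group[OF finA X(1) img] by blast
  finally have F: "fourier p n A c = (\<Sum>x\<in>?X. of_nat (a x) * chr p x)" ..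
  have cardA: "card A = (\<Sum>x\<in>?X. a x)"
    using sum.group[OF finA X(1) img, of "\<lambda>_. 1::nat"] by (simp add: a_def)
  have "\<not> int p dvd 1" using p prime_gt_1_nat by auto
  then have "(\<Sum>x\<in>?X. chr p x) = 0" using sum_chr[OF p0, of 1] by simp
  then have "fourier p n A c = - (\<Sum>x\<in>?X. of_nat (M - a x) * chr p x)"
    using le by (simp add: F of_nat_diff left_diff_distrib sum_subtractf sum_distrib_left[symmetric])
  then have "norm (fourier p n A c) \<le> (\<Sum>x\<in>?X. real (M - a x))"
    using norm_sum[of "\<lambda>x. of_nat (M - a x) * chr p x" ?X] by (simp add: norm_mult)
  also have "\<dots> = real p * real M - real (card A)"
    using le X(3) by (simp add: of_nat_diff sum_subtractf cardA)
  finally show ?thesis using eta x by (intro bexI[of _ x]) (auto simp: a_def[symmetric] algebra_simps)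
qed

text \<open>The linear form given by \<open>c\<close> becomes the first coordinate after an
  automorphism, so that its level sets become slices.\<close>

lemma exists_iso_large_slice:
  assumes p: "prime p" and n: "n \<ge> 1" and sf: "sum_free p n k l A" and q: "k + l \<ge> 3"
    and dense: "real (p ^ n) - real (card A) \<le> real (k + l) * real (card A)"
    and eta: "\<eta> \<ge> 0" "real (k + l) * \<eta> ^ (k + l - 2) \<le> 1"
  shows "\<exists>\<phi>\<in>iso (Fpn p n) (Fpn p n). \<exists>x\<in>{0..<int p}.
    (1 + \<eta>) * real (card A) \<le> real p * real (card (slice p n (\<phi> ` A) x))"
proof -
  have p0: "p > 0" using p prime_gt_0_nat by simp
  have A: "A \<subseteq> carrier (Fpn p n)" using sf by (simp only: sum_free_def)
  obtain c where c: "c \<in> carrier (Fpn p n)" "c \<noteq> \<one>\<^bsub>Fpn p n\<^esub>"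
      "\<eta> * real (card A) \<le> norm (fourier p n A c)"
    using exists_large_fourier[OF assms] by blast
  obtain x where x: "x \<in> {0..<int p}"
      "(1 + \<eta>) * real (card A) \<le> real p * real (card {z \<in> A. dot n c z mod int p = x})"
    using exists_large_hyperplane_section[OF p A c] by blast
  obtain i where i: "i < n" "c i \<noteq> 0"
    using Fpn_eqI[OF c(1), of "\<one>\<^bsub>Fpn p n\<^esub>"] c(2) p0 by fastforce
  have ci: "coprime (c i) (int p)"
  proof -
    have "0 \<le> c i" "c i \<le> int p - 1" using i c(1) by (auto simp: PiE_iff)
    then have "0 < c i" "c i < int p" using i by auto
    then have "\<not> int p dvd c i" using zdvd_imp_le by fastforce
    then show ?thesis using p by (metis coprime_commute prime_imp_coprime prime_nat_int_transfer)
  qed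
  \<comment> \<open>The old coordinate 0 is stored at the place \<open>i\<close>; coordinate
    \<open>i\<close> itself can be recovered from \<open>dot n c z\<close> because
    \<open>c i\<close> is invertible modulo \<open>p\<close>.\<close>
  define \<phi> where "\<phi> z = (\<lambda>t\<in>{..<n}. if t = 0 then dot n c z mod int p else if t = i then z 0 else z t)" for z
  have "\<phi> \<in> iso (Fpn p n) (Fpn p n)"
  proof (rule iso_FpnI[OF p])
    fix z assume z: "z \<in> carrier (Fpn p n)"
    let ?M = "\<lambda>t s. if t = 0 then c s else if t = i then of_bool (s = 0) else of_bool (s = t)"
    have "(\<Sum>s<n. of_bool (s = t) * z s) mod int p = z t" if "t < n" for t
    proof -
      have "(\<Sum>s<n. of_bool (s = t) * z s) = (\<Sum>s<n. if s = t then z s else 0)"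
        by (intro sum.cong) auto
      then have "(\<Sum>s<n. of_bool (s = t) * z s) = z t" using that by simp
      then show ?thesis using z that by (simp add: PiE_iff)
    qed
    then show "\<phi> z = (\<lambda>t\<in>{..<n}. (\<Sum>s<n. ?M t s * z s) mod int p)"
      unfolding \<phi>_def using n by (intro restrict_ext) (auto simp: dot_def)
  next
    fix z w assume zw: "z \<in> carrier (Fpn p n)" "w \<in> carrier (Fpn p n)" "\<phi> z = \<phi> w"
    have \<phi>: "\<phi> z t = \<phi> w t" for t using zw(3) by simp
    have ne: "z s = w s" if "s < n" "s \<noteq> i" for s
    proof (cases "s = 0")
      case True
      then show ?thesis using \<phi>[of i] i that by (simp add: \<phi>_def)
    next
      case False
      then show ?thesis using \<phi>[of s] that by (simp add: \<phi>_def)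
    qed
    have "dot n c z mod int p = dot n c w mod int p"
      using \<phi>[of 0] n by (simp add: \<phi>_def)
    then have "int p dvd dot n c z - dot n c w" by (simp add: mod_eq_dvd_iff)
    moreover have "dot n c z - dot n c w = c i * (z i - w i)"
    proof -
      have "dot n c z - dot n c w = (\<Sum>s<n. c s * (z s - w s))"
        by (simp add: dot_def sum_subtractf right_diff_distrib)
      also have "\<dots> = (\<Sum>s<n. if s = i then c i * (z i - w i) else 0)"
        using ne by (intro sum.cong) auto
      finally show ?thesis using i by simp
    qed
    ultimately have "int p dvd z i - w i"
      using ci by (simp add: coprime_commute coprime_dvd_mult_right_iff)
    then have "int p dvd z s - w s" if "s < n" for s using ne[OF that] by (cases "s = i") auto
    then show "z = w" using Fpn_eqI zw by blast
  qed
  moreover have "card {z \<in> A. dot n c z mod int p = x} = card (slice p n (\<phi> ` A) x)"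
  proof -
    have iso: "\<phi> \<in> iso (Fpn p n) (Fpn p n)" by fact
    then have closed: "\<phi> z \<in> carrier (Fpn p n)" if "z \<in> A" for z
      using that A unfolding iso_def bij_betw_def by blast
    have inj: "inj_on \<phi> A" using iso A unfolding iso_def bij_betw_def by (blast intro: inj_on_subset)
    have \<phi>0: "\<phi> z 0 = dot n c z mod int p" for z using n by (simp add: \<phi>_def)
    have "bij_betw (\<lambda>z. vtail n (\<phi> z)) {z \<in> A. dot n c z mod int p = x} (slice p n (\<phi> ` A) x)"
    proof (rule bij_betw_imageI)
      show "inj_on (\<lambda>z. vtail n (\<phi> z)) {z \<in> A. dot n c z mod int p = x}"
      proof (rule inj_onI)
        fix z w assume "z \<in> {z \<in> A. dot n c z mod int p = x}" "w \<in> {z \<in> A. dot n c z mod int p = x}"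
          "vtail n (\<phi> z) = vtail n (\<phi> w)"
        then have "z \<in> A" "w \<in> A" "\<phi> z = \<phi> w"
          using vcons_vtail[OF n closed] \<phi>0 by (simp, simp, metis (mono_tags, lifting) mem_Collect_eq)
        then show "z = w" using inj by (simp add: inj_on_def)
      qed
      show "(\<lambda>z. vtail n (\<phi> z)) ` {z \<in> A. dot n c z mod int p = x} = slice p n (\<phi> ` A) x"
      proof
        show "(\<lambda>z. vtail n (\<phi> z)) ` {z \<in> A. dot n c z mod int p = x} \<subseteq> slice p n (\<phi> ` A) x"
        proof
          fix v assume "v \<in> (\<lambda>z. vtail n (\<phi> z)) ` {z \<in> A. dot n c z mod int p = x}"
          then obtain z where z: "z \<in> A" "\<phi> z 0 = x" "v = vtail n (\<phi> z)" using \<phi>0 by auto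
          have "\<phi> ` A \<subseteq> carrier (Fpn p n)" using closed by blast
          then show "v \<in> slice p n (\<phi> ` A) x" using mem_slice[OF n, of "\<phi> ` A" p "\<phi> z"] z by blast
        qed
        show "slice p n (\<phi> ` A) x \<subseteq> (\<lambda>z. vtail n (\<phi> z)) ` {z \<in> A. dot n c z mod int p = x}"
        proof
          fix v assume v: "v \<in> slice p n (\<phi> ` A) x"
          then obtain z where z: "z \<in> A" "vcons n x v = \<phi> z" by (auto simp: slice_def)
          then have "x = dot n c z mod int p" using \<phi>0[of z] n by (metis vcons_0)
          moreover have "v = vtail n (\<phi> z)" using z v vtail_vcons slice_subset by (metis subsetD)
          ultimately show "v \<in> (\<lambda>z. vtail n (\<phi> z)) ` {z \<in> A. dot n c z mod int p = x}" using z by blast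
        qed
      qed
    qed
    then show ?thesis by (rule bij_betw_same_card)
  qed
  ultimately show ?thesis using x by force
qed

section \<open>The sizes of the slices\<close>

text \<open>Both sides of the equation are kept in one list, so that statements about two entries
  need not distinguish whether these are on the same side.\<close>

definition balanced :: "nat \<Rightarrow> nat \<Rightarrow> nat \<Rightarrow> int list \<Rightarrow> bool" where
  "balanced p k l zs \<longleftrightarrow>
     length zs = k + l \<and> sum_list (take k zs) mod int p = sum_list (drop k zs) mod int p"

lemma exists_balanced:
  assumes "prime p" "k \<ge> 1" "length L = k + l"
    and "\<forall>X\<in>set L. X \<subseteq> {0..<int p} \<and> X \<noteq> {}" and "int p - 1 \<le> (\<Sum>X\<leftarrow>L. int (card X) - 1)"
  shows "\<exists>zs. list_all2 (\<in>) zs L \<and> balanced p k l zs"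
proof -
  have "\<exists>xs ys. list_all2 (\<in>) xs (take k L) \<and> list_all2 (\<in>) ys (drop k L) \<and>
      sum_list xs mod int p = sum_list ys mod int p"
    using assms by (intro exists_equal_sums[OF assms(1)]) (simp_all only: append_take_drop_id, auto)
  then obtain xs ys where xy: "list_all2 (\<in>) xs (take k L)" "list_all2 (\<in>) ys (drop k L)"
      "sum_list xs mod int p = sum_list ys mod int p" by blast
  then have "list_all2 (\<in>) (xs @ ys) L"
    using list_all2_appendI[OF xy(1,2)] by simp
  moreover have "length xs = k" using xy(1) assms(3) by (auto dest: list_all2_lengthD)
  then have "balanced p k l (xs @ ys)"
    using xy(3) list_all2_lengthD[OF \<open>list_all2 (\<in>) (xs @ ys) L\<close>] assms(3) by (simp add: balanced_def)
  ultimately show ?thesis by blast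
qed

lemma list_all2_replicate_right:
  "list_all2 (\<in>) us (replicate i X) \<Longrightarrow> set us \<subseteq> X \<and> length us = i"
  by (induction i arbitrary: us) (auto simp: list_all2_Cons2 subset_iff)

text \<open>The numbers \<open>a x\<close> stand for the sizes of the slices of a sum-free set, as subsets of a group
  of order \<open>P\<close>.\<close>

locale slice_system =
  fixes p k l P :: nat and S :: "int set" and a :: "int \<Rightarrow> nat"
  assumes p: "prime p" and kl: "k > l" "l \<ge> 1" "k + l \<ge> 5"
    and S: "S \<subseteq> {0..<int p}" and a_pos: "x \<in> S \<Longrightarrow> a x \<ge> 1" and a_le: "x \<in> S \<Longrightarrow> a x \<le> P"
    and sum_less: "balanced p k l zs \<Longrightarrow> set zs \<subseteq> S \<Longrightarrow>
      (\<Sum>z\<leftarrow>zs. real (a z)) < real P * (1 + (real (k + l) - 1) / real p)"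
    and pair_le: "balanced p k l zs \<Longrightarrow> set zs \<subseteq> S \<Longrightarrow> i < j \<Longrightarrow> j < k + l \<Longrightarrow>
      a (zs ! i) + a (zs ! j) \<le> P"
begin

lemma finite_S: "finite S"
  using S by (rule finite_subset) simp

text \<open>For a larger \<open>X\<close> the Cauchy--Davenport theorem would give a balanced tuple
  with \<open>i\<close> entries in \<open>X\<close> and all others equal to \<open>x0\<close>, whose
  slices are too large for \<open>sum_less\<close>.\<close>

lemma repeat_bound:
  assumes x0: "x0 \<in> S" and X: "X \<subseteq> S" "X \<noteq> {}" and i: "i \<le> k + l"
    and th: "\<And>x. x \<in> X \<Longrightarrow> \<theta> \<le> real (a x)"
    and big: "real P * (1 + (real (k + l) - 1) / real p) \<le> real i * \<theta> + real (k + l - i) * real (a x0)"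
  shows "real i * (real (card X) - 1) \<le> real p - 2"
proof (rule ccontr)
  assume *: "\<not> ?thesis"
  let ?L = "replicate i X @ replicate (k + l - i) {x0}"
  have "(\<Sum>X\<leftarrow>?L. int (card X) - 1) = int i * (int (card X) - 1)"
    by (simp add: sum_list_replicate)
  moreover have "int p - 1 \<le> int i * (int (card X) - 1)"
  proof -
    have "real_of_int (int p - 2) < real_of_int (int i * (int (card X) - 1))" using * by simp
    then show ?thesis by linarith
  qed
  moreover have "\<forall>Y\<in>set ?L. Y \<subseteq> {0..<int p} \<and> Y \<noteq> {}"
    using X(2) order_trans[OF X(1) S] subsetD[OF S x0] by auto
  moreover have "length ?L = k + l" "1 \<le> k" using i kl by auto
  ultimately obtain zs where zs: "list_all2 (\<in>) zs ?L" "balanced p k l zs"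
    using exists_balanced[OF p, of k ?L l] by metis
  then obtain us vs where uv: "zs = us @ vs" "list_all2 (\<in>) us (replicate i X)"
      "list_all2 (\<in>) vs (replicate (k + l - i) {x0})"
    by (auto simp: list_all2_append2)
  have us: "set us \<subseteq> X" "length us = i" and vs: "set vs \<subseteq> {x0}" "length vs = k + l - i"
    using uv list_all2_replicate_right by blast+
  have "real (length us) * \<theta> \<le> (\<Sum>z\<leftarrow>us. real (a z))"
    using us(1) th by (induction us) (auto simp: ring_distribs add_mono)
  moreover have "(\<Sum>z\<leftarrow>vs. real (a z)) = real (length vs) * real (a x0)"
    using vs(1) by (induction vs) (auto simp: ring_distribs)
  ultimately have "real P * (1 + (real (k + l) - 1) / real p) \<le> (\<Sum>z\<leftarrow>zs. real (a z))"
    using big us(2) vs(2) by (simp add: uv(1))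
  moreover have "set zs \<subseteq> S" using uv(1) us vs X x0 by auto
  ultimately show False using sum_less[OF zs(2)] by simp
qed

lemma sum_le_levels:
  assumes "\<And>x. x \<in> S \<Longrightarrow> real (a x) \<le> M"
  shows "(\<Sum>x\<in>S. real (a x)) \<le> real (card S) * \<theta> + real (card {x\<in>S. \<theta> \<le> real (a x)}) * (M - \<theta>)"
proof -
  have "(\<Sum>x\<in>S. real (a x)) \<le> (\<Sum>x\<in>S. \<theta> + (if \<theta> \<le> real (a x) then M - \<theta> else 0))"
    using assms by (intro sum_mono) auto
  also have "\<dots> = real (card S) * \<theta> + real (card {x\<in>S. \<theta> \<le> real (a x)}) * (M - \<theta>)"
    using finite_S by (simp add: sum.distrib sum.If_cases Int_def conj_commute)
  finally show ?thesis .
qed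

text \<open>Repeating a slice of maximal size \<open>M P\<close> in a balanced tuple bounds the sizes of the level sets of
  \<open>a\<close>, which leaves only \<open>M\<close> close to the average density or \<open>M\<close> close to \<open>1\<close>; the former is excluded
  by the Fourier-analytic lower bound \<open>p M \<ge> (1 + \<eta>) N\<close>.\<close>

lemma max_slice_large:
  assumes peq: "p = (k + l) * m + 2 + lam" and lam: "lam \<le> k + l - 5" and m: "m \<ge> 14"
    and x0: "x0 \<in> S" "\<And>x. x \<in> S \<Longrightarrow> a x \<le> a x0"
    and P: "P > 0" and N: "m * P \<le> (\<Sum>x\<in>S. a x)"
    and fourier: "(1 + \<eta>) * (\<Sum>x\<in>S. real (a x)) \<le> real p * real (a x0)" and eta0: "\<eta> \<ge> 0"
    and eta: "real (k + l + lam + 4) \<le> \<eta> * real m"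
  shows "real (k + l) * real P \<le> 2 * (real (k + l) - 1) * real (a x0)"
proof (rule ccontr)
  assume small: "\<not> ?thesis"
  define q where "q = real (k + l)"
  define r where "r = real m"
  define L where "L = real lam"
  define M where "M = real (a x0) / real P"
  define T where "T = 1 + (q - 1) / real p"
  \<comment> \<open>In units of \<open>P\<close>, \<open>D\<close> is the excess of a tuple that
    consists of \<open>x0\<close> only over the bound \<open>T\<close> of \<open>sum_less\<close>.
    Entries may be replaced by smaller slices as long as the total loss is at most
    \<open>D\<close>.\<close>
  define D where "D = q * M - T"
  define N' where "N' = (\<Sum>x\<in>S. real (a x)) / real P"
  have q5: "q \<ge> 5" using kl by (simp add: q_def)
  have L: "0 \<le> L" "L \<le> q - 5" using lam kl by (auto simp: L_def q_def of_nat_diff[symmetric])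
  have r: "r \<ge> 14" using m by (simp add: r_def)
  have pr: "real p = q * r + 2 + L" by (simp add: peq q_def r_def L_def)
  have p0: "real p > 0" using p prime_gt_0_nat by simp
  have P0: "real P > 0" using P by simp
  have N': "r \<le> N'"
  proof -
    have "real (m * P) \<le> real (\<Sum>x\<in>S. a x)" using N by (simp only: of_nat_le_iff)
    then show ?thesis using P0 by (simp add: N'_def r_def field_simps)
  qed
  have fourier': "(1 + \<eta>) * N' \<le> real p * M"
    using divide_right_mono[OF fourier, of "real P"] P0 by (simp add: N'_def M_def)
  have eta': "q + L + 4 \<le> \<eta> * r" using eta by (simp add: q_def L_def r_def)
  have aM: "real (a x) \<le> M * real P" if "x \<in> S" for x
    using x0(2)[OF that] P0 by (simp add: M_def)
  have pT: "real p * T = real p + q - 1" using p0 by (simp add: T_def field_simps)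
  have T1: "T \<ge> 1" using q5 p0 by (simp add: T_def)
  have qr: "14 * q \<le> q * r" using r q5 by (simp add: mult.commute)
  \<comment> \<open>From \<open>m >= 14\<close> follows \<open>p >= 14 (k + l)\<close>, which makes
    \<open>T\<close> exceed 1 by at most \<open>1 / 14\<close>.\<close>
  have T2: "T \<le> 15 / 14"
  proof -
    have "14 * (q - 1) \<le> 14 * q" by simp
    also note qr
    also have "q * r \<le> real p" using L by (simp add: pr)
    finally have "14 * (q - 1) \<le> real p" .
    then show ?thesis using p0 by (simp add: T_def field_simps)
  qed
  have M1: "M * (2 * (q - 1)) < q"
    using small P0 by (simp add: M_def q_def field_simps)
  have M0: "M \<ge> 0" by (simp add: M_def)
  have pM: "r + \<eta> * r \<le> real p * M"
  proof -
    have "(1 + \<eta>) * r \<le> (1 + \<eta>) * N'" using N' eta0 by (intro mult_left_mono) auto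
    then show ?thesis using fourier' by (simp add: algebra_simps)
  qed
  have D0: "D > 0"
  proof -
    define y c e where "y = q * (real p * M)" and "c = q * r" and "e = q * (q + L + 4)"
    have "q * (r + (q + L + 4)) \<le> y"
      unfolding y_def using pM eta' q5 by (intro mult_left_mono) auto
    then have "c + e \<le> y" by (simp add: c_def e_def ring_distribs)
    moreover have "q + L + 4 \<le> e"
      unfolding e_def using q5 L mult_right_mono[of 1 q "q + L + 4"] by simp
    ultimately have "c + (q + L + 4) \<le> y" by linarith
    moreover have "real p * D = y - real p - q + 1"
      by (simp add: D_def right_diff_distrib pT y_def)
    moreover have "real p = c + 2 + L" by (simp add: pr c_def)
    ultimately have "real p * D > 0" by linarith
    then show ?thesis using p0 by (simp add: zero_less_mult_iff)
  qed
  have bound: "real i * (real (card X) - 1) \<le> q * r + L"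
    if "X \<subseteq> S" "X \<noteq> {}" "i \<le> k + l" "\<And>x. x \<in> X \<Longrightarrow> \<theta> * real P \<le> real (a x)"
      "T \<le> real i * \<theta> + (q - real i) * M" for X i \<theta>
  proof -
    have "real i * (real (card X) - 1) \<le> real p - 2"
    proof (rule repeat_bound[OF x0(1) that(1-4)])
      have "real P * T \<le> real P * (real i * \<theta> + (q - real i) * M)"
        using that(5) P0 by (intro mult_left_mono) auto
      also have "\<dots> = real i * (\<theta> * real P) + (q - real i) * real (a x0)"
        using P0 by (simp add: M_def field_simps)
      finally show "real P * (1 + (real (k + l) - 1) / real p) \<le>
          real i * (\<theta> * real P) + real (k + l - i) * real (a x0)"
        using that(3) by (simp add: T_def q_def of_nat_diff)
    qed
    then show ?thesis by (simp add: pr)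
  qed
  define X where "X \<theta> = {x\<in>S. \<theta> * real P \<le> real (a x)}" for \<theta>
  have X: "X \<theta> \<subseteq> S" "\<And>x. x \<in> X \<theta> \<Longrightarrow> \<theta> * real P \<le> real (a x)" for \<theta> by (auto simp: X_def)
  have Xne: "X \<theta> \<noteq> {}" if "\<theta> \<le> M" for \<theta>
  proof -
    have "x0 \<in> X \<theta>" using that x0(1) P0 by (simp add: X_def M_def field_simps)
    then show ?thesis by blast
  qed
  have levels: "N' \<le> real (card S) * \<theta> + real (card (X \<theta>)) * (M - \<theta>)" for \<theta>
  proof -
    have "(\<Sum>x\<in>S. real (a x)) \<le>
        real (card S) * (\<theta> * real P) + real (card (X \<theta>)) * (M * real P - \<theta> * real P)"
      unfolding X_def using aM by (rule sum_le_levels)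
    also have "\<dots> = (real (card S) * \<theta> + real (card (X \<theta>)) * (M - \<theta>)) * real P"
      by (simp add: algebra_simps)
    finally show ?thesis using P0 by (simp add: N'_def field_simps)
  qed
  have cardS: "real (card S) \<le> real p"
    using card_mono[OF _ S] by simp
  have k2: "2 \<le> k + l" "3 \<le> k + l" using kl by auto
  show False
  proof (cases "D < 2 * M")
    case True
    \<comment> \<open>Lowering two entries by \<open>D / 2\<close> each uses up the excess, so this
      level set has at most half of the residues. Here \<open>M\<close> is near the average density,
      and the estimate for the sum of the slices contradicts
      \<open>\<eta> * r >= q + L + 4\<close>.\<close>
    let ?\<theta> = "M - D / 2"
    have "real 2 * (real (card (X ?\<theta>)) - 1) \<le> q * r + L"
    proof (rule bound[OF X(1) Xne k2(1) X(2)])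
      show "T \<le> real 2 * ?\<theta> + (q - real 2) * M" by (simp add: D_def field_simps)
    qed (use D0 in auto)
    then have "real (card (X ?\<theta>)) \<le> real p / 2" by (simp add: pr)
    then have "real (card (X ?\<theta>)) * (M - ?\<theta>) \<le> real p / 2 * (D / 2)"
      using D0 by simp
    moreover have "real (card S) * ?\<theta> \<le> real p * ?\<theta>" using cardS True by (intro mult_right_mono) auto
    ultimately have "N' \<le> real p * ?\<theta> + real p / 2 * (D / 2)" using levels[of ?\<theta>] by linarith
    then have "4 * N' \<le> 4 * (real p * M) - real p * D" by (simp add: algebra_simps)
    also have "real p * D = q * (real p * M) - real p - q + 1"
      by (simp add: D_def right_diff_distrib pT)
    finally have "4 * N' + (q - 4) * (real p * M) \<le> real p + q - 1" by (simp add: algebra_simps)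
    moreover have "(q - 4) * (r + \<eta> * r) \<le> (q - 4) * (real p * M)"
      using pM q5 by (intro mult_left_mono) auto
    moreover have "1 * (\<eta> * r) \<le> (q - 4) * (\<eta> * r)"
      using q5 eta' L by (intro mult_right_mono) auto
    ultimately show False using N' eta' by (simp add: pr algebra_simps)
  next
    case ge2: False
    \<comment> \<open>At this threshold all \<open>k + l\<close> entries can be taken from the level
      set, which bounds its size by about \<open>m\<close>. The smaller slices are controlled
      through the size of the support: \<open>i\<close> entries may be arbitrarily small when
      \<open>i * M <= D\<close>, so \<open>i\<close> copies of \<open>S\<close> can be used.\<close>
    let ?\<theta> = "T / q"
    have "T / q \<le> M" using D0 q5 by (simp add: D_def field_simps)
    have X0: "q * (real (card (X ?\<theta>)) - 1) \<le> q * r + L"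
      using bound[OF X(1) Xne _ X(2), of ?\<theta> "k + l"] \<open>T / q \<le> M\<close> q5 by (simp add: q_def)
    have cX: "real (card (X ?\<theta>)) \<le> r + 2"
    proof -
      have "q * (real (card (X ?\<theta>)) - 1) \<le> q * (r + 1)" using X0 L by (simp add: algebra_simps)
      then show ?thesis using q5 by simp
    qed
    have XM: "real (card (X ?\<theta>)) * (M - ?\<theta>) \<le> ((q * r + L) / q + 1) * (M - ?\<theta>)"
      using X0 q5 \<open>T / q \<le> M\<close> by (intro mult_right_mono) (auto simp: field_simps)
    have S_bound: "real i * (real (card S) - 1) \<le> q * r + L" if "i \<le> k + l" "real i * M \<le> D" for i
      using bound[of S i 0] x0(1) that by (auto simp: D_def algebra_simps)
    have fin: "N' \<le> T * (r + 1) * ((q - real i) / (real i * q)) + (r + 2) * M"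
      if i: "i \<le> k + l" "real i * M \<le> D" "i > 0" for i
    proof -
      have ri: "real i > 0" "real i \<le> q" using i by (auto simp: q_def)
      have "real (card S) \<le> (q * r + L) / real i + 1"
        using S_bound[OF i(1,2)] ri by (simp add: field_simps)
      then have "real (card S) * ?\<theta> \<le> ((q * r + L) / real i + 1) * ?\<theta>"
        using T1 q5 by (intro mult_right_mono) auto
      then have "N' \<le> ((q * r + L) / real i + 1) * ?\<theta> + ((q * r + L) / q + 1) * (M - ?\<theta>)"
        using levels[of ?\<theta>] XM by linarith
      also have "\<dots> = (q * r + L) * (T * ((q - real i) / (real i * q))) / q + ((q * r + L) / q + 1) * M"
        using ri q5 by (simp add: field_simps)
      also have "\<dots> \<le> (q * (r + 1)) * (T * ((q - real i) / (real i * q))) / q + (r + 2) * M"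
      proof (rule add_mono)
        show "(q * r + L) * (T * ((q - real i) / (real i * q))) / q
            \<le> (q * (r + 1)) * (T * ((q - real i) / (real i * q))) / q"
          using L q5 T1 ri by (intro divide_right_mono mult_right_mono) (auto simp: ring_distribs)
        have "(q * r + L) / q + 1 \<le> r + 2" using L q5 by (simp add: field_simps)
        then show "((q * r + L) / q + 1) * M \<le> (r + 2) * M" using M0 by (rule mult_right_mono)
      qed
      also have "\<dots> = T * (r + 1) * ((q - real i) / (real i * q)) + (r + 2) * M"
        using q5 by simp
      finally show ?thesis .
    qed
    show False
    \<comment> \<open>If \<open>D < 3 * M\<close>, then \<open>M\<close> is small and
      \<open>i = 2\<close> suffices; otherwise \<open>i = 3\<close> is available and the negated
      claim bounds \<open>M\<close>. Both branches end with \<open>N' <= 6 / 7 * (r + 2)\<close>,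
      which is less than \<open>r\<close> for \<open>r > 12\<close>.\<close>
    proof (cases "D < 3 * M")
      case True
      then have M: "M < T / (q - 3)" using q5 by (simp add: D_def field_simps)
      have "N' \<le> T * (r + 1) * ((q - 2) / (2 * q)) + (r + 2) * M"
        using fin[of 2] k2 ge2 by simp
      also have "\<dots> \<le> T * (r + 2) * ((q - 2) / (2 * q)) + (r + 2) * (T / (q - 3))"
        using M r q5 T1 by (intro add_mono mult_right_mono mult_left_mono) auto
      also have "\<dots> = T * (r + 2) * ((q - 2) / (2 * q) + 1 / (q - 3))"
        by (simp add: ring_distribs add_divide_distrib mult_ac)
      also have "\<dots> \<le> T * (r + 2) * (4 / 5)"
      proof (intro mult_left_mono)
        have "0 \<le> 3 * ((q - 5) * (q + 2))" using q5 by simp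
        then show "(q - 2) / (2 * q) + 1 / (q - 3) \<le> 4 / 5"
          using q5 by (simp add: field_simps)
      qed (use T1 r in auto)
      also have "\<dots> \<le> 15 / 14 * (r + 2) * (4 / 5)"
        using T2 r by (intro mult_right_mono) auto
      finally show False using N' r by simp
    next
      case False
      have M: "M \<le> q / (2 * (q - 1))" using M1 q5 by (simp add: field_simps)
      define u v where "u = (q - 3) / (3 * q)" and "v = q / (2 * (q - 1))"
      have "u \<ge> 0" using q5 by (simp add: u_def)
      have "N' \<le> T * (r + 1) * u + (r + 2) * M"
        using fin[of 3] k2 False by (simp add: u_def)
      also have "\<dots> \<le> 15 / 14 * (r + 2) * u + (r + 2) * v"
        using M r \<open>u \<ge> 0\<close> T1 T2 unfolding v_def
        by (intro add_mono mult_right_mono mult_left_mono mult_mono) auto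
      also have "\<dots> = (r + 2) * (15 / 14 * u + v)"
        by (simp add: algebra_simps)
      also have "\<dots> \<le> (r + 2) * (6 / 7)"
      proof (intro mult_left_mono)
        show "15 / 14 * u + v \<le> 6 / 7"
          using q5 by (simp add: u_def v_def field_simps)
      qed (use r in auto)
      finally show False using N' r by simp
    qed
  qed
qed

text \<open>The sum of the sizes is the sum of the numbers \<open>g t\<close> of slices of size at
  least \<open>t\<close>. Thresholds are paired as \<open>t\<close> and \<open>P + 1 - t\<close>:
  slices from the two level sets have total size above \<open>P\<close>, so they cannot both occur
  in a balanced tuple. Together with \<open>k + l - 2\<close> copies of \<open>S\<close>, the
  Cauchy--Davenport theorem then bounds \<open>g t + g (P + 1 - t)\<close>.\<close>

lemma card_supp_le:
  assumes peq: "p = (k + l) * m + 2 + lam" and lam: "lam \<le> k + l - 5" and m: "m \<ge> 14"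
    and x0: "x0 \<in> S" "\<And>x. x \<in> S \<Longrightarrow> a x \<le> a x0"
    and P: "P > 0" and N: "m * P \<le> (\<Sum>x\<in>S. a x)"
    and big: "real (k + l) * real P \<le> 2 * (real (k + l) - 1) * real (a x0)"
  shows "card S \<le> m + 1"
proof (rule ccontr)
  assume "\<not> ?thesis"
  then have s: "int (card S) \<ge> int m + 2" by simp
  define M where "M = a x0"
  define g where "g t = card {x\<in>S. t \<le> a x}" for t
  have MP: "M \<le> P" using a_le[OF x0(1)] by (simp add: M_def)
  have big': "int (k + l) * int P \<le> 2 * (int (k + l) - 1) * int M"
  proof -
    have "real_of_int (int (k + l) * int P) \<le> real_of_int (2 * (int (k + l) - 1) * int M)"
      using big by (simp add: M_def)
    then show ?thesis by (simp only: of_int_le_iff)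
  qed
  have MP2: "P < 2 * M"
  proof (rule ccontr)
    assume "\<not> P < 2 * M"
    then have "(int (k + l) - 1) * (2 * int M) \<le> (int (k + l) - 1) * int P"
      using kl by (intro mult_left_mono) auto
    then show False using big' P by (simp add: algebra_simps)
  qed
  have sum_eq: "(\<Sum>x\<in>S. a x) = (\<Sum>t=1..M. g t)"
  proof -
    have "(\<Sum>x\<in>S. a x) = (\<Sum>x\<in>S. \<Sum>t=1..M. if t \<le> a x then 1 else 0)"
    proof (rule sum.cong)
      fix x assume "x \<in> S"
      then have "{1..M} \<inter> {t. t \<le> a x} = {1..a x}" using x0(2)[of x] by (auto simp: M_def)
      then show "a x = (\<Sum>t=1..M. if t \<le> a x then 1 else 0)" by (simp add: sum.If_cases)
    qed simp
    also have "\<dots> = (\<Sum>t=1..M. \<Sum>x\<in>S. if t \<le> a x then 1 else 0)" by (rule sum.swap)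
    also have "\<dots> = (\<Sum>t=1..M. g t)"
      using finite_S by (intro sum.cong) (auto simp: g_def sum.If_cases Int_def)
    finally show ?thesis .
  qed
  have gS: "g t \<le> card S" for t unfolding g_def using finite_S by (intro card_mono) auto
  have pair: "int (g t) + int (g (P + 1 - t)) \<le> int p - (int (k + l) - 2) * (int (card S) - 1)"
    if t: "t \<in> {P + 1 - M..M}" for t
  proof (rule ccontr)
    assume *: "\<not> ?thesis"
    let ?X = "\<lambda>t. {x\<in>S. t \<le> a x}"
    let ?L = "?X t # ?X (P + 1 - t) # replicate (k + l - 2) S"
    have "x0 \<in> ?X t" "x0 \<in> ?X (P + 1 - t)" using t x0(1) by (auto simp: M_def)
    then have ne: "\<forall>X\<in>set ?L. X \<subseteq> {0..<int p} \<and> X \<noteq> {}" using S x0(1) by auto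
    have "(\<Sum>X\<leftarrow>?L. int (card X) - 1) = int (g t) + int (g (P + 1 - t)) - 2 + (int (k + l) - 2) * (int (card S) - 1)"
      using kl by (simp add: sum_list_replicate g_def of_nat_diff)
    then have "int p - 1 \<le> (\<Sum>X\<leftarrow>?L. int (card X) - 1)" using * by linarith
    moreover have "length ?L = k + l" "1 \<le> k" using kl by auto
    ultimately obtain zs where zs: "list_all2 (\<in>) zs ?L" "balanced p k l zs"
      using exists_balanced[OF p _ _ ne, of k l] by metis
    then obtain x y us where xy: "zs = x # y # us" "x \<in> ?X t" "y \<in> ?X (P + 1 - t)" "set us \<subseteq> S"
      by (auto simp: list_all2_Cons2 dest!: list_all2_replicate_right)
    then have "set zs \<subseteq> S" by auto
    then have "a x + a y \<le> P" using pair_le[OF zs(2), of 0 1] xy kl by simp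
    then show False using xy t by auto
  qed
  \<comment> \<open>The reflection preserves the range of thresholds for which both level sets
    contain \<open>x0\<close>.\<close>
  have refl: "(\<Sum>t\<in>{P + 1 - M..M}. int (g (P + 1 - t))) = (\<Sum>t\<in>{P + 1 - M..M}. int (g t))"
    by (rule sum.reindex_bij_witness[of _ "\<lambda>t. P + 1 - t" "\<lambda>t. P + 1 - t"]) (use MP in auto)
  have cI: "int (card {P + 1 - M..M}) = 2 * int M - int P" using MP MP2 by simp
  have "2 * (\<Sum>t\<in>{P + 1 - M..M}. int (g t)) = (\<Sum>t\<in>{P + 1 - M..M}. int (g t) + int (g (P + 1 - t)))"
    using refl by (simp add: sum.distrib)
  also have "\<dots> \<le> (\<Sum>t\<in>{P + 1 - M..M}. int p - (int (k + l) - 2) * (int (card S) - 1))"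
    using pair by (rule sum_mono)
  also have "\<dots> = (2 * int M - int P) * (int p - (int (k + l) - 2) * (int (card S) - 1))"
    using cI by (simp only: sum_constant)
  finally have upper: "2 * (\<Sum>t\<in>{P + 1 - M..M}. int (g t))
    \<le> (2 * int M - int P) * (int p - (int (k + l) - 2) * (int (card S) - 1))" .
  have "{1..M} = {1..P - M} \<union> {P + 1 - M..M}" "{1..P - M} \<inter> {P + 1 - M..M} = {}" using MP MP2 by auto
  then have "int (\<Sum>t=1..M. g t) = (\<Sum>t\<in>{1..P - M}. int (g t)) + (\<Sum>t\<in>{P + 1 - M..M}. int (g t))"
    by (simp add: sum.union_disjoint)
  moreover have "(\<Sum>t\<in>{1..P - M}. int (g t)) \<le> (\<Sum>t\<in>{1..P - M}. int (card S))"
    using gS by (intro sum_mono) simp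
  moreover have "(\<Sum>t\<in>{1..P - M}. int (card S)) = (int P - int M) * int (card S)" using MP by (simp add: of_nat_diff)
  moreover have "int m * int P \<le> int (\<Sum>t=1..M. g t)"
    using N sum_eq by (metis of_nat_le_iff of_nat_mult)
  ultimately have main: "2 * (int m * int P) \<le> 2 * ((int P - int M) * int (card S)) +
      (2 * int M - int P) * (int p - (int (k + l) - 2) * (int (card S) - 1))"
    using upper by linarith
  \<comment> \<open>\<open>e\<close> is the excess of the support over \<open>m + 2\<close>, the
    smallest size to be excluded, and \<open>b\<close> the distance of \<open>lam\<close> from its
    maximum. By \<open>big'\<close> the upper bound does not increase with \<open>e\<close>, so
    \<open>e = 0\<close> is the worst case.\<close>
  define e where "e = int (card S) - int m - 2"
  define b where "b = int (k + l) - 5 - int lam"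
  have e0: "e \<ge> 0" using s by (simp add: e_def)
  have b0: "b \<ge> 0" using lam kl by (auto simp: b_def)
  have pi: "int p = int (k + l) * int m + 2 + int lam" using peq by simp
  have "2 * ((int P - int M) * int (card S)) +
      (2 * int M - int P) * (int p - (int (k + l) - 2) * (int (card S) - 1))
    = 2 * (int P - int M) * (int m + 2) + (2 * int M - int P) * (2 * int m - 1 - b)
      - e * (2 * (int (k + l) - 1) * int M - int (k + l) * int P)"
    unfolding pi e_def b_def by (simp add: algebra_simps)
  also have "\<dots> \<le> 2 * (int P - int M) * (int m + 2) + (2 * int M - int P) * (2 * int m - 1)"
  proof -
    have "0 \<le> e * (2 * (int (k + l) - 1) * int M - int (k + l) * int P)"
      using e0 big' by simp
    moreover have "(2 * int M - int P) * (2 * int m - 1 - b) \<le> (2 * int M - int P) * (2 * int m - 1)"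
      using MP2 b0 by (intro mult_left_mono) auto
    ultimately show ?thesis by linarith
  qed
  finally have "2 * (int m * int P) \<le> 2 * (int P - int M) * (int m + 2) + (2 * int M - int P) * (2 * int m - 1)"
    using main by linarith
  then have "(2 * int m - 6) * (int P - int M) + int P \<le> 0" by (simp add: algebra_simps)
  moreover have "(2 * int m - 6) * (int P - int M) \<ge> 0" using MP m by simp
  ultimately show False using P by simp
qed

text \<open>The slices miss at most \<open>P\<close> elements altogether, so at most one of them is small; \<open>S'\<close> omits its
  position.\<close>

lemma exists_core:
  assumes m: "m \<ge> 1" and p2: "2 * (k + l) \<le> p"
    and P: "P > 0" and N: "m * P \<le> (\<Sum>x\<in>S. a x)" and S_le: "card S \<le> m + 1"
  shows "\<exists>S'\<subseteq>S. card S' = m \<and> (\<forall>zs i j. balanced p k l zs \<longrightarrow> set zs \<subseteq> S \<longrightarrow> i < j \<longrightarrow> j < k + l \<longrightarrow>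
    zs ! i \<in> S' \<longrightarrow> zs ! j \<in> S' \<longrightarrow> False)"
proof -
  have ub: "(\<Sum>x\<in>S. a x) \<le> card S * P" using a_le sum_bounded_above[of S a P] by simp
  then have "m * P \<le> card S * P" using N by linarith
  then have "m \<le> card S" using P by simp
  then consider "card S = m" | "card S = m + 1" using S_le by linarith
  then show ?thesis
  proof cases
    case 1
    have full: "a x = P" if "x \<in> S" for x
    proof (rule ccontr)
      assume "a x \<noteq> P"
      then have "(\<Sum>x\<in>S. a x) < (\<Sum>x\<in>S. P)"
        using that a_le[OF that] a_le finite_S by (intro sum_strict_mono_ex1) (auto intro!: bexI[of _ x] simp: le_less)
      then show False using 1 N by simp
    qed
    have False if "balanced p k l zs" "set zs \<subseteq> S" "i < j" "j < k + l" for zs i j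
    proof -
      have "zs ! i \<in> S" "zs ! j \<in> S" using that by (auto simp: balanced_def subset_iff)
      then show False using pair_le[OF that] full P by simp
    qed
    then show ?thesis using 1 by (intro exI[of _ S]) blast
  next
    case 2
    then have "S \<noteq> {}" by auto
    then obtain y where y: "y \<in> S" "\<And>x. x \<in> S \<Longrightarrow> a y \<le> a x"
      using ex_is_arg_min_if_finite[OF finite_S, of a] by (auto simp: is_arg_min_linorder)
    \<comment> \<open>The deficiencies add up to at most \<open>P\<close>. Two entries of a balanced
      tuple have total deficiency at least \<open>P\<close>, and \<open>y\<close> has the largest
      deficiency of all.\<close>
    define d where "d x = P - a x" for x
    have dle: "d x \<le> d y" if "x \<in> S" for x using y(2)[OF that] by (auto simp: d_def)
    have da: "d x + a x = P" if "x \<in> S" for x using a_le[OF that] by (simp add: d_def)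
    have "(\<Sum>x\<in>S. d x) + (\<Sum>x\<in>S. a x) = (m + 1) * P"
      using da 2 by (simp add: sum.distrib[symmetric])
    then have dsum: "(\<Sum>x\<in>S. d x) \<le> P" using N by simp
    have sub: "(\<Sum>x\<in>X. d x) \<le> P" if "X \<subseteq> S" for X
      using sum_mono2[OF finite_S that, of d] dsum by linarith
    have False if zs: "balanced p k l zs" "set zs \<subseteq> S" and ij: "i < j" "j < k + l"
        "zs ! i \<in> S - {y}" "zs ! j \<in> S - {y}" for zs i j
    proof -
      let ?u = "zs ! i" and ?v = "zs ! j"
      have uv: "a ?u + a ?v \<le> P" using pair_le[OF zs ij(1,2)] .
      have au: "a ?u + d ?u = P" "a ?v + d ?v = P" "a y + d y = P" using da ij y by (auto simp: add.commute)
      show False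
      proof (cases "?u = ?v")
        case False
        have "d ?u + d ?v + d y \<le> P"
          using sub[of "{?u, ?v, y}"] ij y False by auto
        then show False using uv au dle[of ?u] dle[of ?v] ij P by auto
      next
        case True
        have duy: "d ?u + d y \<le> P" using sub[of "{?u, y}"] ij y by auto
        \<comment> \<open>Only equality remains: \<open>y\<close> and the repeated entry have half
          the full size, and every other slice is full. A full slice cannot accompany a half one in
          a balanced tuple, so all entries are halves, and \<open>k + l >= 5\<close> of them violate
          \<open>sum_less\<close>.\<close>
        have dP: "2 * d ?u = P" "d y = d ?u" using uv au True dle[of ?u] duy ij by auto
        have a_zs: "2 * a z = P" if "z \<in> set zs" for z
        proof (rule ccontr)
          assume *: "2 * a z \<noteq> P"
          then have "z \<noteq> ?u" "z \<noteq> y" using au dP by auto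
          moreover have "z \<in> S" using that zs by auto
          ultimately have "d z + d ?u + d y \<le> P"
            using sub[of "{z, ?u, y}"] ij y by auto
          then have "d z = 0" using dP by simp
          then have az: "a z = P" using da[OF \<open>z \<in> S\<close>] by simp
          obtain t where t: "t < length zs" "zs ! t = z" using \<open>z \<in> set zs\<close> by (auto simp: in_set_conv_nth)
          then have "t \<noteq> i" using \<open>z \<noteq> ?u\<close> by auto
          then have "a z + a ?u \<le> P"
            using pair_le[OF zs, of t i] pair_le[OF zs, of i t] t zs ij
            by (auto simp: balanced_def nat_neq_iff add.commute)
          then show False using az au dP P by auto
        qed
        have "real (a z) = real P / 2" if "z \<in> set zs" for z
          using arg_cong[OF a_zs[OF that], of real] by simp
        then have "(\<Sum>z\<leftarrow>zs. real (a z)) = (\<Sum>z\<leftarrow>zs. real P / 2)"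
          by (intro arg_cong[of _ _ sum_list] map_cong refl)
        also have "\<dots> = real P * (real (k + l) / 2)"
          using zs by (simp add: balanced_def sum_list_triv)
        finally have "real P * (real (k + l) / 2) < real P * (1 + (real (k + l) - 1) / real p)"
          using sum_less[OF zs] by linarith
        then have "real (k + l) / 2 < 1 + (real (k + l) - 1) / real p" using P by (simp only: mult_less_cancel_left_pos of_nat_0_less_iff)
        moreover have "(real (k + l) - 1) / real p \<le> 1 / 2"
          using p2 p prime_gt_0_nat[OF p] by (simp add: field_simps)
        ultimately show False using kl by simp
      qed
    qed
    moreover have "card (S - {y}) = m" using 2 y finite_S by simp
    ultimately show ?thesis by (intro exI[of _ "S - {y}"]) blast
  qed
qed

end

section \<open>Vosper's theorem\<close>

text \<open>Subsets of \<open>F\<^sub>p\<close> are represented by their preimages in the integers.\<close>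

definition periodic :: "nat \<Rightarrow> int set \<Rightarrow> bool" where
  "periodic p X \<longleftrightarrow> (\<forall>x\<in>X. \<forall>i. x + i * int p \<in> X)"

definition pcard :: "nat \<Rightarrow> int set \<Rightarrow> nat" where
  "pcard p X = card (X \<inter> {0..<int p})"

text \<open>Degenerate parameters occur as well: \<open>d = 0\<close> with \<open>N = 1\<close>
  gives a single residue class, and \<open>N > p\<close> with \<open>d\<close> prime to
  \<open>p\<close> gives all integers.\<close>

definition progression :: "nat \<Rightarrow> int \<Rightarrow> int \<Rightarrow> nat \<Rightarrow> int set" where
  "progression p b d N = {x. \<exists>i<N. int p dvd x - (b + int i * d)}"

lemma periodicD: "periodic p X \<Longrightarrow> x \<in> X \<Longrightarrow> int p dvd y - x \<Longrightarrow> y \<in> X"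
  unfolding periodic_def dvd_def by (metis add.commute diff_add_cancel mult.commute)

lemma periodicI: "(\<And>x y. x \<in> X \<Longrightarrow> int p dvd y - x \<Longrightarrow> y \<in> X) \<Longrightarrow> periodic p X"
  by (simp add: periodic_def)

lemma periodic_mod_iff: "periodic p X \<Longrightarrow> x mod int p \<in> X \<longleftrightarrow> x \<in> X"
  using periodicD[of p X x "x mod int p"] periodicD[of p X "x mod int p" x]
  by (metis dvd_diff_commute dvd_minus_mod)

lemma periodic_Un: "periodic p X \<Longrightarrow> periodic p Y \<Longrightarrow> periodic p (X \<union> Y)"
  and periodic_Int: "periodic p X \<Longrightarrow> periodic p Y \<Longrightarrow> periodic p (X \<inter> Y)"
  by (auto simp: periodic_def)

lemma periodic_Compl: "periodic p X \<Longrightarrow> periodic p (- X)"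
  by (rule periodicI) (meson ComplD ComplI dvd_diff_commute periodicD)

lemma periodic_Diff: "periodic p X \<Longrightarrow> periodic p Y \<Longrightarrow> periodic p (X - Y)"
  unfolding Diff_eq by (intro periodic_Int periodic_Compl)

lemma periodic_plus: "periodic p X \<Longrightarrow> periodic p (X + Y)"
  unfolding periodic_def
  by (auto elim!: set_plus_elim) (metis add.assoc add.commute set_plus_intro)

lemma periodic_vimage:
  assumes "periodic p X"
  shows "periodic p {x. u * x + c \<in> X}"
proof (rule periodicI)
  fix x y assume "x \<in> {x. u * x + c \<in> X}" "int p dvd y - x"
  then have "u * x + c \<in> X" "int p dvd (u * y + c) - (u * x + c)"
    by (auto simp: right_diff_distrib[symmetric])
  then show "y \<in> {x. u * x + c \<in> X}" using periodicD[OF assms] by blast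
qed

lemma periodic_progression: "periodic p (progression p b d N)"
  by (rule periodicI) (auto simp: progression_def, metis diff_add_cancel add_diff_eq dvd_add)

lemma pcard_le: "pcard p X \<le> p"
  unfolding pcard_def using card_mono[of "{0..<int p}" "X \<inter> {0..<int p}"] by simp

lemma pcard_mono: "X \<subseteq> Y \<Longrightarrow> pcard p X \<le> pcard p Y"
  unfolding pcard_def by (intro card_mono) auto

lemma pcard_Un_Int: "pcard p (X \<union> Y) + pcard p (X \<inter> Y) = pcard p X + pcard p Y"
proof -
  have "(X \<union> Y) \<inter> {0..<int p} = (X \<inter> {0..<int p}) \<union> (Y \<inter> {0..<int p})"
    "X \<inter> Y \<inter> {0..<int p} = (X \<inter> {0..<int p}) \<inter> (Y \<inter> {0..<int p})" by auto
  then show ?thesis unfolding pcard_def using card_Un_Int[of "X \<inter> {0..<int p}" "Y \<inter> {0..<int p}"] by simp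
qed

lemma pcard_Un_disjoint: "X \<inter> Y = {} \<Longrightarrow> pcard p (X \<union> Y) = pcard p X + pcard p Y"
  using pcard_Un_Int[of p X Y] by (simp add: pcard_def)

lemma pcard_Diff: "Y \<subseteq> X \<Longrightarrow> pcard p (X - Y) + pcard p Y = pcard p X"
  using pcard_Un_disjoint[of "X - Y" Y p] by (simp add: Un_absorb2 Diff_Int_distrib2)

lemma pcard_Compl: "pcard p (- X) + pcard p X = p"
  using pcard_Diff[of X UNIV p] by (simp add: Compl_eq_Diff_UNIV pcard_def[of p UNIV])

lemma pcard_eq_0_iff:
  assumes "p > 0" "periodic p X"
  shows "pcard p X = 0 \<longleftrightarrow> X = {}"
proof
  assume *: "pcard p X = 0"
  have "x \<notin> X" for x
  proof
    assume "x \<in> X"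
    then have "x mod int p \<in> X \<inter> {0..<int p}" using assms by (simp add: periodic_mod_iff)
    then show False using * by (auto simp: pcard_def)
  qed
  then show "X = {}" by blast
qed (simp add: pcard_def)

lemma pcard_subset_eq:
  assumes "p > 0" "periodic p X" "periodic p Y" "X \<subseteq> Y" "pcard p Y \<le> pcard p X"
  shows "X = Y"
proof -
  have "pcard p (Y - X) = 0" using pcard_Diff[OF assms(4), of p] assms(5) by simp
  then have "Y - X = {}" using pcard_eq_0_iff[OF assms(1) periodic_Diff[OF assms(3,2)]] by simp
  then show ?thesis using assms(4) by blast
qed

lemma coprime_prime_int: "prime p \<Longrightarrow> \<not> int p dvd u \<Longrightarrow> coprime u (int p)"
  by (metis coprime_commute prime_imp_coprime prime_nat_int_transfer)

lemma pcard_vimage: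
  assumes p: "prime p" and X: "periodic p X" and u: "\<not> int p dvd u"
  shows "pcard p {x. u * x + c \<in> X} = pcard p X"
proof -
  have p0: "p > 0" using p prime_gt_0_nat by simp
  obtain v where v: "[u * v = 1] (mod int p)"
    using coprime_prime_int[OF p u] by (metis cong_solve_coprime_int)
  have dvd: "int p dvd u * (v * z) - z" for z
  proof -
    have "u * (v * z) - z = (u * v - 1) * z" by (simp add: algebra_simps)
    then show ?thesis using v by (simp add: cong_iff_dvd_diff)
  qed
  have "bij_betw (\<lambda>x. (u * x + c) mod int p) ({x. u * x + c \<in> X} \<inter> {0..<int p}) (X \<inter> {0..<int p})"
  proof (rule bij_betwI[where g = "\<lambda>y. (v * (y - c)) mod int p"])
    show "(\<lambda>x. (u * x + c) mod int p) \<in> {x. u * x + c \<in> X} \<inter> {0..<int p} \<rightarrow> X \<inter> {0..<int p}"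
      using p0 X by (auto simp: periodic_mod_iff)
    show "(\<lambda>y. v * (y - c) mod int p) \<in> X \<inter> {0..<int p} \<rightarrow> {x. u * x + c \<in> X} \<inter> {0..<int p}"
    proof
      fix y assume y: "y \<in> X \<inter> {0..<int p}"
      have "int p dvd u * (v * (y - c)) + c - y" using dvd[of "y - c"] by (simp add: algebra_simps)
      then have "v * (y - c) \<in> {x. u * x + c \<in> X}" using periodicD[OF X] y by auto
      then show "v * (y - c) mod int p \<in> {x. u * x + c \<in> X} \<inter> {0..<int p}"
        using p0 periodic_mod_iff[OF periodic_vimage[OF X, of u c]] by simp
    qed
    show "v * ((u * x + c) mod int p - c) mod int p = x" if "x \<in> {x. u * x + c \<in> X} \<inter> {0..<int p}" for x
    proof -
      have "v * ((u * x + c) mod int p - c) mod int p = v * (((u * x + c) mod int p - c) mod int p) mod int p"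
        by (simp only: mod_mult_right_eq)
      also have "\<dots> = (u * (v * x)) mod int p"
        by (simp only: mod_diff_left_eq add_diff_cancel_right' mod_mult_right_eq mult.left_commute)
      also have "\<dots> = x mod int p" using dvd[of x] by (simp add: mod_eq_dvd_iff)
      finally show ?thesis using that by simp
    qed
    show "(u * (v * (y - c) mod int p) + c) mod int p = y" if "y \<in> X \<inter> {0..<int p}" for y
    proof -
      have "(u * (v * (y - c) mod int p) + c) mod int p = (u * (v * (y - c)) + c) mod int p"
        by (metis mod_add_left_eq mod_mult_right_eq)
      also have "\<dots> = y mod int p" using dvd[of "y - c"] by (simp add: mod_eq_dvd_iff algebra_simps)
      finally show ?thesis using that by simp
    qed
  qed
  then show ?thesis unfolding pcard_def by (rule bij_betw_same_card)
qed

lemma pcard_shift: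
  assumes "prime p" "periodic p X"
  shows "pcard p ((+) c ` X) = pcard p X" and "periodic p ((+) c ` X)"
proof -
  have *: "(+) c ` X = {x. 1 * x + (- c) \<in> X}" by (auto simp: image_iff) (metis add_diff_cancel_left' diff_add_cancel add.commute)
  have "\<not> int p dvd 1" using assms(1) prime_gt_1_nat by auto
  then show "pcard p ((+) c ` X) = pcard p X" unfolding * using pcard_vimage[OF assms] by blast
  show "periodic p ((+) c ` X)" unfolding * using assms(2) by (rule periodic_vimage)
qed

lemma pcard_uminus:
  assumes "prime p" "periodic p X"
  shows "pcard p (uminus ` X) = pcard p X" and "periodic p (uminus ` X)"
proof -
  have *: "uminus ` X = {x. (- 1) * x + 0 \<in> X}" by (auto simp: image_iff) (metis minus_minus)
  have "\<not> int p dvd - 1" using assms(1) prime_gt_1_nat by auto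
  then show "pcard p (uminus ` X) = pcard p X" unfolding * using pcard_vimage[OF assms] by blast
  show "periodic p (uminus ` X)" unfolding * using assms(2) by (rule periodic_vimage)
qed

lemma exists_multiple:
  assumes "prime p" "\<not> int p dvd d"
  shows "\<exists>i<p. int p dvd z - (y + int i * d)"
proof -
  have p0: "p > 0" using assms prime_gt_0_nat by simp
  obtain v where v: "[d * v = 1] (mod int p)"
    using coprime_prime_int[OF assms] by (metis cong_solve_coprime_int)
  define i where "i = nat (((z - y) * v) mod int p)"
  have i: "int i = ((z - y) * v) mod int p" using p0 by (simp add: i_def)
  then have "i < p" using p0 by (metis mod_less_divisor of_nat_0_less_iff of_nat_less_iff pos_mod_bound)
  have "(y + int i * d) mod int p = (y + ((z - y) * v) * d) mod int p"
    unfolding i by (metis mod_add_right_eq mod_mult_left_eq)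
  also have "\<dots> = z mod int p"
  proof -
    have "y + ((z - y) * v) * d - z = (z - y) * (d * v - 1)" by (simp add: algebra_simps)
    then show ?thesis using v by (simp add: mod_eq_dvd_iff cong_iff_dvd_diff)
  qed
  finally have "int p dvd z - (y + int i * d)" by (metis mod_eq_dvd_iff)
  then show ?thesis using \<open>i < p\<close> by blast
qed

section \<open>Arithmetic progressions modulo p\<close>

lemma progression_mem: "i < N \<Longrightarrow> b + int i * d \<in> progression p b d N"
  by (auto simp: progression_def)

lemma progression_mono: "N \<le> N' \<Longrightarrow> progression p b d N \<subseteq> progression p b d N'"
  by (auto simp: progression_def) (meson order_less_le_trans)

lemma pcard_progression_le:
  assumes "p > 0"
  shows "pcard p (progression p b d N) \<le> N"
proof -
  have "progression p b d N \<inter> {0..<int p} \<subseteq> (\<lambda>i. (b + int i * d) mod int p) ` {..<N}"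
  proof
    fix x assume x: "x \<in> progression p b d N \<inter> {0..<int p}"
    then obtain i where "i < N" "int p dvd x - (b + int i * d)" by (auto simp: progression_def)
    then have "x mod int p = (b + int i * d) mod int p" by (simp add: mod_eq_dvd_iff)
    then show "x \<in> (\<lambda>i. (b + int i * d) mod int p) ` {..<N}" using x \<open>i < N\<close> by auto
  qed
  then have "pcard p (progression p b d N) \<le> card ((\<lambda>i. (b + int i * d) mod int p) ` {..<N})"
    unfolding pcard_def by (intro card_mono) auto
  also have "\<dots> \<le> N" using card_image_le[of "{..<N}"] by force
  finally show ?thesis .
qed

lemma progression_disjoint:
  assumes p: "prime p" and d: "\<not> int p dvd d" and "i < p" "j < p" "int p dvd (b + int i * d) - (b + int j * d)"
  shows "i = j"
proof -
  have "int p dvd (int i - int j) * d" using assms(5) by (simp add: algebra_simps)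
  then have "int p dvd int i - int j"
    using p d by (metis prime_dvd_multD prime_nat_int_transfer)
  then have "int i mod int p = int j mod int p" by (simp add: mod_eq_dvd_iff)
  then show ?thesis using assms(3,4) by simp
qed

lemma progression_Compl:
  assumes p: "prime p" and d: "\<not> int p dvd d" and "N \<le> p"
  shows "- progression p b d N = progression p (b + int N * d) d (p - N)"
proof (intro equalityI subsetI)
  fix x assume x: "x \<in> - progression p b d N"
  obtain i where i: "i < p" "int p dvd x - (b + int i * d)" using exists_multiple[OF p d] by blast
  then have "\<not> i < N" using x by (auto simp: progression_def)
  then have "b + int N * d + int (i - N) * d = b + int i * d" by (simp add: algebra_simps of_nat_diff)
  then have "int p dvd x - (b + int N * d + int (i - N) * d)" using i(2) by (simp only:)
  moreover have "i - N < p - N" using i \<open>\<not> i < N\<close> by simp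
  ultimately show "x \<in> progression p (b + int N * d) d (p - N)"
    unfolding progression_def by blast
next
  fix x assume "x \<in> progression p (b + int N * d) d (p - N)"
  then obtain i where i: "i < p - N" "int p dvd x - (b + int (N + i) * d)"
    by (auto simp: progression_def algebra_simps)
  show "x \<in> - progression p b d N"
  proof
    assume "x \<in> progression p b d N"
    then obtain j where j: "j < N" "int p dvd x - (b + int j * d)" by (auto simp: progression_def)
    then have "int p dvd (b + int (N + i) * d) - (b + int j * d)"
      using i(2) dvd_diff[OF j(2) i(2)] by simp
    then have "N + i = j" using i j assms by (intro progression_disjoint[OF p d]) auto
    then show False using j by simp
  qed
qed

lemma pcard_progression:
  assumes p: "prime p" and d: "\<not> int p dvd d" and "N \<le> p"
  shows "pcard p (progression p b d N) = N"
proof -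
  have p0: "p > 0" using p prime_gt_0_nat by simp
  have "pcard p (- progression p b d N) \<le> p - N"
    unfolding progression_Compl[OF assms] by (rule pcard_progression_le[OF p0])
  then show ?thesis
    using pcard_progression_le[OF p0, of b d N] pcard_Compl[of p "progression p b d N"] assms(3) by linarith
qed

lemma progression_plus:
  assumes "N \<ge> 1" "N' \<ge> 1"
  shows "progression p b d N + progression p b' d N' = progression p (b + b') d (N + N' - 1)"
proof (intro equalityI subsetI)
  fix z assume "z \<in> progression p b d N + progression p b' d N'"
  then obtain x y where "z = x + y" "x \<in> progression p b d N" "y \<in> progression p b' d N'"
    by (rule set_plus_elim)
  then obtain i j where ij: "i < N" "j < N'" "int p dvd x - (b + int i * d)" "int p dvd y - (b' + int j * d)" "z = x + y"
    by (auto simp: progression_def)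
  have "int p dvd (x - (b + int i * d)) + (y - (b' + int j * d))" using ij by (intro dvd_add)
  also have "(x - (b + int i * d)) + (y - (b' + int j * d)) = z - (b + b' + int (i + j) * d)"
    by (simp add: ij(5) algebra_simps)
  finally have "int p dvd z - (b + b' + int (i + j) * d)" .
  moreover have "i + j < N + N' - 1" using ij by simp
  ultimately show "z \<in> progression p (b + b') d (N + N' - 1)" unfolding progression_def by blast
next
  fix z assume "z \<in> progression p (b + b') d (N + N' - 1)"
  then obtain i where i: "i < N + N' - 1" "int p dvd z - (b + b' + int i * d)" by (auto simp: progression_def)
  define i1 where "i1 = min i (N - 1)"
  have "i1 < N" "i - i1 < N'" "int i = int i1 + int (i - i1)" using i assms by (auto simp: i1_def min_def)
  have "int i1 * d + int (i - i1) * d = int i * d"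
    using \<open>int i = int i1 + int (i - i1)\<close> by (metis distrib_right)
  then have "z - (b + int i1 * d) - (b' + int (i - i1) * d) = z - (b + b' + int i * d)"
    by (simp add: algebra_simps)
  then have "int p dvd z - (b + int i1 * d) - (b' + int (i - i1) * d)" using i(2) by (simp only:)
  then have "z - (b + int i1 * d) \<in> progression p b' d N'"
    unfolding progression_def using \<open>i - i1 < N'\<close> by blast
  then have "(b + int i1 * d) + (z - (b + int i1 * d)) \<in> progression p b d N + progression p b' d N'"
    using progression_mem[OF \<open>i1 < N\<close>] by (intro set_plus_intro)
  then show "z \<in> progression p b d N + progression p b' d N'" by simp
qed

lemma progression_uminus:
  assumes "N \<ge> 1"
  shows "uminus ` progression p b d N = progression p (- (b + int (N - 1) * d)) d N"
proof -
  have sub: "uminus ` progression p b d N \<subseteq> progression p (- (b + int (N - 1) * d)) d N" for b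
  proof
    fix z assume "z \<in> uminus ` progression p b d N"
    then obtain i where i: "i < N" "int p dvd - z - (b + int i * d)" by (auto simp: progression_def)
    have "z - (- (b + int (N - 1) * d) + int (N - 1 - i) * d) = - (- z - (b + int i * d))"
      using i by (simp add: algebra_simps of_nat_diff)
    then have "int p dvd z - (- (b + int (N - 1) * d) + int (N - 1 - i) * d)" using i by (simp only: dvd_minus_iff)
    then show "z \<in> progression p (- (b + int (N - 1) * d)) d N"
      using i unfolding progression_def by (intro CollectI exI[of _ "N - 1 - i"]) auto
  qed
  have "uminus ` progression p (- (b + int (N - 1) * d)) d N \<subseteq> progression p b d N"
    using sub[of "- (b + int (N - 1) * d)"] by simp
  then have "uminus ` uminus ` progression p (- (b + int (N - 1) * d)) d N \<subseteq> uminus ` progression p b d N"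
    by (rule image_mono)
  then show ?thesis using sub by (auto simp: image_image)
qed

text \<open>On residues this is the weak Kneser bound with \<open>M = 1\<close>, that is, the
  Cauchy--Davenport theorem; periodicity makes the reduction modulo \<open>p\<close> compatible with
  sums of integer sets.\<close>

lemma pcard_plus_ge:
  assumes p: "prime p" and A: "periodic p A" "A \<noteq> {}" and B: "periodic p B" "B \<noteq> {}"
  shows "min p (pcard p A + pcard p B - 1) \<le> pcard p (A + B)"
proof -
  have p0: "p > 0" using p prime_gt_0_nat by simp
  interpret F: comm_group "add_monoid (Fp p)" using p by (rule comm_group_Fp)
  let ?R = "{0..<int p}"
  have c: "carrier (add_monoid (Fp p)) = ?R" by auto
  have "(A \<inter> ?R) <#>\<^bsub>add_monoid (Fp p)\<^esub> (B \<inter> ?R) = (A + B) \<inter> ?R"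
  proof (intro equalityI subsetI)
    fix z assume "z \<in> (A \<inter> ?R) <#>\<^bsub>add_monoid (Fp p)\<^esub> (B \<inter> ?R)"
    then obtain x y where "x \<in> A" "y \<in> B" "z = (x + y) mod int p" by (auto simp: set_mult_def)
    then show "z \<in> (A + B) \<inter> ?R"
      using p0 periodic_mod_iff[OF periodic_plus[OF A(1)]] by (auto intro: set_plus_intro)
  next
    fix z assume z: "z \<in> (A + B) \<inter> ?R"
    then obtain x y where xy: "x \<in> A" "y \<in> B" "z = x + y" by (auto elim: set_plus_elim)
    then have "x mod int p \<in> A \<inter> ?R" "y mod int p \<in> B \<inter> ?R"
      using A B p0 by (auto simp: periodic_mod_iff)
    moreover have "z = (x mod int p + y mod int p) mod int p" using z xy by (simp add: mod_simps)
    then have "z = (x mod int p) \<otimes>\<^bsub>add_monoid (Fp p)\<^esub> (y mod int p)" by simp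
    ultimately show "z \<in> (A \<inter> ?R) <#>\<^bsub>add_monoid (Fp p)\<^esub> (B \<inter> ?R)"
      unfolding set_mult_def by blast
  qed
  moreover have "A \<inter> ?R \<noteq> {}" "B \<inter> ?R \<noteq> {}"
    using A B p0 pcard_eq_0_iff by (auto simp: pcard_def)
  moreover have "min (real (card ?R)) (real (card (A \<inter> ?R)) + real (card (B \<inter> ?R)) - 1)
      \<le> real (card ((A \<inter> ?R) <#>\<^bsub>add_monoid (Fp p)\<^esub> (B \<inter> ?R)))"
    using F.card_set_mult_weak_kneser[of 1 "A \<inter> ?R" "B \<inter> ?R"] card_proper_subgroup_Fp[OF p] calculation
    unfolding c by auto
  ultimately have "min (real p) (real (pcard p A) + real (pcard p B) - 1) \<le> real (pcard p (A + B))"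
    by (simp only: pcard_def) simp
  then show ?thesis by linarith
qed

text \<open>At most one residue of \<open>d + B\<close> lies outside \<open>B\<close>, so steps by
  \<open>d\<close> can leave \<open>B\<close> only from one residue \<open>e\<close>. The walk from
  any element of \<open>B\<close> has to leave, hence passes through \<open>e\<close>, and
  \<open>B\<close> is the run of steps that ends there.\<close>

lemma progression_if_shift:
  assumes p: "prime p" and d: "\<not> int p dvd d" and B: "periodic p B" "B \<noteq> {}" "pcard p B < p"
    and le: "pcard p (B \<union> (+) d ` B) \<le> pcard p B + 1"
  shows "\<exists>b N. B = progression p b d N"
proof -
  have p0: "p > 0" using p prime_gt_0_nat by simp
  have leave: "\<exists>i. y + int i * c \<notin> B" if "\<not> int p dvd c" for y c
  proof (rule ccontr)
    assume *: "\<not> ?thesis"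
    have "B = UNIV"
    proof (intro equalityI subsetI UNIV_I)
      fix z
      obtain i where "int p dvd z - (y + int i * c)" using exists_multiple[OF p \<open>\<not> int p dvd c\<close>] by blast
      then show "z \<in> B" using * periodicD[OF B(1)] by blast
    qed
    then show False using B(3) by (simp add: pcard_def)
  qed
  have "pcard p ((+) d ` B - B) \<le> 1"
    using pcard_Un_disjoint[of B "(+) d ` B - B" p] le by simp
  then have fin1: "card (((+) d ` B - B) \<inter> {0..<int p}) \<le> 1" by (simp add: pcard_def)
  have uniq: "int p dvd e - e'" if e: "e \<in> B" "e + d \<notin> B" "e' \<in> B" "e' + d \<notin> B" for e e'
  proof -
    have per: "periodic p ((+) d ` B - B)" using pcard_shift(2)[OF p B(1)] B(1) by (rule periodic_Diff)
    have "d + e \<in> (+) d ` B - B" "d + e' \<in> (+) d ` B - B" using e by (auto simp: add.commute)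
    then have "(d + e) mod int p \<in> ((+) d ` B - B) \<inter> {0..<int p}"
      "(d + e') mod int p \<in> ((+) d ` B - B) \<inter> {0..<int p}"
      using p0 by (simp_all only: Int_iff periodic_mod_iff[OF per]) simp_all
    then have "(d + e) mod int p = (d + e') mod int p"
      using fin1 card_le_Suc0_iff_eq[of "((+) d ` B - B) \<inter> {0..<int p}"] by simp
    then have "int p dvd (d + e) - (d + e')" by (simp add: mod_eq_dvd_iff)
    then show ?thesis by simp
  qed
  have up: "\<exists>i. y + int i * d \<in> B \<and> y + int i * d + d \<notin> B \<and> (\<forall>j\<le>i. y + int j * d \<in> B)" if "y \<in> B" for y
  proof -
    define i where "i = (LEAST i. y + int i * d \<notin> B)"
    have i: "y + int i * d \<notin> B" unfolding i_def using leave[OF d] by (metis (mono_tags, lifting) LeastI_ex)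
    have least: "y + int j * d \<in> B" if "j < i" for j using not_less_Least that unfolding i_def by blast
    have "i \<noteq> 0"
    proof
      assume "i = 0"
      then show False using i that by simp
    qed
    then have "y + int (i - 1) * d + d = y + int i * d" by (simp add: algebra_simps of_nat_diff)
    then have "y + int (i - 1) * d + d \<notin> B" using i by metis
    moreover have "\<forall>j\<le>i - 1. y + int j * d \<in> B" using least \<open>i \<noteq> 0\<close> by simp
    ultimately show ?thesis by blast
  qed
  obtain y0 where "y0 \<in> B" using B(2) by blast
  then obtain e where e: "e \<in> B" "e + d \<notin> B" using up by blast
  have d': "\<not> int p dvd - d" using d by simp
  \<comment> \<open>\<open>N\<close> is the length of the run inside \<open>B\<close> that ends at
    \<open>e\<close>, found by walking backwards.\<close>
  define N where "N = (LEAST i. e + int i * (- d) \<notin> B)"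
  have N: "e + int N * (- d) \<notin> B" unfolding N_def using leave[OF d'] by (metis (mono_tags, lifting) LeastI_ex)
  have least: "e + int j * (- d) \<in> B" if "j < N" for j using not_less_Least that unfolding N_def by blast
  have "N \<noteq> 0"
  proof
    assume "N = 0"
    then show False using N e by simp
  qed
  have "B = progression p (e - int (N - 1) * d) d N"
  proof (intro equalityI subsetI)
    fix y assume "y \<in> B"
    then obtain i where i: "y + int i * d \<in> B" "y + int i * d + d \<notin> B" "\<forall>j\<le>i. y + int j * d \<in> B"
      using up by blast
    have dv: "int p dvd (y + int i * d) - e" using uniq[OF i(1,2) e] .
    have "i < N"
    proof (rule ccontr)
      assume "\<not> i < N"
      have "y + int (i - N) * d \<in> B" using i(3) by (metis diff_le_self)
      moreover have "(e + int N * (- d)) - (y + int (i - N) * d) = - ((y + int i * d) - e)"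
        using \<open>\<not> i < N\<close> by (simp add: algebra_simps of_nat_diff)
      ultimately show False using N periodicD[OF B(1)] dv by (metis dvd_minus_iff)
    qed
    then have "y - (e - int (N - 1) * d + int (N - 1 - i) * d) = (y + int i * d) - e"
      by (simp add: algebra_simps of_nat_diff)
    then have "int p dvd y - (e - int (N - 1) * d + int (N - 1 - i) * d)" using dv by (simp only:)
    moreover have "N - 1 - i < N" using \<open>N \<noteq> 0\<close> by simp
    ultimately show "y \<in> progression p (e - int (N - 1) * d) d N"
      unfolding progression_def by blast
  next
    fix y assume "y \<in> progression p (e - int (N - 1) * d) d N"
    then obtain i where i: "i < N" "int p dvd y - (e - int (N - 1) * d + int i * d)"
      by (auto simp: progression_def)
    have "e - int (N - 1) * d + int i * d = e + int (N - 1 - i) * (- d)"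
      using i by (simp add: algebra_simps of_nat_diff)
    then have "int p dvd y - (e + int (N - 1 - i) * (- d))" using i by (simp only:)
    moreover have "N - 1 - i < N" using \<open>N \<noteq> 0\<close> by simp
    ultimately show "y \<in> B" using periodicD[OF B(1) least[of "N - 1 - i"]] by blast
  qed
  then show ?thesis by blast
qed

text \<open>Splitting a two-term progression off the given one writes the sum as a progression of
  length \<open>N - 1\<close> plus the union of \<open>B\<close> and its translate by
  \<open>d\<close>. By Cauchy--Davenport this union has at most one residue more than
  \<open>B\<close>.\<close>

lemma progression_if_critical:
  assumes p: "prime p" and d: "\<not> int p dvd d" and B: "periodic p B" "B \<noteq> {}"
    and N: "2 \<le> pcard p (progression p b d N)"
    and crit: "pcard p (progression p b d N + B) = pcard p (progression p b d N) + pcard p B - 1"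
      "pcard p (progression p b d N + B) + 2 \<le> p"
  shows "\<exists>b N. B = progression p b d N"
proof (rule progression_if_shift[OF p d B])
  have p0: "p > 0" using p prime_gt_0_nat by simp
  let ?A = "progression p b d N"
  have N2: "2 \<le> N" using N pcard_progression_le[OF p0, of b d N] by linarith
  show "pcard p B < p" using N crit by linarith
  have "N \<le> p"
  proof (rule ccontr)
    assume "\<not> N \<le> p"
    then have "progression p b d p \<subseteq> ?A" by (intro progression_mono) simp
    then have "p \<le> pcard p ?A" using pcard_mono pcard_progression[OF p d, of p b] by (metis order_refl)
    then show False using N crit B p0 pcard_eq_0_iff[OF p0 B(1)] by linarith
  qed
  then have cA: "pcard p ?A = N" using pcard_progression[OF p d] by blast
  have "progression p 0 d 2 + progression p b d (N - 1) = ?A"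
    using progression_plus[of 2 "N - 1" p 0 d b] N2 by (simp add: numeral_2_eq_2)
  then have AB: "?A + B = progression p b d (N - 1) + (progression p 0 d 2 + B)" by (simp add: ac_simps)
  have eq: "progression p 0 d 2 + B = B \<union> (+) d ` B"
  proof (intro equalityI subsetI)
    fix z assume "z \<in> progression p 0 d 2 + B"
    then obtain x y where "z = x + y" "x \<in> progression p 0 d 2" "y \<in> B" by (rule set_plus_elim)
    then obtain i where i: "i < 2" "int p dvd x - int i * d" "z = x + y" "y \<in> B" by (auto simp: progression_def)
    then have "int p dvd z - (int i * d + y)" by (simp add: algebra_simps)
    moreover have "int i * d + y \<in> B \<union> (+) d ` B" using i by (auto simp: less_2_cases_iff)
    moreover have "periodic p (B \<union> (+) d ` B)" using B(1) pcard_shift(2)[OF p B(1)] by (rule periodic_Un)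
    ultimately show "z \<in> B \<union> (+) d ` B" using periodicD by blast
  next
    fix z assume "z \<in> B \<union> (+) d ` B"
    then obtain i y where "i < 2" "y \<in> B" "z = (0 + int i * d) + y"
      by (auto intro: that[of 0] that[of 1])
    then show "z \<in> progression p 0 d 2 + B" using progression_mem[of i 2 0 d p] by (auto intro: set_plus_intro)
  qed
  have ne: "progression p b d (N - 1) \<noteq> {}" using progression_mem[of 0 "N - 1" b d p] N2 by auto
  have "min p (pcard p (progression p b d (N - 1)) + pcard p (B \<union> (+) d ` B) - 1) \<le> pcard p (?A + B)"
    unfolding AB eq using B ne
    by (intro pcard_plus_ge[OF p periodic_progression] periodic_Un pcard_shift(2)[OF p]) auto
  moreover have "pcard p (progression p b d (N - 1)) = N - 1"
    using \<open>N \<le> p\<close> by (intro pcard_progression[OF p d]) simp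
  ultimately show "pcard p (B \<union> (+) d ` B) \<le> pcard p B + 1"
    using crit cA N2 by (simp add: min_def split: if_splits)
qed

text \<open>Duality: the complement \<open>D\<close> of \<open>A + B\<close> is a progression, and
  \<open>D - A\<close> avoids \<open>B\<close>, which makes \<open>D\<close> and \<open>- A\<close>
  a critical pair. So \<open>- A\<close> and hence \<open>A\<close> is a progression with difference
  \<open>d\<close>, and then so is \<open>B\<close>.\<close>

lemma progressions_if_sum_progression:
  assumes p: "prime p" and d: "\<not> int p dvd d" and A: "periodic p A" "A \<noteq> {}" and B: "periodic p B" "B \<noteq> {}"
    and crit: "pcard p (A + B) = pcard p A + pcard p B - 1" "pcard p (A + B) + 2 \<le> p"
    and "2 \<le> pcard p A" "2 \<le> pcard p B" and AB: "A + B = progression p b d N"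
  shows "(\<exists>b N. A = progression p b d N) \<and> (\<exists>b N. B = progression p b d N)"
proof -
  have p0: "p > 0" using p prime_gt_0_nat by simp
  have "N \<le> p"
  proof (rule ccontr)
    assume "\<not> N \<le> p"
    then have "progression p b d p \<subseteq> progression p b d N" by (intro progression_mono) simp
    then have "p \<le> pcard p (A + B)" unfolding AB using pcard_mono pcard_progression[OF p d, of p b] by (metis order_refl)
    then show False using crit by linarith
  qed
  let ?D = "- (A + B)"
  have D: "?D = progression p (b + int N * d) d (p - N)" unfolding AB by (rule progression_Compl[OF p d \<open>N \<le> p\<close>])
  have cD: "pcard p ?D + pcard p (A + B) = p" by (rule pcard_Compl)
  have "?D + uminus ` A \<subseteq> - B"
  proof
    fix z assume "z \<in> ?D + uminus ` A"
    then obtain x a where "z = x - a" "x \<notin> A + B" "a \<in> A" by (auto elim!: set_plus_elim)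
    then show "z \<in> - B" by (metis ComplI add_diff_cancel_left' add.commute diff_add_cancel set_plus_intro)
  qed
  then have "pcard p (?D + uminus ` A) \<le> pcard p (- B)" by (rule pcard_mono)
  moreover have "pcard p (- B) + pcard p B = p" by (rule pcard_Compl)
  moreover have perD: "periodic p ?D" unfolding D by (rule periodic_progression)
  have "?D \<noteq> {}" using cD crit by (auto simp: pcard_def)
  have perA: "periodic p (uminus ` A)" and cA: "pcard p (uminus ` A) = pcard p A" using pcard_uminus[OF p A(1)] by auto
  have "min p (pcard p ?D + pcard p (uminus ` A) - 1) \<le> pcard p (?D + uminus ` A)"
    using perD \<open>?D \<noteq> {}\<close> perA A by (intro pcard_plus_ge[OF p]) auto
  ultimately have "pcard p (?D + uminus ` A) = pcard p ?D + pcard p (uminus ` A) - 1"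
      "pcard p (?D + uminus ` A) + 2 \<le> p"
    using cA cD crit assms(8-10) by (auto simp: min_def split: if_splits)
  moreover have "2 \<le> pcard p ?D" using cD crit by linarith
  ultimately obtain b' N' where A': "uminus ` A = progression p b' d N'"
    using progression_if_critical[OF p d perA, of "b + int N * d" "p - N"] A unfolding D by blast
  have "N' \<ge> 1"
  proof (rule ccontr)
    assume "\<not> ?thesis"
    then have "uminus ` A = {}" using A' by (simp add: progression_def)
    then show False using A by simp
  qed
  have "A = uminus ` uminus ` A" by (simp add: image_image)
  also have "\<dots> = progression p (- (b' + int (N' - 1) * d)) d N'"
    unfolding A' by (rule progression_uminus[OF \<open>N' \<ge> 1\<close>])
  finally have A'': "A = progression p (- (b' + int (N' - 1) * d)) d N'" .
  have "\<exists>b N. B = progression p b d N"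
    using progression_if_critical[OF p d B, of "- (b' + int (N' - 1) * d)" N'] assms(9) crit
    unfolding A''[symmetric] by blast
  then show ?thesis using A'' by blast
qed

text \<open>Induction by e-transforms, with \<open>E a\<close> as the transformed \<open>B\<close>.
  If some \<open>E a\<close> is smaller than \<open>B\<close> but has at least two residues, the new
  pair is critical with the same sum, so this sum is a progression and duality leads back to
  \<open>A\<close> and \<open>B\<close>. Otherwise every \<open>E a\<close> is all of
  \<open>B\<close> or just the class of \<open>b0\<close>; then either \<open>B\<close> has two
  residues or \<open>A + B\<close> turns out too large.\<close>

theorem vosper:
  assumes p: "prime p" and "periodic p A" "periodic p B" "2 \<le> pcard p A" "2 \<le> pcard p B"
    and "pcard p (A + B) = pcard p A + pcard p B - 1" "pcard p (A + B) + 2 \<le> p"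
  shows "\<exists>d. \<not> int p dvd d \<and> (\<exists>b N. A = progression p b d N) \<and> (\<exists>b N. B = progression p b d N)"
  using assms(2-)
proof (induction "pcard p B" arbitrary: A B rule: less_induct)
  case less
  note A = \<open>periodic p A\<close> and B = \<open>periodic p B\<close> and A2 = \<open>2 \<le> pcard p A\<close> and B2 = \<open>2 \<le> pcard p B\<close>
    and crit = \<open>pcard p (A + B) = pcard p A + pcard p B - 1\<close> \<open>pcard p (A + B) + 2 \<le> p\<close>
  have p0: "p > 0" using p prime_gt_0_nat by simp
  have Ane: "A \<noteq> {}" and Bne: "B \<noteq> {}" using A2 B2 by (auto simp: pcard_def)
  obtain b0 where b0: "b0 \<in> B" using Bne by blast
  define E where "E a = {y \<in> B. a - b0 + y \<in> A}" for a
  have perE: "periodic p (E a)" for a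
  proof -
    have "E a = B \<inter> {y. 1 * y + (a - b0) \<in> A}" by (auto simp: E_def add.commute)
    then show ?thesis using periodic_Int[OF B periodic_vimage[OF A, of 1 "a - b0"]] by simp
  qed
  have Esub: "E a \<subseteq> B" for a by (auto simp: E_def)
  have b0E: "b0 \<in> E a" if "a \<in> A" for a using that b0 by (simp add: E_def)
  define C where "C = progression p b0 0 1"
  have C: "x \<in> C \<longleftrightarrow> int p dvd x - b0" for x by (simp add: C_def progression_def)
  have perC: "periodic p C" unfolding C_def by (rule periodic_progression)
  have cC: "pcard p C \<le> 1" unfolding C_def using pcard_progression_le[OF p0] by blast
  have CB: "C \<subseteq> E a" if "a \<in> A" for a using periodicD[OF perE b0E[OF that]] C by blast
  show ?case
  proof (cases "\<exists>a\<in>A. 2 \<le> pcard p (E a) \<and> pcard p (E a) < pcard p B")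
    case True
    then obtain a where a: "a \<in> A" "2 \<le> pcard p (E a)" "pcard p (E a) < pcard p B" by blast
    define A' where "A' = A \<union> (+) (a - b0) ` B"
    have perA': "periodic p A'" unfolding A'_def using A pcard_shift(2)[OF p B] by (rule periodic_Un)
    have "A \<inter> (+) (a - b0) ` B = (+) (a - b0) ` E a" by (auto simp: E_def)
    then have cA': "pcard p A' + pcard p (E a) = pcard p A + pcard p B"
      using pcard_Un_Int[of p A "(+) (a - b0) ` B"] pcard_shift(1)[OF p B] pcard_shift(1)[OF p perE]
      by (simp add: A'_def)
    have sub: "A' + E a \<subseteq> A + B"
    proof
      fix z assume "z \<in> A' + E a"
      then obtain x y where xy: "z = x + y" "x \<in> A'" "y \<in> E a" by (rule set_plus_elim)
      show "z \<in> A + B"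
      proof (cases "x \<in> A")
        case True
        then show ?thesis using xy by (auto simp: E_def)
      next
        case False
        then obtain u where "u \<in> B" "x = a - b0 + u" using xy by (auto simp: A'_def)
        then have "z = (a - b0 + y) + u" "a - b0 + y \<in> A" using xy by (auto simp: E_def)
        then show ?thesis using \<open>u \<in> B\<close> by (metis set_plus_intro)
      qed
    qed
    have A'ne: "A' \<noteq> {}" "E a \<noteq> {}" using Ane b0E[OF a(1)] by (auto simp: A'_def)
    have "min p (pcard p A' + pcard p (E a) - 1) \<le> pcard p (A' + E a)"
      using perA' perE A'ne by (intro pcard_plus_ge[OF p]) auto
    then have ge: "pcard p (A + B) \<le> pcard p (A' + E a)"
      using cA' crit by (simp add: min_def split: if_splits)
    have eq: "A' + E a = A + B"
      using ge sub by (intro pcard_subset_eq[OF p0] periodic_plus perA' A)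
    have A'2: "2 \<le> pcard p A'" using A2 pcard_mono[of A A' p] by (simp add: A'_def)
    have "\<exists>d. \<not> int p dvd d \<and> (\<exists>b N. A' = progression p b d N) \<and> (\<exists>b N. E a = progression p b d N)"
      using a(2,3) perA' perE A'2 crit cA' unfolding eq[symmetric] by (intro less.hyps) auto
    then obtain d b N b' N' where d: "\<not> int p dvd d" "A' = progression p b d N" "E a = progression p b' d N'"
      by blast
    then have "N \<ge> 1" "N' \<ge> 1" using A'ne by (auto simp: progression_def Suc_le_eq intro: gr0I)
    then have "A + B = progression p (b + b') d (N + N' - 1)"
      using eq d progression_plus by metis
    then show ?thesis
      using progressions_if_sum_progression[OF p d(1) A Ane B Bne crit A2 B2] d(1) by blast
  next
    case False
    show ?thesis
    proof (cases "pcard p B = 2")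
      case True
      have "pcard p (B - C) + pcard p C = 2" using pcard_Diff[OF order_trans[OF CB Esub], of _ p] Ane True by fastforce
      then have "pcard p (B - C) \<noteq> 0" using cC by linarith
      then have "B - C \<noteq> {}" by (metis pcard_def card.empty Int_empty_left)
      then obtain y where y: "y \<in> B" "\<not> int p dvd y - b0" using C by blast
      have "progression p b0 (y - b0) 2 \<subseteq> B"
      proof
        fix x assume "x \<in> progression p b0 (y - b0) 2"
        then obtain i where "i < 2" "int p dvd x - (b0 + int i * (y - b0))" by (auto simp: progression_def)
        moreover have "b0 + int i * (y - b0) \<in> B" using \<open>i < 2\<close> b0 y by (auto simp: less_2_cases_iff)
        ultimately show "x \<in> B" using periodicD[OF B] by blast
      qed
      then have Beq: "B = progression p b0 (y - b0) 2"
        using True pcard_progression[OF p y(2), of 2 b0] crit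
        by (intro pcard_subset_eq[OF p0 periodic_progression B, symmetric]) auto
      then have "\<exists>b N. A = progression p b (y - b0) N"
        using progression_if_critical[OF p y(2) A Ane, of b0 2] B2 crit by (simp add: add.commute)
      then show ?thesis using Beq y(2) by blast
    next
      case B3: False
      define A1 where "A1 = {a \<in> A. E a \<noteq> B}"
      have per1: "periodic p A1"
      proof (rule periodicI)
        fix x y assume x: "x \<in> A1" "int p dvd y - x"
        have "E y = E x"
        proof -
          have "int p dvd (y - b0 + z) - (x - b0 + z)" "int p dvd (x - b0 + z) - (y - b0 + z)" for z
            using x(2) by (auto simp: dvd_diff_commute)
          then show ?thesis using periodicD[OF A] unfolding E_def by blast
        qed
        then show "y \<in> A1" using x periodicD[OF A] by (auto simp: A1_def)
      qed
      have A1sub: "A1 \<subseteq> A" by (auto simp: A1_def)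
      have EC: "E a = C" if "a \<in> A1" for a
      proof -
        have a: "a \<in> A" "E a \<noteq> B" using that by (auto simp: A1_def)
        then have "pcard p (E a) < pcard p B"
          using pcard_subset_eq[OF p0 perE B Esub] by (metis not_le)
        then have "pcard p (E a) \<le> 1" using False a by force
        moreover have "1 \<le> pcard p C"
          using pcard_eq_0_iff[OF p0 perC] C[of b0] by (metis dvd_0_right diff_self empty_iff less_one not_le)
        ultimately show ?thesis using pcard_subset_eq[OF p0 perC perE CB[OF a(1)]] by auto
      qed
      have A1_2: "2 \<le> pcard p A1"
      proof (cases "A - A1 = {}")
        case True
        then show ?thesis using A1sub A2 by (simp add: subset_antisym)
      next
        case ne: False
        \<comment> \<open>If \<open>E x = B\<close>, then \<open>x + B\<close> stays inside
          \<open>b0 + A\<close>. Comparing sizes leaves at least \<open>|B| - 1 >= 2\<close>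
          residues for \<open>A1\<close>.\<close>
        have "(A - A1) + B \<subseteq> (+) b0 ` A"
        proof
          fix z assume "z \<in> (A - A1) + B"
          then obtain x y where xy: "z = x + y" "x \<in> A - A1" "y \<in> B" by (rule set_plus_elim)
          then have "y \<in> E x" by (auto simp: A1_def)
          then have "x - b0 + y \<in> A" by (simp add: E_def)
          then show "z \<in> (+) b0 ` A" using xy by (auto simp: image_iff intro!: bexI[of _ "x - b0 + y"])
        qed
        then have "pcard p ((A - A1) + B) \<le> pcard p A" using pcard_mono pcard_shift(1)[OF p A] by metis
        moreover have "min p (pcard p (A - A1) + pcard p B - 1) \<le> pcard p ((A - A1) + B)"
          using ne Bne by (intro pcard_plus_ge[OF p] periodic_Diff A per1 B)
        moreover have "pcard p (A - A1) + pcard p A1 = pcard p A" using A1sub by (rule pcard_Diff)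
        ultimately show ?thesis using B2 B3 crit by (simp add: min_def split: if_splits)
      qed
      then have A1ne: "A1 \<noteq> {}" by (auto simp: pcard_def)
      then have CB': "C \<subseteq> B" using CB Esub A1sub by blast
      have cBC: "pcard p (B - C) + pcard p C = pcard p B" using CB' by (rule pcard_Diff)
      then have "pcard p (B - C) \<noteq> 0" using cC B2 B3 by linarith
      then have BCne: "B - C \<noteq> {}" by (metis pcard_def card.empty Int_empty_left)
      \<comment> \<open>For \<open>x\<close> in \<open>A1\<close> and \<open>y\<close> in
        \<open>B\<close> outside the class of \<open>b0\<close>, the sum \<open>x + y\<close> is not
        in \<open>b0 + A\<close>. There are at least \<open>|B|\<close> such residues, but a
        critical pair has room for \<open>|B| - 1\<close> only.\<close>
      have sub: "A1 + (B - C) \<subseteq> (A + B) - (+) b0 ` A"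
      proof
        fix z assume "z \<in> A1 + (B - C)"
        then obtain x y where xy: "z = x + y" "x \<in> A1" "y \<in> B" "y \<notin> C" by (auto elim: set_plus_elim)
        then have "y \<notin> E x" using EC by simp
        then have "x - b0 + y \<notin> A" using xy by (simp add: E_def)
        then have "z \<notin> (+) b0 ` A" using xy by (auto simp: algebra_simps)
        then show "z \<in> (A + B) - (+) b0 ` A" using xy A1sub by auto
      qed
      have "(+) b0 ` A \<subseteq> A + B" using b0 by (auto simp: add.commute intro: set_plus_intro)
      then have "pcard p ((A + B) - (+) b0 ` A) + pcard p A = pcard p (A + B)"
        using pcard_Diff pcard_shift(1)[OF p A] by metis
      moreover have "pcard p (A1 + (B - C)) \<le> pcard p ((A + B) - (+) b0 ` A)" using sub by (rule pcard_mono)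
      moreover have "min p (pcard p A1 + pcard p (B - C) - 1) \<le> pcard p (A1 + (B - C))"
        using A1ne BCne by (intro pcard_plus_ge[OF p] periodic_Diff per1 B perC)
      ultimately have False using A1_2 cBC cC crit A2 B2 by (simp add: min_def split: if_splits)
      then show ?thesis ..
    qed
  qed
qed

section \<open>Small doubling of the support\<close>

text \<open>\<open>S\<close> is the support of a sum-free set, and \<open>S'\<close> consists of the positions of its large slices.\<close>

definition core :: "nat \<Rightarrow> nat \<Rightarrow> nat \<Rightarrow> int set \<Rightarrow> int set \<Rightarrow> bool" where
  "core p k l S S' \<longleftrightarrow> S' \<subseteq> S \<and>
    (\<forall>zs i j. balanced p k l zs \<longrightarrow> set zs \<subseteq> S \<longrightarrow> i < j \<longrightarrow> j < k + l \<longrightarrow> zs ! i \<in> S' \<longrightarrow> zs ! j \<notin> S')"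

lemma coreD:
  "core p k l S S' \<Longrightarrow> balanced p k l zs \<Longrightarrow> set zs \<subseteq> S \<Longrightarrow> i < j \<Longrightarrow> j < k + l \<Longrightarrow>
    zs ! i \<in> S' \<Longrightarrow> zs ! j \<in> S' \<Longrightarrow> False"
  by (auto simp: core_def)

lemma balancedI:
  "length us = k \<Longrightarrow> length vs = l \<Longrightarrow> int p dvd sum_list us - sum_list vs \<Longrightarrow> balanced p k l (us @ vs)"
  by (simp add: balanced_def mod_eq_dvd_iff)

text \<open>The sets are pulled back along the dilation so that tuples can be pushed forward, and
  multiplication by \<open>d\<close> keeps tuples balanced.\<close>

lemma core_scale:
  assumes "core p k l S S'"
  shows "core p k l {x. d * x \<in> S} {x. d * x \<in> S'}"
  unfolding core_def
proof (intro conjI allI impI notI)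
  show "{x. d * x \<in> S'} \<subseteq> {x. d * x \<in> S}" using assms by (auto simp: core_def)
  fix zs i j
  assume zs: "balanced p k l zs" "set zs \<subseteq> {x. d * x \<in> S}" and ij: "i < j" "j < k + l"
    "zs ! i \<in> {x. d * x \<in> S'}" "zs ! j \<in> {x. d * x \<in> S'}"
  have len: "length zs = k + l" using zs by (simp add: balanced_def)
  have "balanced p k l (map ((*) d) zs)"
  proof -
    have "(d * sum_list (take k zs)) mod int p = (d * sum_list (drop k zs)) mod int p"
      using zs(1) unfolding balanced_def by (metis mod_mult_right_eq)
    then show ?thesis using len by (simp add: balanced_def take_map drop_map sum_list_const_mult)
  qed
  moreover have "set (map ((*) d) zs) \<subseteq> S" using zs(2) by auto
  ultimately show False using coreD[OF assms, of "map ((*) d) zs" i j] ij len by auto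
qed

section \<open>Sums of several sets of residues\<close>

lemma sum_list_sets_iff:
  "z \<in> sum_list (Xs :: int set list) \<longleftrightarrow> (\<exists>zs. list_all2 (\<in>) zs Xs \<and> sum_list zs = z)"
proof (induction Xs arbitrary: z)
  case Nil
  then show ?case by (auto simp: set_zero)
next
  case (Cons X Xs)
  show ?case
  proof
    assume "z \<in> sum_list (X # Xs)"
    then obtain x w where "z = x + w" "x \<in> X" "w \<in> sum_list Xs" by (auto elim: set_plus_elim)
    moreover from this Cons.IH obtain zs where "list_all2 (\<in>) zs Xs" "sum_list zs = w" by blast
    ultimately show "\<exists>zs. list_all2 (\<in>) zs (X # Xs) \<and> sum_list zs = z"
      by (intro exI[of _ "x # zs"]) simp
  next
    assume "\<exists>zs. list_all2 (\<in>) zs (X # Xs) \<and> sum_list zs = z"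
    then obtain x zs where "x \<in> X" "list_all2 (\<in>) zs Xs" "z = x + sum_list zs"
      by (auto simp: list_all2_Cons2)
    then show "z \<in> sum_list (X # Xs)" using Cons.IH by (auto intro: set_plus_intro)
  qed
qed

lemma sum_list_replicate_iff:
  "z \<in> sum_list (replicate h (X :: int set)) \<longleftrightarrow> (\<exists>zs. set zs \<subseteq> X \<and> length zs = h \<and> sum_list zs = z)"
proof -
  have "list_all2 (\<in>) zs (replicate h X) \<longleftrightarrow> set zs \<subseteq> X \<and> length zs = h" for zs
    by (auto simp: list_all2_conv_all_nth in_set_conv_nth subset_iff)
  then show ?thesis unfolding sum_list_sets_iff by auto
qed

text \<open>A solution inside \<open>S'\<close> would have two entries in \<open>S'\<close> among
  its \<open>k >= 2\<close> left-hand ones; the core condition thus contains the sum-freeness of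
  \<open>S'\<close>.\<close>

lemma core_zero_notin:
  assumes "core p k l S S'" "k \<ge> 2"
  shows "0 \<notin> sum_list (replicate k S') + uminus ` sum_list (replicate l S')"
proof
  assume "0 \<in> sum_list (replicate k S') + uminus ` sum_list (replicate l S')"
  then obtain x y where "0 = x + y" "x \<in> sum_list (replicate k S')" "y \<in> uminus ` sum_list (replicate l S')"
    by (rule set_plus_elim)
  then obtain us vs where uv: "set us \<subseteq> S'" "length us = k" "set vs \<subseteq> S'" "length vs = l" "sum_list us = sum_list vs"
    by (auto simp: sum_list_replicate_iff)
  then have "balanced p k l (us @ vs)" by (intro balancedI) auto
  moreover have "S' \<subseteq> S" using assms(1) by (simp add: core_def)
  moreover have "(us @ vs) ! 0 \<in> S'" "(us @ vs) ! 1 \<in> S'"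
    using uv assms(2) by (auto simp: nth_append subset_iff)
  ultimately show False using coreD[OF assms(1), of "us @ vs" 0 1] uv assms(2) by auto
qed

lemma uminus_plus: "uminus ` (X + Y) = uminus ` X + uminus ` (Y :: int set)"
proof (intro equalityI subsetI)
  fix z assume "z \<in> uminus ` (X + Y)"
  then obtain x y where "x \<in> X" "y \<in> Y" "z = - x + - y" by (auto elim!: set_plus_elim)
  then show "z \<in> uminus ` X + uminus ` Y" by (metis imageI set_plus_intro)
next
  fix z assume "z \<in> uminus ` X + uminus ` Y"
  then obtain x y where "x \<in> X" "y \<in> Y" "z = - (x + y)" by (auto elim!: set_plus_elim)
  then show "z \<in> uminus ` (X + Y)" by (metis imageI set_plus_intro)
qed

lemma uminus_sum_list_replicate:
  "uminus ` sum_list (replicate h (X :: int set)) = sum_list (replicate h (uminus ` X))"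
  by (induction h) (auto simp: uminus_plus set_zero)

text \<open>Grouping equal summands in pairs lets the size of \<open>X + X\<close> enter the
  estimates for multiple sums.\<close>

lemma sum_list_replicate_double:
  "sum_list (replicate (2 * a + b) (X :: int set)) = sum_list (replicate a (X + X)) + sum_list (replicate b X)"
  by (induction a) (auto simp: add.assoc)

lemma sum_list_props:
  assumes "Zs \<noteq> []" "\<forall>Z\<in>set Zs. periodic p Z \<and> Z \<noteq> {}"
  shows "periodic p (sum_list Zs)" "sum_list Zs \<noteq> {}"
proof -
  obtain Z Zs' where Zs: "Zs = Z # Zs'" using assms(1) by (cases Zs) auto
  show "periodic p (sum_list Zs)" using assms Zs by (simp add: periodic_plus)
  have "\<exists>zs. list_all2 (\<in>) zs Zs" using assms(2)
    by (induction Zs) (auto simp: list_all2_Cons2)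
  then show "sum_list Zs \<noteq> {}" using sum_list_sets_iff by blast
qed

lemma pcard_sum_list_ge:
  assumes p: "prime p" and "Zs \<noteq> []" "\<forall>Z\<in>set Zs. periodic p Z \<and> Z \<noteq> {}"
  shows "min (int p) ((\<Sum>Z\<leftarrow>Zs. int (pcard p Z) - 1) + 1) \<le> int (pcard p (sum_list Zs))"
  using assms(2,3)
proof (induction Zs)
  case (Cons Z Zs)
  show ?case
  proof (cases "Zs = []")
    case False
    have p0: "p > 0" using p prime_gt_0_nat by simp
    have IH: "min (int p) ((\<Sum>Z\<leftarrow>Zs. int (pcard p Z) - 1) + 1) \<le> int (pcard p (sum_list Zs))"
      using Cons False by simp
    have s: "periodic p (sum_list Zs)" "sum_list Zs \<noteq> {}" using Cons.prems False sum_list_props by auto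
    have "min p (pcard p Z + pcard p (sum_list Zs) - 1) \<le> pcard p (Z + sum_list Zs)"
      using Cons.prems s by (intro pcard_plus_ge[OF p]) auto
    moreover have "pcard p Z \<ge> 1" using Cons.prems pcard_eq_0_iff[OF p0, of Z] by (simp add: Suc_le_eq)
    ultimately have "min (int p) (int (pcard p Z) + int (pcard p (sum_list Zs)) - 1) \<le> int (pcard p (Z + sum_list Zs))"
      by linarith
    then show ?thesis using IH \<open>pcard p Z \<ge> 1\<close> unfolding list.map sum_list.Cons by linarith
  qed simp
qed simp

text \<open>These are the sets for which Vosper's theorem improves the Cauchy--Davenport bound by
  one at each addition.\<close>

definition no_progression :: "nat \<Rightarrow> int set \<Rightarrow> bool" where
  "no_progression p Z \<longleftrightarrow> periodic p Z \<and> 2 \<le> pcard p Z \<and>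
    (\<forall>b d N. \<not> int p dvd d \<longrightarrow> Z \<noteq> progression p b d N)"

lemma no_progression_uminus:
  assumes p: "prime p" and Z: "no_progression p Z"
  shows "no_progression p (uminus ` Z)"
  unfolding no_progression_def
proof (intro conjI allI impI notI)
  have per: "periodic p Z" "2 \<le> pcard p Z" using Z by (auto simp: no_progression_def)
  show "periodic p (uminus ` Z)" "2 \<le> pcard p (uminus ` Z)" using pcard_uminus[OF p per(1)] per by auto
  fix b d N assume d: "\<not> int p dvd d" "uminus ` Z = progression p b d N"
  have "N \<ge> 1"
  proof (rule ccontr)
    assume "\<not> ?thesis"
    then have "Z = {}" using d by (simp add: progression_def)
    then show False using per by (simp add: pcard_def)
  qed
  then have "uminus ` uminus ` Z = progression p (- (b + int (N - 1) * d)) d N"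
    unfolding d(2) by (rule progression_uminus)
  then have "Z = progression p (- (b + int (N - 1) * d)) d N" by (simp only: image_image minus_minus image_ident)
  then show False using Z d(1) unfolding no_progression_def by blast
qed

text \<open>Vosper's theorem gains one residue per addition, but only up to \<open>p - 1\<close>,
  since it does not speak about larger sums. The last addition is therefore made with
  Cauchy--Davenport, which can reach \<open>p\<close>; this costs the \<open>- 1\<close> in the
  conclusion.\<close>

lemma pcard_sum_list_vosper:
  assumes p: "prime p" and "Zs \<noteq> []" "\<forall>Z\<in>set Zs. no_progression p Z"
  shows "min (int p) ((\<Sum>Z\<leftarrow>Zs. int (pcard p Z)) - 1) \<le> int (pcard p (sum_list Zs))"
proof -
  have p0: "p > 0" using p prime_gt_0_nat by simp
  have ap: "periodic p Z" "2 \<le> pcard p Z" "Z \<noteq> {}" if "no_progression p Z" for Z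
    using that by (auto simp: no_progression_def pcard_def)
  have v: "min (p - 1) (pcard p Z + pcard p Y) \<le> pcard p (Z + Y)"
    if Z: "no_progression p Z" and Y: "periodic p Y" "2 \<le> pcard p Y" for Z Y
  proof (rule ccontr)
    assume *: "\<not> ?thesis"
    have "Y \<noteq> {}" using Y by (auto simp: pcard_def)
    then have "min p (pcard p Z + pcard p Y - 1) \<le> pcard p (Z + Y)"
      using ap[OF Z] Y by (intro pcard_plus_ge[OF p]) auto
    then have "pcard p (Z + Y) = pcard p Z + pcard p Y - 1" "pcard p (Z + Y) + 2 \<le> p"
      using * by (auto simp: min_def split: if_splits)
    then have "\<exists>d. \<not> int p dvd d \<and> (\<exists>b N. Z = progression p b d N) \<and> (\<exists>b N. Y = progression p b d N)"
      using ap[OF Z] Y by (intro vosper[OF p]) auto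
    then show False using Z by (auto simp: no_progression_def)
  qed
  have weak: "min (int p - 1) (\<Sum>Z\<leftarrow>Zs. int (pcard p Z)) \<le> int (pcard p (sum_list Zs)) \<and>
      2 \<le> pcard p (sum_list Zs)" if "Zs \<noteq> []" "\<forall>Z\<in>set Zs. no_progression p Z" for Zs
    using that
  proof (induction Zs)
    case (Cons Z Zs)
    show ?case
    proof (cases "Zs = []")
      case True
      then show ?thesis using Cons ap by auto
    next
      case False
      have IH: "min (int p - 1) (\<Sum>Z\<leftarrow>Zs. int (pcard p Z)) \<le> int (pcard p (sum_list Zs))"
        "2 \<le> pcard p (sum_list Zs)" using Cons False by auto
      have s: "periodic p (sum_list Zs)" "sum_list Zs \<noteq> {}" using Cons.prems False sum_list_props[of Zs p] ap by auto
      have Z: "no_progression p Z" using Cons by simp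
      have "min p (pcard p Z + pcard p (sum_list Zs) - 1) \<le> pcard p (Z + sum_list Zs)"
        using ap[OF Z] s by (intro pcard_plus_ge[OF p]) auto
      moreover have "2 \<le> p" using p prime_ge_2_nat by simp
      ultimately have "2 \<le> pcard p (Z + sum_list Zs)" using ap(2)[OF Z] IH(2) by linarith
      moreover have "min (p - 1) (pcard p Z + pcard p (sum_list Zs)) \<le> pcard p (Z + sum_list Zs)"
        using v[OF Z s(1) IH(2)] .
      ultimately show ?thesis using IH(1) \<open>2 \<le> p\<close> ap(2)[OF Z]
        by simp
    qed
  qed simp
  show ?thesis
  proof (cases "length Zs = 1")
    case True
    then obtain Z where "Zs = [Z]" by (auto simp: length_Suc_conv)
    then show ?thesis by simp
  next
    case False
    then obtain Z Zs' where Zs: "Zs = Z # Zs'" "Zs' \<noteq> []" using assms(2) by (cases Zs) auto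
    have Z: "no_progression p Z" and Zs': "\<forall>Z\<in>set Zs'. no_progression p Z" using assms Zs by auto
    have s: "periodic p (sum_list Zs')" "sum_list Zs' \<noteq> {}" using Zs' Zs(2) sum_list_props[of Zs' p] ap by auto
    have "min p (pcard p Z + pcard p (sum_list Zs') - 1) \<le> pcard p (Z + sum_list Zs')"
      using ap[OF Z] s by (intro pcard_plus_ge[OF p]) auto
    then have "min (int p) (int (pcard p Z) + int (pcard p (sum_list Zs')) - 1) \<le> int (pcard p (Z + sum_list Zs'))"
      using ap(2)[OF Z] by linarith
    then show ?thesis using weak[OF Zs(2) Zs'] ap(2)[OF Z]
      unfolding Zs(1) list.map sum_list.Cons by linarith
  qed
qed

lemma pcard_eq_card_interval:
  assumes p: "prime p" and X: "periodic p X" "X \<subseteq> progression p b 1 N" and "N \<le> p"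
  shows "pcard p X = card {u \<in> {0..<int N}. b + u \<in> X}"
proof -
  have p0: "p > 0" using p prime_gt_0_nat by simp
  have "bij_betw (\<lambda>u. (b + u) mod int p) {u \<in> {0..<int N}. b + u \<in> X} (X \<inter> {0..<int p})"
  proof (rule bij_betw_imageI)
    show "inj_on (\<lambda>u. (b + u) mod int p) {u \<in> {0..<int N}. b + u \<in> X}"
    proof (rule inj_onI)
      fix u v assume "u \<in> {u \<in> {0..<int N}. b + u \<in> X}" "v \<in> {u \<in> {0..<int N}. b + u \<in> X}"
        "(b + u) mod int p = (b + v) mod int p"
      then have "int p dvd u - v" "0 \<le> u" "u < int p" "0 \<le> v" "v < int p"
        using assms(4) by (auto simp: mod_eq_dvd_iff)
      have "u mod int p = v mod int p" using \<open>int p dvd u - v\<close> by (simp only: mod_eq_dvd_iff)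
      then show "u = v"
        using mod_pos_pos_trivial[OF \<open>0 \<le> u\<close> \<open>u < int p\<close>] mod_pos_pos_trivial[OF \<open>0 \<le> v\<close> \<open>v < int p\<close>] by linarith
    qed
    show "(\<lambda>u. (b + u) mod int p) ` {u \<in> {0..<int N}. b + u \<in> X} = X \<inter> {0..<int p}"
    proof (intro equalityI subsetI)
      fix x assume "x \<in> (\<lambda>u. (b + u) mod int p) ` {u \<in> {0..<int N}. b + u \<in> X}"
      then show "x \<in> X \<inter> {0..<int p}" using p0 X(1) by (auto simp: periodic_mod_iff)
    next
      fix x assume x: "x \<in> X \<inter> {0..<int p}"
      then obtain i where i: "i < N" "int p dvd x - (b + int i * 1)" using X(2) by (auto simp: progression_def)
      then have "b + int i \<in> X" using periodicD[OF X(1), of x] x by (simp add: dvd_diff_commute)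
      moreover have "x = (b + int i) mod int p"
        using i x by (metis IntD2 atLeastLessThan_iff mod_eq_dvd_iff mod_pos_pos_trivial mult.right_neutral)
      ultimately show "x \<in> (\<lambda>u. (b + u) mod int p) ` {u \<in> {0..<int N}. b + u \<in> X}" using i by auto
    qed
  qed
  from bij_betw_same_card[OF this] show ?thesis unfolding pcard_def by (rule sym)
qed

lemma plus_scale:
  assumes p: "prime p" and d: "\<not> int p dvd d" and X: "periodic p X" and Y: "periodic p Y"
  shows "{x. d * x \<in> X} + {x. d * x \<in> Y} = {x. d * x \<in> X + Y}"
proof (intro equalityI subsetI)
  fix z assume "z \<in> {x. d * x \<in> X} + {x. d * x \<in> Y}"
  then show "z \<in> {x. d * x \<in> X + Y}" by (auto elim!: set_plus_elim simp: ring_distribs intro: set_plus_intro)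
next
  fix z assume "z \<in> {x. d * x \<in> X + Y}"
  then obtain x y where xy: "d * z = x + y" "x \<in> X" "y \<in> Y" by (auto elim: set_plus_elim)
  obtain i where "int p dvd x - (0 + int i * d)" using exists_multiple[OF p d] by blast
  then have i: "int p dvd x - d * int i" by (simp add: mult.commute)
  then have "d * int i \<in> X" using periodicD[OF X xy(2)] by (simp add: dvd_diff_commute)
  moreover have "int p dvd d * (z - int i) - y" using i xy(1) by (simp add: algebra_simps)
  then have "d * (z - int i) \<in> Y" using periodicD[OF Y xy(3)] by blast
  ultimately have "int i + (z - int i) \<in> {x. d * x \<in> X} + {x. d * x \<in> Y}"
    by (intro set_plus_intro) auto
  then show "z \<in> {x. d * x \<in> X} + {x. d * x \<in> Y}" by simp
qed

lemma scale_progression: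
  assumes p: "prime p" and d: "\<not> int p dvd d"
  shows "\<exists>b'. {x. d * x \<in> progression p b d N} = progression p b' 1 N"
proof -
  obtain i where i: "int p dvd b - (0 + int i * d)" using exists_multiple[OF p d] by blast
  have "int p dvd d * x - (b + int j * d) \<longleftrightarrow> int p dvd x - (int i + int j * 1)" for x j
  proof -
    have "int p dvd d * x - (b + int j * d) \<longleftrightarrow> int p dvd (d * x - (b + int j * d)) + (b - int i * d)"
      using i by (subst dvd_add_left_iff) auto
    also have "(d * x - (b + int j * d)) + (b - int i * d) = d * (x - (int i + int j * 1))"
      by (simp add: algebra_simps)
    also have "int p dvd \<dots> \<longleftrightarrow> int p dvd x - (int i + int j * 1)"
      using coprime_prime_int[OF p d] by (simp only: coprime_commute[of d] coprime_dvd_mult_right_iff)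
    finally show ?thesis .
  qed
  then have "{x. d * x \<in> progression p b d N} = progression p (int i) 1 N"
    unfolding progression_def by auto
  then show ?thesis by blast
qed

text \<open>If \<open>Q + Q\<close> is an interval of even length \<open>2 m + 2\<close>, then for \<open>x, x + t \<in> Q\<close> the elements \<open>2 x\<close>,
  \<open>2 x + t\<close> and \<open>2 x + 2 t\<close> all lie in it, which confines \<open>t\<close> to an interval of length \<open>m + 1\<close>.\<close>

lemma double_not_progression:
  assumes p: "prime p" and Q: "periodic p Q" and d: "\<not> int p dvd d"
    and QQ: "Q + Q = progression p b d (2 * m + 2)" and p4: "4 * m + 2 < p"
  shows False
proof -
  have p0: "p > 0" using p prime_gt_0_nat by simp
  define X where "X = {x. d * x \<in> Q}"
  have perX: "periodic p X" using periodic_vimage[OF Q, of d 0] by (simp add: X_def)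
  obtain c where "{x. d * x \<in> Q + Q} = progression p c 1 (2 * m + 2)"
    using scale_progression[OF p d] unfolding QQ by blast
  then have XX: "X + X = progression p c 1 (2 * m + 2)"
    using plus_scale[OF p d Q Q] by (simp add: X_def)
  have one: "\<not> int p dvd 1" using p prime_gt_1_nat by auto
  have cXX: "pcard p (X + X) = 2 * m + 2" unfolding XX using p4 by (intro pcard_progression[OF p one]) simp
  then have "X + X \<noteq> {}" by (auto simp: pcard_def)
  then obtain x where x: "x \<in> X" by (auto elim: set_plus_elim)
  have inXX: "\<exists>i. 0 \<le> i \<and> i \<le> 2 * int m + 1 \<and> int p dvd u + v - (c + i)" if "u \<in> X" "v \<in> X" for u v
  proof -
    have "u + v \<in> progression p c 1 (2 * m + 2)" using that XX by (metis set_plus_intro)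
    then obtain i where "i < 2 * m + 2" "int p dvd u + v - (c + int i * 1)" unfolding progression_def by blast
    then show ?thesis by (intro exI[of _ "int i"]) auto
  qed
  obtain i0 where i0: "0 \<le> i0" "i0 \<le> 2 * int m + 1" "int p dvd x + x - (c + i0)" using inXX[OF x x] by blast
  \<comment> \<open>One of \<open>i0\<close> and \<open>2 * m + 1 - i0\<close> is odd, so the two
    halves, rounded down, add up to \<open>m\<close> only. This is where the even length of the
    interval is used.\<close>
  define lo hi where "lo = i0 div 2" and "hi = (2 * int m + 1 - i0) div 2"
  have lohi: "lo \<ge> 0" "hi \<ge> 0" "lo + hi \<le> int m" "i0 \<le> 2 * lo + 1" "2 * int m + 1 - i0 \<le> 2 * hi + 1"
    using i0 unfolding lo_def hi_def by linarith+
  have "X \<subseteq> progression p (x - lo) 1 (m + 1)"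
  proof
    fix y assume y: "y \<in> X"
    obtain i1 where i1: "0 \<le> i1" "i1 \<le> 2 * int m + 1" "int p dvd x + y - (c + i1)" using inXX[OF x y] by blast
    obtain i2 where i2: "0 \<le> i2" "i2 \<le> 2 * int m + 1" "int p dvd y + y - (c + i2)" using inXX[OF y y] by blast
    define t where "t = i1 - i0"
    have yt: "int p dvd y - (x + t)"
      using dvd_diff[OF i1(3) i0(3)] by (simp add: t_def algebra_simps)
    \<comment> \<open>As \<open>4 * m + 2 < p\<close>, this divisibility forces the value 0, so
      \<open>i0\<close>, \<open>i1\<close>, \<open>i2\<close> are equally spaced as integers and not
      only modulo \<open>p\<close>.\<close>
    have "int p dvd (i2 - i1) - (i1 - i0)"
    proof -
      have "(i2 - i1) - (i1 - i0) = 2 * (x + y - (c + i1)) - (y + y - (c + i2)) - (x + x - (c + i0))" by simp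
      then show ?thesis using i0(3) i1(3) i2(3) by (metis dvd_diff dvd_mult)
    qed
    moreover have "\<bar>(i2 - i1) - (i1 - i0)\<bar> < int p" using i0 i1 i2 p4 by linarith
    ultimately have "(i2 - i1) - (i1 - i0) = 0"
      using dvd_imp_le_int[of "(i2 - i1) - (i1 - i0)" "int p"] by linarith
    then have "i0 + 2 * t = i2" by (simp add: t_def)
    then have t: "- lo \<le> t" "t \<le> hi" using i2 lohi by linarith+
    then have "int (nat (t + lo)) = t + lo" "nat (t + lo) < m + 1" using lohi by auto
    then show "y \<in> progression p (x - lo) 1 (m + 1)"
      using yt unfolding progression_def by (intro CollectI exI[of _ "nat (t + lo)"]) simp
  qed
  then have "X + X \<subseteq> progression p (x - lo) 1 (m + 1) + progression p (x - lo) 1 (m + 1)"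
    by (intro set_plus_mono2)
  then have "pcard p (X + X) \<le> pcard p (progression p (x - lo) 1 (m + 1) + progression p (x - lo) 1 (m + 1))"
    by (rule pcard_mono)
  also have "progression p (x - lo) 1 (m + 1) + progression p (x - lo) 1 (m + 1)
      = progression p (x - lo + (x - lo)) 1 ((m + 1) + (m + 1) - 1)"
    by (rule progression_plus) simp_all
  also have "(m + 1) + (m + 1) - 1 = 2 * m + 1" by simp
  also have "pcard p (progression p (x - lo + (x - lo)) 1 (2 * m + 1)) \<le> 2 * m + 1"
    by (rule pcard_progression_le[OF p0])
  finally have "pcard p (X + X) \<le> 2 * m + 1" .
  then show False using cXX by simp
qed

text \<open>The \<open>k\<close> copies of \<open>Q\<close> and \<open>l\<close> copies of
  \<open>- Q\<close> are grouped into copies of \<open>Q + Q\<close> and its negative. If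
  \<open>Q + Q\<close> had at least \<open>2 m + 3\<close> residues, Cauchy--Davenport would make
  the sum everything. If it had \<open>2 m + 2\<close>, it could not be a progression, hence neither
  could \<open>Q\<close>, and Vosper's theorem would supply the missing residues.\<close>

lemma pcard_double_le:
  assumes p: "prime p" and kl: "k > l" "l \<ge> 1" "k + l \<ge> 5" and peq: "p = (k + l) * m + 2 + lam"
    and lam: "lam \<le> k + l - 5" and m: "m \<ge> 2" and Q: "periodic p Q" "pcard p Q = m"
    and sf: "0 \<notin> sum_list (replicate k Q) + uminus ` sum_list (replicate l Q)"
  shows "pcard p (Q + Q) \<le> 2 * m + 1"
proof (rule ccontr)
  assume *: "\<not> ?thesis"
  have p0: "p > 0" using p prime_gt_0_nat by simp
  let ?B = "Q + Q"
  define a b a' b' where "a = k div 2" and "b = k mod 2" and "a' = l div 2" and "b' = l mod 2"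
  have ab: "k = 2 * a + b" "l = 2 * a' + b'" "b \<le> 1" "b' \<le> 1"
    by (auto simp: a_def b_def a'_def b'_def)
  define Zs where "Zs = replicate a ?B @ replicate b Q @ replicate a' (uminus ` ?B) @ replicate b' (uminus ` Q)"
  have sum_Zs: "sum_list Zs = sum_list (replicate k Q) + uminus ` sum_list (replicate l Q)"
    unfolding ab(1,2) sum_list_replicate_double uminus_plus uminus_sum_list_replicate
    by (simp add: Zs_def add.assoc uminus_plus)
  have "a \<ge> 1" using kl by (auto simp: a_def)
  then have Zne: "Zs \<noteq> []" by (auto simp: Zs_def)
  have Qne: "Q \<noteq> {}" using Q m by (auto simp: pcard_def)
  then have Bne: "?B \<noteq> {}" using set_plus_intro by blast
  have perB: "periodic p ?B" using Q(1) by (rule periodic_plus)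
  have per: "\<forall>Z\<in>set Zs. periodic p Z \<and> Z \<noteq> {}"
    using Q(1) perB Qne Bne pcard_uminus(2)[OF p Q(1)] pcard_uminus(2)[OF p perB]
    by (simp add: Zs_def ball_Un)
  have small: "int (pcard p (sum_list Zs)) < int p"
  proof -
    have "0 \<notin> sum_list Zs" using sf sum_Zs by simp
    then have "sum_list Zs \<noteq> UNIV" by blast
    then show ?thesis
      using pcard_subset_eq[OF p0 sum_list_props(1)[OF Zne per], of UNIV] pcard_le[of p UNIV]
        pcard_le[of p "sum_list Zs"] by (auto simp: periodic_def)
  qed
  have um: "pcard p (uminus ` Q) = m" "pcard p (uminus ` ?B) = pcard p ?B"
    using pcard_uminus(1)[OF p] Q perB by auto
  define s where "s = int b + int b'"
  define B2 where "B2 = int (pcard p ?B)"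
  have s: "s \<le> 2" "0 \<le> s" using ab by (auto simp: s_def)
  have rs: "2 * (int a + int a') = int (k + l) - s" using ab by (simp add: s_def)
  \<comment> \<open>The reserve of 3 is used up in both cases when \<open>k\<close> and
    \<open>l\<close> are odd, that is, for \<open>s = 2\<close>.\<close>
  have pi: "int p + 3 \<le> int (k + l) * (int m + 1)"
  proof -
    have "int lam + 5 \<le> int (k + l)" using lam kl by simp
    moreover have "int p = int (k + l) * int m + 2 + int lam" using peq by simp
    ultimately show ?thesis by (simp add: algebra_simps)
  qed
  have "(\<Sum>Z\<leftarrow>Zs. int (pcard p Z) - 1) = (int a + int a') * (B2 - 1) + s * (int m - 1)"
    using Q um by (simp add: Zs_def sum_list_replicate B2_def s_def algebra_simps)
  then have cd: "(int a + int a') * (B2 - 1) + s * (int m - 1) + 1 < int p"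
    using pcard_sum_list_ge[OF p Zne per] small by linarith
  have B2: "B2 = 2 * int m + 2"
  proof (rule ccontr)
    assume "B2 \<noteq> 2 * int m + 2"
    then have "2 * int m + 2 \<le> B2 - 1" using * by (simp add: B2_def)
    then have "(int a + int a') * (2 * int m + 2) \<le> (int a + int a') * (B2 - 1)"
      by (intro mult_left_mono) auto
    moreover have "(int a + int a') * (2 * int m + 2) = (int (k + l) - s) * (int m + 1)"
      unfolding rs[symmetric] by (simp add: algebra_simps)
    ultimately have "int (k + l) * (int m + 1) - 2 * s + 1 < int p"
      using cd by (simp add: algebra_simps)
    then show False using pi s by linarith
  qed
  have notB: "\<not> (\<exists>b d N. \<not> int p dvd d \<and> ?B = progression p b d N)"
  proof
    assume "\<exists>b d N. \<not> int p dvd d \<and> ?B = progression p b d N"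
    then obtain b d N where d: "\<not> int p dvd d" "?B = progression p b d N" by blast
    have p4: "5 * m \<le> (k + l) * m" using kl by (intro mult_right_mono) auto
    then have p4': "4 * m + 2 < p" using m peq by linarith
    have "N = 2 * m + 2"
    proof (cases "N \<le> p")
      case True
      then show ?thesis using pcard_progression[OF p d(1) True, of b] B2 d(2) by (simp add: B2_def)
    next
      case False
      then have "progression p b d p \<subseteq> ?B" unfolding d(2) by (intro progression_mono) simp
      then have "p \<le> pcard p ?B" using pcard_mono pcard_progression[OF p d(1), of p b] by (metis order_refl)
      then show ?thesis using B2 p4' m by (simp add: B2_def)
    qed
    then show False using double_not_progression[OF p Q(1) d(1) _ p4'] d(2) by blast
  qed
  have notQ: "\<not> (\<exists>b d N. \<not> int p dvd d \<and> Q = progression p b d N)"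
  proof
    assume "\<exists>b d N. \<not> int p dvd d \<and> Q = progression p b d N"
    then obtain b d N where d: "\<not> int p dvd d" "Q = progression p b d N" by blast
    then have "N \<ge> 1" using Qne by (cases N) (auto simp: progression_def)
    then have "?B = progression p (b + b) d (N + N - 1)" unfolding d(2) by (intro progression_plus) auto
    then show False using notB d(1) by blast
  qed
  have "2 \<le> pcard p ?B" using B2 by (simp add: B2_def)
  then have "no_progression p ?B" using notB perB unfolding no_progression_def by metis
  moreover have "no_progression p Q" using notQ Q m unfolding no_progression_def by metis
  ultimately have "\<forall>Z\<in>set Zs. no_progression p Z"
    using no_progression_uminus[OF p, of Q] no_progression_uminus[OF p, of ?B]
    by (simp add: Zs_def ball_Un)
  then have "min (int p) ((\<Sum>Z\<leftarrow>Zs. int (pcard p Z)) - 1) \<le> int (pcard p (sum_list Zs))"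
    by (rule pcard_sum_list_vosper[OF p Zne])
  moreover have "(\<Sum>Z\<leftarrow>Zs. int (pcard p Z)) = (int a + int a') * B2 + s * int m"
    using Q um by (simp add: Zs_def sum_list_replicate B2_def s_def algebra_simps)
  moreover have "(int a + int a') * B2 = (int (k + l) - s) * (int m + 1)"
    unfolding B2 rs[symmetric] by (simp add: algebra_simps)
  ultimately have "int (k + l) * (int m + 1) - s - 1 < int p"
    using small by (simp add: algebra_simps)
  then show False using pi s by linarith
qed

text \<open>The hypothesis puts the supremum of the feasible values at \<open>5 / m\<close> or
  above, hence strictly above \<open>4 / m\<close>, and then some feasible \<tau> exceeds
  \<open>4 / m\<close> too. The value 4 is what \<open>2 m + 1 <= (2 + \<tau>) m - 3\<close>
  requires.\<close>

lemma exists_feasible: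
  assumes "5 * T_fun c \<le> ennreal (real m)" "m > 0"
  shows "\<exists>\<tau>. feasible c \<tau> \<and> 4 / real m < \<tau>"
proof (rule ccontr)
  assume *: "\<not> ?thesis"
  have le: "tau_sup c \<le> ennreal (4 / real m)"
    unfolding tau_sup_def using * by (intro SUP_least ennreal_leI) force
  then obtain s where s: "tau_sup c = ennreal s" "0 \<le> s"
    by (cases "tau_sup c") (auto simp: top_unique)
  then have sm: "s \<le> 4 / real m" using le by (simp add: ennreal_le_iff)
  show False
  \<comment> \<open>For \<open>s = 0\<close> the value of \<open>T_fun\<close> is infinite, which
    the real bound \<open>m\<close> excludes.\<close>
  proof (cases "s = 0")
    case True
    then show False using assms(1) s by (simp add: T_fun_def top_unique ennreal_mult_top)
  next
    case False
    then have "s > 0" using s by simp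
    then have "T_fun c = ennreal (1 / s)"
      using s by (simp add: T_fun_def divide_ennreal flip: ennreal_1)
    then have "5 * T_fun c = ennreal (5 * (1 / s))"
      using \<open>s > 0\<close> ennreal_mult[of 5 "1 / s"] by simp
    then have "5 * (1 / s) \<le> real m" using assms(1) by (simp add: ennreal_le_iff)
    then have "5 \<le> real m * s" using \<open>s > 0\<close> by (simp add: field_simps)
    moreover have "real m * s \<le> 4" using sm assms(2) by (simp add: field_simps)
    ultimately show False by simp
  qed
qed

text \<open>The covering property supplies a progression of length \<open>|Q + Q| - |Q| + 1\<close>,
  which is at most \<open>m + 2\<close>.\<close>

lemma covered_by_progression:
  assumes p: "prime p" and Q: "periodic p Q" "pcard p Q = m" and m: "m > 0"
    and QQ: "pcard p (Q + Q) \<le> 2 * m + 1" and c: "real m \<le> c * real p"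
    and T: "5 * T_fun c \<le> ennreal (real m)"
  shows "\<exists>b d. \<not> int p dvd d \<and> Q \<subseteq> progression p b d (m + 2)"
proof -
  have p0: "p > 0" using p prime_gt_0_nat by simp
  interpret F: comm_group "add_monoid (Fp p)" using p by (rule comm_group_Fp)
  obtain \<tau> where \<tau>: "feasible c \<tau>" "4 / real m < \<tau>" using exists_feasible[OF T m] by blast
  let ?X = "Q \<inter> {0..<int p}"
  have X: "?X \<subseteq> carrier (add_monoid (Fp p))" by auto
  have hf: "hfold (add_monoid (Fp p)) 2 ?X = (Q + Q) \<inter> {0..<int p}"
  proof (intro equalityI subsetI)
    fix z assume "z \<in> hfold (add_monoid (Fp p)) 2 ?X"
    then obtain xs where xs: "set xs \<subseteq> ?X" "length xs = 2" "z = sum_list xs mod int p"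
      unfolding F.hfold_eq_lprod[OF X] lprod_Fp by blast
    then obtain x y where "xs = [x, y]" by (auto simp: length_Suc_conv numeral_2_eq_2)
    then have "x + y \<in> Q + Q" "z = (x + y) mod int p" using xs by (auto intro: set_plus_intro)
    then show "z \<in> (Q + Q) \<inter> {0..<int p}"
      using p0 periodic_mod_iff[OF periodic_plus[OF Q(1)]] by simp
  next
    fix z assume z: "z \<in> (Q + Q) \<inter> {0..<int p}"
    then obtain x y where xy: "z = x + y" "x \<in> Q" "y \<in> Q" by (auto elim: set_plus_elim)
    let ?xs = "[x mod int p, y mod int p]"
    have "set ?xs \<subseteq> ?X" using xy p0 periodic_mod_iff[OF Q(1)] by auto
    moreover have "z = sum_list ?xs mod int p" using z xy by (simp add: mod_simps)
    ultimately show "z \<in> hfold (add_monoid (Fp p)) 2 ?X"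
      unfolding F.hfold_eq_lprod[OF X] lprod_Fp by (intro image_eqI[of _ _ ?xs]) auto
  qed
  have cX: "card ?X = m" using Q(2) by (simp add: pcard_def)
  have cXX: "card (hfold (add_monoid (Fp p)) 2 ?X) = pcard p (Q + Q)" unfolding hf pcard_def ..
  have "4 < \<tau> * real m" using \<tau>(2) m by (simp add: field_simps)
  then have "real (card (hfold (add_monoid (Fp p)) 2 ?X)) \<le> (2 + \<tau>) * real (card ?X) - 3"
    using QQ unfolding cX cXX by (simp add: algebra_simps)
  moreover have "?X \<subseteq> carrier (Fp p)" by auto
  ultimately have "covering_property p ?X"
    using \<tau>(1) p c cX unfolding feasible_def by blast
  then obtain b d where bd: "d \<in> carrier (Fp p) - {0}"
      "?X \<subseteq> arith_prog p b d (card (hfold (add_monoid (Fp p)) 2 ?X) - card ?X + 1)"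
    unfolding covering_property_def by blast
  have d: "\<not> int p dvd d" using bd(1) zdvd_not_zless[of d "int p"] by auto
  have "Q \<subseteq> progression p b d (m + 2)"
  proof
    fix x assume "x \<in> Q"
    then have "x mod int p \<in> ?X" using p0 periodic_mod_iff[OF Q(1)] by simp
    then obtain i where i: "i < pcard p (Q + Q) - m + 1" "x mod int p = (b + int i * d) mod int p"
      using bd(2) unfolding cX cXX arith_prog_def by blast
    then have "int p dvd x - (b + int i * d)" by (simp add: mod_eq_dvd_iff)
    moreover have "i < m + 2" using i(1) QQ by linarith
    ultimately show "x \<in> progression p b d (m + 2)" unfolding progression_def by blast
  qed
  then show ?thesis using d by blast
qed

section \<open>Sum-free sets close to an interval\<close>

text \<open>\<open>U\<close> fills more than about three quarters of the interval. For
  \<open>0 <= 2 t <= N\<close>, two disjoint translates of \<open>U\<close> would not fit into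
  \<open>{0..N + t}\<close>. For larger \<open>t\<close> the elements outside the middle form pairs
  at distance \<open>t\<close> with at most one member in \<open>U\<close>, and the middle has
  \<open>2 t - N - 1\<close> elements, so \<open>U\<close> would have at most
  \<open>t\<close>.\<close>

lemma exists_difference:
  fixes U :: "int set"
  assumes U: "U \<subseteq> {0..N}" and t: "\<bar>t\<bar> < int (card U)" and big: "3 * N + 2 < 4 * int (card U)"
  shows "\<exists>u\<in>U. \<exists>v\<in>U. u - v = t"
proof -
  have finU: "finite U" using U by (rule finite_subset) simp
  have pos: "\<exists>u\<in>U. \<exists>v\<in>U. u - v = t" if t: "0 \<le> t" "t < int (card U)" for t
  proof (rule ccontr)
    assume no: "\<not> ?thesis"
    have "U \<noteq> {}" using t by auto
    then have N0: "N \<ge> 0" using U by fastforce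
    show False
    proof (cases "2 * t \<le> N")
      case True
      have "U \<inter> (+) t ` U = {}"
      proof (rule ccontr)
        assume "U \<inter> (+) t ` U \<noteq> {}"
        then obtain u v where "u \<in> U" "v \<in> U" "u = t + v" by blast
        then show False using no by force
      qed
      moreover have "card ((+) t ` U) = card U" by (rule card_image) simp
      ultimately have "2 * card U = card (U \<union> (+) t ` U)" using finU by (simp add: card_Un_disjoint)
      also have "\<dots> \<le> card {0..N + t}" using U t by (intro card_mono) auto
      also have "\<dots> = nat (N + t + 1)" by simp
      finally have "2 * int (card U) \<le> N + t + 1" using N0 t by linarith
      then show False using big True by linarith
    next
      case False
      have tN: "t \<le> N"
      proof -
        have "card U \<le> card {0..N}" using U by (intro card_mono) auto
        then show ?thesis using t N0 by auto
      qed
      let ?X = "U \<inter> {0..N - t}" and ?Y = "(\<lambda>u. u - t) ` (U \<inter> {t..N})" and ?Z = "U \<inter> {N - t<..<t}"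
      have "?X \<inter> ?Y = {}"
      proof (rule ccontr)
        assume "?X \<inter> ?Y \<noteq> {}"
        then obtain u v where "u \<in> U" "v \<in> U" "u = v - t" by blast
        then show False using no by force
      qed
      then have "card ?X + card ?Y = card (?X \<union> ?Y)" using finU by (simp add: card_Un_disjoint)
      also have "\<dots> \<le> card {0..N - t}" by (intro card_mono) auto
      finally have 1: "card ?X + card ?Y \<le> nat (N - t + 1)" by simp
      have 2: "card ?Y = card (U \<inter> {t..N})" by (intro card_image inj_onI) simp
      have "card ?Z \<le> card {N - t<..<t}" by (intro card_mono) auto
      then have 3: "card ?Z \<le> nat (2 * t - N - 1)" by simp
      have "U = ?X \<union> ?Z \<union> (U \<inter> {t..N})" using U by auto
      then have "card U \<le> card ?X + card ?Z + card (U \<inter> {t..N})"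
        by (metis (no_types, lifting) card_Un_le add_le_mono1 order_trans)
      then have "int (card U) \<le> t" using 1 2 3 False tN by linarith
      then show False using t by simp
    qed
  qed
  show ?thesis
  proof (cases "t \<ge> 0")
    case False
    then obtain u v where "u \<in> U" "v \<in> U" "u - v = - t" using pos[of "- t"] t by auto
    then show ?thesis by (intro bexI[of _ v] bexI[of _ u]) auto
  qed (use pos t in auto)
qed

text \<open>The differences of \<open>U\<close> cover a window of \<open>2 g + 1\<close> integers.
  Every further summand may be chosen as 0 or \<open>r\<close>, and since
  \<open>r <= 2 g + 1\<close>, the shifted windows leave no gap.\<close>

lemma difference_of_sums:
  fixes U :: "int set"
  assumes U: "0 \<in> U" "r \<in> U" and diff: "\<And>t. \<bar>t\<bar> \<le> g \<Longrightarrow> \<exists>u\<in>U. \<exists>v\<in>U. u - v = t"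
    and r: "0 \<le> r" "r \<le> 2 * g + 1"
    and t: "- g - int h' * r \<le> t" "t \<le> g + int h * r"
  shows "\<exists>us vs. length us = Suc h \<and> length vs = Suc h' \<and> set us \<subseteq> U \<and> set vs \<subseteq> U \<and>
    sum_list us - sum_list vs = t"
  using t
proof (induction h arbitrary: t)
  case 0
  then show ?case
  proof (induction h' arbitrary: t)
    case 0
    then have "\<bar>t\<bar> \<le> g" by auto
    then obtain u v where "u \<in> U" "v \<in> U" "u - v = t" using diff by blast
    then show ?case by (intro exI[of _ "[u]"] exI[of _ "[v]"]) auto
  next
    case (Suc h')
    define w where "w = (if t < - g - int h' * r then r else 0)"
    have w: "w \<in> U" using U by (simp add: w_def)
    have "- g - int h' * r \<le> t + w" "t + w \<le> g + int 0 * r"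
    proof -
      define x where "x = int h' * r"
      have x: "x \<ge> 0" "int (Suc h') * r = x + r" using r by (auto simp: x_def algebra_simps)
      show "- g - int h' * r \<le> t + w" "t + w \<le> g + int 0 * r"
        using Suc.prems r x(1) unfolding x(2) w_def x_def[symmetric] by (auto split: if_splits)
    qed
    then obtain us vs where "length us = Suc 0" "length vs = Suc h'" "set us \<subseteq> U" "set vs \<subseteq> U"
        "sum_list us - sum_list vs = t + w" using Suc.IH by blast
    then show ?case using w by (intro exI[of _ us] exI[of _ "w # vs"]) auto
  qed
next
  case (Suc h)
  define w where "w = (if t > g + int h * r then r else 0)"
  have w: "w \<in> U" using U by (simp add: w_def)
  have "- g - int h' * r \<le> t - w" "t - w \<le> g + int h * r"
  proof -
    define x x' where "x = int h * r" and "x' = int h' * r"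
    have x: "x \<ge> 0" "x' \<ge> 0" "int (Suc h) * r = x + r" using r by (auto simp: x_def x'_def algebra_simps)
    show "- g - int h' * r \<le> t - w" "t - w \<le> g + int h * r"
      using Suc.prems r x(1,2) unfolding x(3) w_def x_def[symmetric] x'_def[symmetric] by (auto split: if_splits)
  qed
  then obtain us vs where "length us = Suc h" "length vs = Suc h'" "set us \<subseteq> U" "set vs \<subseteq> U"
      "sum_list us - sum_list vs = t - w" using Suc.IH by blast
  then show ?case using w by (intro exI[of _ "w # us"] exI[of _ vs]) auto
qed

lemma sum_list_map_add: "sum_list (map ((+) (b :: int)) us) = int (length us) * b + sum_list us"
  by (induction us) (auto simp: algebra_simps)

text \<open>\<open>y\<close> takes \<open>i\<close> of the \<open>k\<close> places on the left, and
  elements of \<open>b + U\<close> take all others. As \<open>i < k\<close> and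
  \<open>l >= 1\<close>, each side has an entry in \<open>S'\<close>, so the tuple cannot be
  balanced.\<close>

lemma no_solution_left:
  assumes core: "core p k l S S'" and U: "0 \<in> U" "r \<in> U" "\<And>u. u \<in> U \<Longrightarrow> b + u \<in> S'"
    and diff: "\<And>t. \<bar>t\<bar> \<le> g \<Longrightarrow> \<exists>u\<in>U. \<exists>v\<in>U. u - v = t" and r: "0 \<le> r" "r \<le> 2 * g + 1"
    and y: "y \<in> S" and i: "i < k" and l: "l \<ge> 1"
    and t: "- g - (int l - 1) * r \<le> t" "t \<le> g + (int k - int i - 1) * r"
  shows "\<not> int p dvd int i * y + (int k - int i) * b - int l * b + t"
proof
  assume *: "int p dvd int i * y + (int k - int i) * b - int l * b + t"
  have "int (l - 1) = int l - 1" "int (k - i - 1) = int k - int i - 1" using i l by auto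
  then obtain us vs where uv: "length us = Suc (k - i - 1)" "length vs = Suc (l - 1)" "set us \<subseteq> U" "set vs \<subseteq> U"
      "sum_list us - sum_list vs = t"
    using difference_of_sums[OF U(1,2) diff r, of "l - 1" t "k - i - 1"] t by metis
  let ?us = "replicate i y @ map ((+) b) us" and ?vs = "map ((+) b) vs"
  have len: "length us = k - i" "length vs = l" using uv i l by auto
  have "sum_list ?us - sum_list ?vs = int i * y + (int k - int i) * b - int l * b + t"
    using i uv(5) by (simp add: sum_list_map_add len sum_list_replicate of_nat_diff algebra_simps)
  then have "balanced p k l (?us @ ?vs)" using len i * by (intro balancedI) auto
  moreover have "S' \<subseteq> S" using core by (simp add: core_def)
  then have "set (?us @ ?vs) \<subseteq> S" using uv U(3) y by auto
  moreover have "us \<noteq> []" "vs \<noteq> []" using len i l by auto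
  then have "us ! 0 \<in> U" "vs ! 0 \<in> U" using uv by (auto simp: subset_iff)
  then have "(?us @ ?vs) ! i \<in> S'" "(?us @ ?vs) ! k \<in> S'"
    using len i l uv U(3) by (simp_all add: nth_append)
  ultimately show False using coreD[OF core, of "?us @ ?vs" i k] i l by auto
qed

text \<open>With the copies of \<open>y\<close> on the right, two left-hand entries in
  \<open>S'\<close> contradict the core condition.\<close>

lemma no_solution_right:
  assumes core: "core p k l S S'" and U: "0 \<in> U" "r \<in> U" "\<And>u. u \<in> U \<Longrightarrow> b + u \<in> S'"
    and diff: "\<And>t. \<bar>t\<bar> \<le> g \<Longrightarrow> \<exists>u\<in>U. \<exists>v\<in>U. u - v = t" and r: "0 \<le> r" "r \<le> 2 * g + 1"
    and y: "y \<in> S" and i: "i < l" and k: "k \<ge> 2"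
    and t: "- g - (int l - int i - 1) * r \<le> t" "t \<le> g + (int k - 1) * r"
  shows "\<not> int p dvd int k * b - int i * y - (int l - int i) * b + t"
proof
  assume *: "int p dvd int k * b - int i * y - (int l - int i) * b + t"
  have "int (k - 1) = int k - 1" "int (l - i - 1) = int l - int i - 1" using i k by auto
  then obtain us vs where uv: "length us = Suc (k - 1)" "length vs = Suc (l - i - 1)" "set us \<subseteq> U" "set vs \<subseteq> U"
      "sum_list us - sum_list vs = t"
    using difference_of_sums[OF U(1,2) diff r, of "l - i - 1" t "k - 1"] t by metis
  let ?us = "map ((+) b) us" and ?vs = "replicate i y @ map ((+) b) vs"
  have len: "length us = k" "length vs = l - i" using uv i k by auto
  have "sum_list ?us - sum_list ?vs = int k * b - int i * y - (int l - int i) * b + t"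
    using i uv(5) by (simp add: sum_list_map_add len sum_list_replicate of_nat_diff algebra_simps)
  then have "balanced p k l (?us @ ?vs)" using len i * by (intro balancedI) auto
  moreover have "S' \<subseteq> S" using core by (simp add: core_def)
  then have "set (?us @ ?vs) \<subseteq> S" using uv U(3) y by auto
  moreover have "(?us @ ?vs) ! 0 \<in> S'" "(?us @ ?vs) ! 1 \<in> S'"
    using len k uv U(3) by (auto simp: nth_append subset_iff)
  ultimately show False using coreD[OF core, of "?us @ ?vs" 0 1] k by auto
qed

text \<open>An additional element at distance \<open>e\<close> beyond an interval is used repeatedly; each use moves the
  sums by \<open>e\<close> into the gap, of total length \<open>q + 1\<close>, between the \<open>k\<close>-fold and the \<open>l\<close>-fold sums.\<close>

lemma additional_element_cases:
  fixes p r k l q e D y b :: int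
  assumes left: "\<And>i t. 0 \<le> i \<Longrightarrow> i < k \<Longrightarrow> - l * r \<le> t \<Longrightarrow> t \<le> (k - i) * r \<Longrightarrow>
      \<not> p dvd i * y + (k - i) * b - l * b + t"
    and right: "\<And>i t. 0 \<le> i \<Longrightarrow> i < l \<Longrightarrow> - (l - i) * r \<le> t \<Longrightarrow> t \<le> k * r \<Longrightarrow>
      \<not> p dvd k * b - i * y - (l - i) * b + t"
    and peq: "p = (k + l) * r + 2 + q" and q: "0 \<le> q" "q < r" and kl: "k \<ge> 3" "l \<ge> 1"
    and D: "1 \<le> D" "D \<le> q + 1" "p dvd l * b - k * b - k * r - D"
    and e: "p dvd y - (b + r + e)" "1 \<le> e" "e \<le> p - r - 1"
  shows "((k - 1) * e \<le> D - 1 \<and> (l - 1) * e \<le> q + 1 - D) \<or>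
    (\<exists>e'\<ge>1. p dvd y - (b - e') \<and> (k - 1) * e' \<le> q + 1 - D \<and> (l - 1) * e' \<le> D - 1)"
proof -
  \<comment> \<open>Measured from the last \<open>k\<close>-fold sum of the interval,
    \<open>i\<close> copies of \<open>y\<close> put the top of the left-hand sums at
    \<open>i * e\<close>, while the \<open>l\<close>-fold sums begin at \<open>D\<close>. The number
    \<open>s\<close> is the distance below the top plus the distance above that beginning.
    \<open>R\<close> treats copies of \<open>y\<close> on the other side.\<close>
  have L: "\<not> p dvd i * e - D - s" if "0 \<le> i" "i < k" "0 \<le> s" "s \<le> (k + l - i) * r" for i s
  proof
    assume *: "p dvd i * e - D - s"
    have "i * y + (k - i) * b - l * b + ((k - i) * r - s)
        = i * (y - (b + r + e)) - (l * b - k * b - k * r - D) + (i * e - D - s)"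
      by (simp add: algebra_simps)
    moreover have "p dvd \<dots>" by (intro dvd_add[OF dvd_diff[OF dvd_mult[OF e(1)] D(3)] *])
    ultimately have "p dvd i * y + (k - i) * b - l * b + ((k - i) * r - s)" by (simp only:)
    moreover have "- l * r \<le> (k - i) * r - s" "(k - i) * r - s \<le> (k - i) * r"
      using that by (simp_all add: algebra_simps)
    ultimately show False using left that by blast
  qed
  have R: "\<not> p dvd i * e + D + s" if "0 \<le> i" "i < l" "i * r \<le> s" "s \<le> (k + l) * r" for i s
  proof
    assume *: "p dvd i * e + D + s"
    have "k * b - i * y - (l - i) * b + (k * r + i * r - s)
        = - (i * (y - (b + r + e))) - (l * b - k * b - k * r - D) - (i * e + D + s)"
      by (simp add: algebra_simps)
    moreover have "p dvd \<dots>"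
      by (intro dvd_diff[OF dvd_diff[OF _ D(3)] *]) (simp only: dvd_minus_iff dvd_mult[OF e(1)])
    ultimately have "p dvd k * b - i * y - (l - i) * b + (k * r + i * r - s)" by (simp only:)
    moreover have "- (l - i) * r \<le> k * r + i * r - s" "k * r + i * r - s \<le> k * r"
      using that by (simp_all add: algebra_simps)
    ultimately show False using right that by blast
  qed
  have mono: "u * r \<le> v * r" if "u \<le> v" for u v using that q by (intro mult_right_mono) auto
  have lr: "1 * r \<le> l * r" "2 * r \<le> (l + 1) * r" "0 \<le> k * r" using mono kl q by auto
  show ?thesis
  proof (cases "e \<le> D - 1")
    case True
    \<comment> \<open>The first \<open>i\<close> with \<open>i * e >= D\<close> would overshoot by
      less than \<open>e\<close>, hence by less than \<open>r\<close>, and so hit an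
      \<open>l\<close>-fold sum.\<close>
    have "int i \<le> k - 1 \<Longrightarrow> int i * e \<le> D - 1" for i
    proof (induction i)
      case (Suc i)
      show ?case
      proof (rule ccontr)
        assume no: "\<not> ?thesis"
        have ie: "int (Suc i) * e = int i * e + e" by (simp add: algebra_simps)
        have "(l + 1) * r \<le> (k + l - int (Suc i)) * r" using Suc.prems by (intro mono) simp
        then have "int (Suc i) * e - D \<le> (k + l - int (Suc i)) * r"
          using Suc ie True lr(2) q D by linarith
        then show False using L[of "int (Suc i)" "int (Suc i) * e - D"] Suc.prems no by simp
      qed
    qed (use D in simp)
    from this[of "nat (k - 1)"] have 1: "(k - 1) * e \<le> D - 1" using kl by simp
    have "int i \<le> l - 1 \<Longrightarrow> int i * e \<le> q + 1 - D" for i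
    proof (induction i)
      case (Suc i)
      show ?case
      proof (rule ccontr)
        assume no: "\<not> ?thesis"
        have ie: "int (Suc i) * e = int i * e + e" by (simp add: algebra_simps)
        have "int (Suc i) * r + 2 * r \<le> (k + l) * r"
          unfolding distrib_right[symmetric] using Suc.prems kl by (intro mono) simp
        moreover have "int i * e \<le> q + 1 - D" using Suc by simp
        ultimately have "int (Suc i) * r \<le> p - (int (Suc i) * e + D)"
          unfolding peq ie using True q D by linarith
        moreover have "p - (int (Suc i) * e + D) \<le> (k + l) * r" using no unfolding peq by simp
        ultimately show False using R[of "int (Suc i)" "p - (int (Suc i) * e + D)"] Suc.prems by simp
      qed
    qed (use D in simp)
    from this[of "nat (l - 1)"] have 2: "(l - 1) * e \<le> q + 1 - D" using kl by simp
    show ?thesis using 1 2 by blast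
  next
    case False
    \<comment> \<open>Seen from the other end, \<open>y\<close> is congruent to
      \<open>b - e'\<close>. The two parts of the gap, with \<open>D - 1\<close> and
      \<open>q + 1 - D\<close> free residues, exchange their roles.\<close>
    define e' where "e' = p - r - e"
    have e'1: "e' \<ge> 1" using e by (simp add: e'_def)
    \<comment> \<open>If \<open>y\<close> were far from both ends, a single copy of it on the left
      would already give a solution.\<close>
    have e'D: "e' \<le> q + 1 - D"
    proof (rule ccontr)
      assume no: "\<not> ?thesis"
      then have "e - D \<le> (k + l - 1) * r" by (simp add: e'_def peq algebra_simps)
      then show False using L[of 1 "e - D"] False kl by simp
    qed
    have L': "\<not> p dvd i * e' + D + s" if "0 \<le> i" "i < k" "i * r \<le> s" "s \<le> (k + l) * r" for i s
    proof
      assume *: "p dvd i * e' + D + s"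
      have "i * e - D - (s - i * r) = i * p - (i * e' + D + s)" by (simp add: e'_def algebra_simps)
      moreover have "p dvd \<dots>" by (rule dvd_diff[OF dvd_triv_right *])
      ultimately have "p dvd i * e - D - (s - i * r)" by (simp only:)
      moreover have "0 \<le> s - i * r" "s - i * r \<le> (k + l - i) * r" using that by (simp_all add: algebra_simps)
      ultimately show False using L that by blast
    qed
    have R': "\<not> p dvd D - i * e' + s" if "0 \<le> i" "i < l" "0 \<le> s" "s \<le> (k + l - i) * r" for i s
    proof
      assume *: "p dvd D - i * e' + s"
      have "i * e + D + (s + i * r) = i * p + (D - i * e' + s)" by (simp add: e'_def algebra_simps)
      moreover have "p dvd \<dots>" by (rule dvd_add[OF dvd_triv_right *])
      ultimately have "p dvd i * e + D + (s + i * r)" by (simp only:)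
      moreover have "i * r \<le> s + i * r" "s + i * r \<le> (k + l) * r" using that by (simp_all add: algebra_simps)
      ultimately show False using R that by blast
    qed
    have "int i \<le> k - 1 \<Longrightarrow> int i * e' \<le> q + 1 - D" for i
    proof (induction i)
      case (Suc i)
      show ?case
      proof (rule ccontr)
        assume no: "\<not> ?thesis"
        have ie: "int (Suc i) * e' = int i * e' + e'" by (simp add: algebra_simps)
        have "int (Suc i) * r + 2 * r \<le> (k + l) * r"
          unfolding distrib_right[symmetric] using Suc.prems kl by (intro mono) simp
        moreover have "int i * e' \<le> q + 1 - D" using Suc by simp
        ultimately have "int (Suc i) * r \<le> p - (int (Suc i) * e' + D)"
          unfolding peq ie using e'D q D by linarith
        moreover have "p - (int (Suc i) * e' + D) \<le> (k + l) * r" using no unfolding peq by simp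
        ultimately show False using L'[of "int (Suc i)" "p - (int (Suc i) * e' + D)"] Suc.prems by simp
      qed
    qed (use D in simp)
    from this[of "nat (k - 1)"] have 1: "(k - 1) * e' \<le> q + 1 - D" using kl by simp
    have "int i \<le> l - 1 \<Longrightarrow> int i * e' \<le> D - 1" for i
    proof (induction i)
      case (Suc i)
      show ?case
      proof (rule ccontr)
        assume no: "\<not> ?thesis"
        have ie: "int (Suc i) * e' = int i * e' + e'" by (simp add: algebra_simps)
        have "(k + 1) * r \<le> (k + l - int (Suc i)) * r" using Suc.prems by (intro mono) simp
        then have "int (Suc i) * e' - D \<le> (k + l - int (Suc i)) * r"
          using Suc ie e'D lr q D by (simp add: ring_distribs)
        then show False using R'[of "int (Suc i)" "int (Suc i) * e' - D"] Suc.prems no by simp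
      qed
    qed (use D in simp)
    from this[of "nat (l - 1)"] have 2: "(l - 1) * e' \<le> D - 1" using kl by simp
    have "y - (b - e') = (y - (b + r + e)) + p" by (simp add: e'_def)
    moreover have "p dvd (y - (b + r + e)) + p" by (rule dvd_add[OF e(1) dvd_refl])
    ultimately have "p dvd y - (b - e')" by (simp only:)
    then show ?thesis using e'1 1 2 by blast
  qed
qed

text \<open>The residue of \<open>l b - k b - k r\<close> is the distance from the last \<open>k\<close>-fold sum to the first \<open>l\<close>-fold
  sum of \<open>[b, b + r]\<close>. The three alternatives lead to trivial sets, to sets of type 1 and to sets of
  type 2.\<close>

definition interval_shape :: "nat \<Rightarrow> nat \<Rightarrow> nat \<Rightarrow> nat \<Rightarrow> nat \<Rightarrow> int set \<Rightarrow> bool" where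
  "interval_shape p k l m lam S \<longleftrightarrow>
    (\<exists>b j. S \<subseteq> progression p b 1 (m + 1) \<and> 0 \<le> j \<and> j \<le> int lam \<and>
      int p dvd int l * b - int k * b - int k * int m - (1 + j)) \<or>
    (\<exists>b D. S \<subseteq> progression p b 1 m \<and> 1 \<le> D \<and> D \<le> int lam + int k + int l + 1 \<and>
      int p dvd int l * b - int k * b - int k * (int m - 1) - D) \<or>
    (l = 1 \<and> (\<exists>b. S \<subseteq> progression p b 1 (m + 1) \<and> b \<in> S \<and> b + int m \<in> S \<and>
      int p dvd b - int k * b - int k * int m))"

text \<open>By size the support consists of \<open>S'\<close> and the class of \<open>y\<close>, so
  it lies in an interval of length \<open>m + 1\<close>, for which the distance is
  \<open>D - k\<close>. Values of \<open>D\<close> strictly between the two bounds give the first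
  alternative. At \<open>D = lam + k + 2\<close>, and at \<open>D = k\<close> for
  \<open>l >= 2\<close>, a tuple made of the two end points violates the core condition. For
  \<open>D = k\<close> and \<open>l = 1\<close> that tuple has only one entry in \<open>S'\<close>,
  and the last alternative remains.\<close>

lemma interval_shape_adjacent:
  assumes p: "prime p" and kl: "k > l" "l \<ge> 1" and peq: "p = (k + l) * m + 2 + lam"
    and core: "core p k l S S'" and per: "periodic p S" "periodic p S'"
    and card: "pcard p S' = m" "pcard p S \<le> m + 1" and m: "m \<ge> 1"
    and S': "S' \<subseteq> progression p b 1 m" "b \<in> S'" and y: "y \<in> S" "int p dvd y - (b + int m)"
    and D: "int k \<le> D" "D \<le> int lam + int k + 2" "int p dvd int l * b - int k * b - int k * (int m - 1) - D"
  shows "interval_shape p k l m lam S"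
proof -
  have p0: "p > 0" using p prime_gt_0_nat by simp
  have S'S: "S' \<subseteq> S" using core by (simp add: core_def)
  have m2: "2 * m < p" 
  proof -
    have "2 * m \<le> (k + l) * m" using kl by (intro mult_right_mono) auto
    then show ?thesis using peq by linarith
  qed
  have bm: "b + int m \<in> S" using periodicD[OF per(1) y(1)] y(2) by (simp add: dvd_diff_commute)
  have yS': "x \<notin> S'" if "int p dvd x - (b + int m)" for x
  proof
    assume "x \<in> S'"
    then obtain i where "i < m" "int p dvd x - (b + int i * 1)" using S' by (auto simp: progression_def)
    from dvd_diff[OF this(2) that] have "int p dvd int m - int i" by simp
    then show False using \<open>i < m\<close> m2 zdvd_imp_le by fastforce
  qed
  define C where "C = progression p (b + int m) 1 1"
  have C: "x \<in> C \<longleftrightarrow> int p dvd x - (b + int m)" for x by (simp add: C_def progression_def)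
  have perC: "periodic p C" unfolding C_def by (rule periodic_progression)
  have CS: "C \<subseteq> S" using periodicD[OF per(1) bm] C by blast
  have "pcard p C = 1"
    unfolding C_def using m2 m p prime_gt_1_nat by (intro pcard_progression[OF p]) auto
  moreover have "S' \<inter> C = {}" using yS' C by blast
  ultimately have "pcard p (S' \<union> C) = m + 1" using card(1) by (simp add: pcard_Un_disjoint)
  then have "S' \<union> C = S"
    using CS S'S card(2) by (intro pcard_subset_eq[OF p0 periodic_Un[OF per(2) perC] per(1)]) auto
  moreover have "C \<subseteq> progression p b 1 (m + 1)"
    unfolding progression_def using C by (auto intro!: exI[of _ m])
  ultimately have Ssub: "S \<subseteq> progression p b 1 (m + 1)"
    using S'(1) progression_mono[of m "m + 1" p b 1] by auto
  have k2: "k \<ge> 2" using kl by simp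
  have bS: "b \<in> S" using S' S'S by blast
  consider "D = int k" | "int k + 1 \<le> D \<and> D \<le> int lam + int k + 1" | "D = int lam + int k + 2"
    using D by linarith
  then show ?thesis
  proof cases
    case 1
    then have dv: "int p dvd int l * b - int k * b - int k * int m" using D(3) by (simp add: algebra_simps)
    show ?thesis
    proof (cases "l = 1")
      case True
      then show ?thesis using Ssub bS bm dv unfolding interval_shape_def by auto
    next
      case False
      let ?zs = "replicate k (b + int m) @ replicate l b"
      have "int p dvd - (int l * b - int k * b - int k * int m)" using dv by (simp only: dvd_minus_iff)
      then have "balanced p k l ?zs"
        by (intro balancedI) (auto simp: sum_list_replicate algebra_simps)
      moreover have "set ?zs \<subseteq> S" using bS bm by auto
      moreover have "?zs ! k \<in> S'" "?zs ! (k + 1) \<in> S'" using False kl S'(2) by (auto simp: nth_append)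
      ultimately show ?thesis using coreD[OF core, of ?zs k "k + 1"] False kl by auto
    qed
  next
    case 2
    then show ?thesis
      using Ssub D(3) unfolding interval_shape_def
      by (intro disjI1 exI[of _ b] exI[of _ "D - int k - 1"]) (auto simp: algebra_simps)
  next
    case 3
    let ?zs = "replicate k b @ replicate l (b + int m)"
    have "int k * b - int l * (b + int m) =
        - (int l * b - int k * b - int k * (int m - 1) - D) - int p"
      by (simp add: peq 3 algebra_simps)
    moreover have "int p dvd - (int l * b - int k * b - int k * (int m - 1) - D) - int p"
      by (rule dvd_diff[OF iffD2[OF dvd_minus_iff D(3)] dvd_refl])
    ultimately have "int p dvd int k * b - int l * (b + int m)" by (simp only:)
    then have "balanced p k l ?zs" by (intro balancedI) (auto simp: sum_list_replicate)
    moreover have "set ?zs \<subseteq> S" using bS bm by auto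
    moreover have "?zs ! 0 \<in> S'" "?zs ! 1 \<in> S'" using k2 S'(2) by (auto simp: nth_append)
    ultimately show ?thesis using coreD[OF core, of ?zs 0 1] k2 by auto
  qed
qed

text \<open>The interval around \<open>S'\<close> is shortened until both its ends belong to
  \<open>S'\<close>; its length is then \<open>m + 1\<close> or \<open>m\<close>. An element of the
  support outside it can only be adjacent to one of the ends, and the left end is reduced to the
  right one by reflection.\<close>

lemma interval_shape_if_core:
  assumes p: "prime p" and kl: "k > l" "l \<ge> 1" "k + l \<ge> 5" and peq: "p = (k + l) * m + 2 + lam"
    and lam: "lam \<le> k + l - 5" and m: "m \<ge> k + l + lam + 4"
    and core: "core p k l S S'" and per: "periodic p S" "periodic p S'"
    and card: "pcard p S' = m" "pcard p S \<le> m + 1" and S': "S' \<subseteq> progression p b0 1 (m + 2)"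
  shows "interval_shape p k l m lam S \<or> interval_shape p k l m lam {x. (- 1) * x \<in> S}"
proof -
  have p0: "p > 0" using p prime_gt_0_nat by simp
  have S'S: "S' \<subseteq> S" using core by (simp add: core_def)
  have lam': "int lam + 5 \<le> int k + int l" using lam kl by simp
  have m': "int k + int l + int lam + 4 \<le> int m" using m by simp
  have pi: "int p = (int k + int l) * int m + 2 + int lam" using peq by simp
  have m5: "5 * int m \<le> (int k + int l) * int m" using kl by (intro mult_right_mono) auto
  have mp: "m + 2 \<le> p" using m5 pi m' by linarith
  have k2: "k \<ge> 2" "k \<ge> 3" using kl by auto
  have cardU: "card {u \<in> {0..<int N}. b + u \<in> S'} = m" if "S' \<subseteq> progression p b 1 N" "N \<le> m + 2" for b N
    using pcard_eq_card_interval[OF p per(2) that(1)] that(2) mp card(1) by simp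
  text \<open>Both end points of an interval of length \<open>m + 2\<close> cannot belong to \<open>S'\<close>, as then the differences
    of \<open>k\<close>-fold and \<open>l\<close>-fold sums would cover \<open>F\<^sub>p\<close>.\<close>
  define U0 where "U0 = {u \<in> {0..<int (m + 2)}. b0 + u \<in> S'}"
  have cU0: "card U0 = m" unfolding U0_def using cardU[OF S'] by simp
  have ends: "0 \<notin> U0 \<or> int m + 1 \<notin> U0"
  proof (rule ccontr)
    assume "\<not> ?thesis"
    then have U: "0 \<in> U0" "int m + 1 \<in> U0" by auto
    have diff: "\<exists>u\<in>U0. \<exists>v\<in>U0. u - v = t" if "\<bar>t\<bar> \<le> int m - 1" for t
    proof (rule exists_difference)
      show "U0 \<subseteq> {0..int m + 1}" by (auto simp: U0_def)
    qed (use that cU0 m' kl in auto)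
    define z where "z = (int k - int l) * b0"
    define lo where "lo = - (int m - 1) - (int l - 1) * (int m + 1)"
    \<comment> \<open>The representative of \<open>- z\<close> modulo \<open>p\<close> in the window
      that starts at \<open>lo\<close>; the attainable differences form an interval of at least
      \<open>p\<close> integers.\<close>
    define t where "t = lo + (- z - lo) mod int p"
    have "int p dvd z + t"
    proof -
      have "z + t = - ((- z - lo) - (- z - lo) mod int p)" by (simp add: t_def)
      then show ?thesis by (simp only: dvd_minus_iff) simp
    qed
    moreover have "lo \<le> t" "t \<le> (int m - 1) + (int k - 1) * (int m + 1)"
    proof -
      have "0 \<le> (- z - lo) mod int p" "(- z - lo) mod int p \<le> int p - 1" using p0 by (auto simp: zle_diff1_eq)
      moreover have "lo + int p - 1 \<le> (int m - 1) + (int k - 1) * (int m + 1)"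
        using lam' by (simp add: lo_def pi algebra_simps)
      ultimately show "lo \<le> t" "t \<le> (int m - 1) + (int k - 1) * (int m + 1)" unfolding t_def by linarith+
    qed
    moreover have "\<not> int p dvd int 0 * b0 + (int k - int 0) * b0 - int l * b0 + t"
    proof (rule no_solution_left[OF core U _ diff])
      show "b0 \<in> S" using U(1) S'S by (auto simp: U0_def)
      show "int m + 1 \<le> 2 * (int m - 1) + 1" using m' kl by simp
    qed (use calculation kl in \<open>auto simp: U0_def lo_def\<close>)
    ultimately show False by (simp add: z_def algebra_simps)
  qed
  have "\<exists>b. S' \<subseteq> progression p b 1 (m + 1)"
  proof (cases "0 \<in> U0")
    case True
    have "S' \<subseteq> progression p b0 1 (m + 1)"
    proof
      fix x assume x: "x \<in> S'"
      then obtain i where i: "i < m + 2" "int p dvd x - (b0 + int i * 1)" using S' by (auto simp: progression_def)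
      then have "b0 + int i \<in> S'" using periodicD[OF per(2) x] by (simp add: dvd_diff_commute)
      then have "int i \<noteq> int m + 1" using ends True by (auto simp: U0_def)
      then have "i < m + 1" using i by linarith
      then show "x \<in> progression p b0 1 (m + 1)" using i unfolding progression_def by blast
    qed
    then show ?thesis by blast
  next
    case False
    have "S' \<subseteq> progression p (b0 + 1) 1 (m + 1)"
    proof
      fix x assume x: "x \<in> S'"
      then obtain i where i: "i < m + 2" "int p dvd x - (b0 + int i * 1)" using S' by (auto simp: progression_def)
      then have "b0 + int i \<in> S'" using periodicD[OF per(2) x] by (simp add: dvd_diff_commute)
      then have "i \<noteq> 0" using False by (intro notI) (simp add: U0_def)
      then have "b0 + 1 + int (i - 1) * 1 = b0 + int i * 1" by simp
      then show "x \<in> progression p (b0 + 1) 1 (m + 1)"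
        using i \<open>i \<noteq> 0\<close> unfolding progression_def by (intro CollectI exI[of _ "i - 1"]) auto
    qed
    then show ?thesis by blast
  qed
  then obtain b1 where S'1: "S' \<subseteq> progression p b1 1 (m + 1)" by blast
  define U1 where "U1 = {u \<in> {0..<int (m + 1)}. b1 + u \<in> S'}"
  have cU1: "card U1 = m" unfolding U1_def using cardU[OF S'1] by simp
  \<comment> \<open>If one end of the interval of length \<open>m + 1\<close> is missing,
    \<open>S'\<close> is all of the remaining \<open>m\<close> residues.\<close>
  have "\<exists>b r. (r = m \<or> r + 1 = m) \<and> S' \<subseteq> progression p b 1 (r + 1) \<and> b \<in> S' \<and> b + int r \<in> S'"
  proof -
    have full: "S' = progression p b 1 m" if "S' \<subseteq> progression p b 1 m" for b
    proof (rule pcard_subset_eq[OF p0 per(2) periodic_progression that])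
      show "pcard p (progression p b 1 m) \<le> pcard p S'"
        using pcard_progression_le[OF p0] card(1) by simp
    qed
    consider "0 \<in> U1" "int m \<in> U1" | "0 \<notin> U1" | "int m \<notin> U1" by blast
    then show ?thesis
    proof cases
      case 1
      then show ?thesis using S'1 by (intro exI[of _ b1] exI[of _ m]) (auto simp: U1_def)
    next
      case 2
      have "S' \<subseteq> progression p (b1 + 1) 1 m"
      proof
        fix x assume x: "x \<in> S'"
        then obtain i where i: "i < m + 1" "int p dvd x - (b1 + int i * 1)" using S'1 by (auto simp: progression_def)
        then have "b1 + int i \<in> S'" using periodicD[OF per(2) x] by (simp add: dvd_diff_commute)
        then have "i \<noteq> 0" using 2 by (intro notI) (simp add: U1_def)
        then have "b1 + 1 + int (i - 1) * 1 = b1 + int i * 1" by simp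
        then show "x \<in> progression p (b1 + 1) 1 m"
          using i \<open>i \<noteq> 0\<close> unfolding progression_def by (intro CollectI exI[of _ "i - 1"]) auto
      qed
      then have eq: "S' = progression p (b1 + 1) 1 m" by (rule full)
      have "b1 + 1 + int 0 * 1 \<in> S'" "b1 + 1 + int (m - 1) * 1 \<in> S'"
        unfolding eq by (rule progression_mem, use m in simp)+
      then show ?thesis using eq m by (intro exI[of _ "b1 + 1"] exI[of _ "m - 1"]) auto
    next
      case 3
      have "S' \<subseteq> progression p b1 1 m"
      proof
        fix x assume x: "x \<in> S'"
        then obtain i where i: "i < m + 1" "int p dvd x - (b1 + int i * 1)" using S'1 by (auto simp: progression_def)
        then have "b1 + int i \<in> S'" using periodicD[OF per(2) x] by (simp add: dvd_diff_commute)
        then have "int i \<noteq> int m" using 3 by (auto simp: U1_def)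
        then have "i < m" using i by linarith
        then show "x \<in> progression p b1 1 m" using i unfolding progression_def by blast
      qed
      then have eq: "S' = progression p b1 1 m" by (rule full)
      have "b1 + int 0 * 1 \<in> S'" "b1 + int (m - 1) * 1 \<in> S'"
        unfolding eq by (rule progression_mem, use m in simp)+
      then show ?thesis using eq m by (intro exI[of _ b1] exI[of _ "m - 1"]) auto
    qed
  qed
  then obtain b r where r: "r = m \<or> r + 1 = m" and S'b: "S' \<subseteq> progression p b 1 (r + 1)"
    and ends: "b \<in> S'" "b + int r \<in> S'" by blast
  define R where "R = int r"
  \<comment> \<open>The part of \<open>p\<close> not covered by the sums of
    \<open>[b, b + R]\<close>: it is \<open>lam\<close> for \<open>R = m\<close>, and larger by
    \<open>k + l\<close> for \<open>R = m - 1\<close>.\<close>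
  define q where "q = int p - 2 - (int k + int l) * R"
  have R: "R = int m \<or> R = int m - 1" using r by (auto simp: R_def)
  have q_eq: "(R = int m \<and> q = int lam) \<or> (R = int m - 1 \<and> q = int lam + int k + int l)"
    using R
  proof
    assume "R = int m - 1"
    then show ?thesis unfolding q_def pi by (simp only:) (simp add: algebra_simps)
  qed (simp add: q_def pi)
  have q: "0 \<le> q" "q < R" using q_eq m' by auto
  have pR: "int p = (int k + int l) * R + 2 + q" by (simp add: q_def)
  define U where "U = {u \<in> {0..<int (r + 1)}. b + u \<in> S'}"
  have cU: "card U = m" unfolding U_def using cardU[OF S'b] r by auto
  have U: "0 \<in> U" "R \<in> U" "\<And>u. u \<in> U \<Longrightarrow> b + u \<in> S'" "U \<subseteq> {0..R}"
    using ends by (auto simp: U_def R_def)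
  have diff: "\<exists>u\<in>U. \<exists>v\<in>U. u - v = t" if t: "\<bar>t\<bar> \<le> R" for t
  proof -
    consider "t = R" | "t = - R" | "\<bar>t\<bar> \<le> R - 1" using t by linarith
    then show ?thesis
    proof cases
      case 3
      show ?thesis
      proof (rule exists_difference[OF U(4)])
        show "\<bar>t\<bar> < int (card U)" "3 * R + 2 < 4 * int (card U)" using 3 R cU m' by auto
      qed
    qed (use U(1,2) in force)+
  qed
  have R0: "0 \<le> R" "R \<le> 2 * R + 1" using q by auto
  have left: "\<not> int p dvd i * y + (int k - i) * b - int l * b + t"
    if "y \<in> S" "0 \<le> i" "i < int k" "- int l * R \<le> t" "t \<le> (int k - i) * R" for y i t
    using no_solution_left[OF core U(1,2,3) diff R0 that(1), of "nat i" t] that kl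
    by (simp add: algebra_simps)
  have right: "\<not> int p dvd int k * b - i * y - (int l - i) * b + t"
    if "y \<in> S" "0 \<le> i" "i < int l" "- (int l - i) * R \<le> t" "t \<le> int k * R" for y i t
    using no_solution_right[OF core U(1,2,3) diff R0 that(1), of "nat i" t] that k2
    by (simp add: algebra_simps)
  have bS: "b \<in> S" using ends S'S by blast
  define D where "D = (int l * b - int k * b - int k * R) mod int p"
  have D0: "0 \<le> D" "D < int p" using p0 by (auto simp: D_def)
  have Ddvd: "int p dvd int l * b - int k * b - int k * R - D" unfolding D_def by simp
  have D: "1 \<le> D" "D \<le> q + 1"
  proof -
    have no: "\<not> int p dvd (int l * b - int k * b - int k * R - D) + (D + int k * R - t)"
      if "- int l * R \<le> t" "t \<le> int k * R" for t
    proof -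
      have "\<not> int p dvd - ((int k - 0) * b - int l * b + t)"
        using left[OF bS, of 0 t] that kl by (simp only: dvd_minus_iff) simp
      then show ?thesis by (simp add: algebra_simps)
    qed
    have kR: "- int l * R \<le> int k * R" using R0 by (intro mult_right_mono) auto
    have "D \<noteq> 0" using no[of "int k * R"] kR Ddvd by auto
    then show "1 \<le> D" using D0 by simp
    show "D \<le> q + 1"
    proof (rule ccontr)
      assume *: "\<not> ?thesis"
      have "- int l * R \<le> D + int k * R - int p" "D + int k * R - int p \<le> int k * R"
        using * D0 by (auto simp: pR algebra_simps)
      then show False using no[of "D + int k * R - int p"] Ddvd by simp
    qed
  qed
  have shape1: "interval_shape p k l m lam S" if "R = int m" "S \<subseteq> progression p b 1 (m + 1)"
    using that q_eq D Ddvd unfolding interval_shape_def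
    by (intro disjI1 exI[of _ b] exI[of _ "D - 1"]) auto
  have shape2: "interval_shape p k l m lam S" if "R = int m - 1" "S \<subseteq> progression p b 1 m"
    using that q_eq D Ddvd unfolding interval_shape_def
    by (intro disjI2 disjI1 exI[of _ b] exI[of _ D]) auto
  show ?thesis
  proof (cases "S \<subseteq> progression p b 1 (r + 1)")
    case True
    then show ?thesis using shape1 shape2 r by (auto simp: R_def)
  next
    case False
    then obtain y where y: "y \<in> S" "y \<notin> progression p b 1 (r + 1)" by blast
    define e where "e = (y - (b + R)) mod int p"
    have e: "int p dvd y - (b + R + e)" unfolding e_def by (simp add: diff_diff_eq[symmetric])
    have e0: "0 \<le> e" "e < int p" using p0 by (auto simp: e_def)
    have "e \<noteq> 0"
    proof
      assume "e = 0"
      then have "y \<in> progression p b 1 (r + 1)"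
        using e unfolding progression_def R_def by (intro CollectI exI[of _ r]) auto
      then show False using y by blast
    qed
    have "e \<le> int p - R - 1"
    proof (rule ccontr)
      assume *: "\<not> ?thesis"
      define i where "i = nat (R + e - int p)"
      have i: "int i = R + e - int p" using * by (simp add: i_def)
      have "i < r + 1" using i e0 by (simp add: R_def)
      have "y - (b + int i * 1) = (y - (b + R + e)) + int p" using i by simp
      moreover have "int p dvd (y - (b + R + e)) + int p" by (rule dvd_add[OF e dvd_refl])
      ultimately have "int p dvd y - (b + int i * 1)" by (simp only:)
      then show False using y(2) \<open>i < r + 1\<close> unfolding progression_def by blast
    qed
    then consider
        "(int k - 1) * e \<le> D - 1" "(int l - 1) * e \<le> q + 1 - D"
      | e' where "e' \<ge> 1" "int p dvd y - (b - e')" "(int k - 1) * e' \<le> q + 1 - D" "(int l - 1) * e' \<le> D - 1"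
      using additional_element_cases[OF left[OF y(1)] right[OF y(1)] pR q _ _ D Ddvd e] k2 kl e0 \<open>e \<noteq> 0\<close>
      by auto
    \<comment> \<open>The two inequalities add up to \<open>(k + l - 2) * e <= q\<close>. This fails
      for \<open>q = lam\<close>, which is below \<open>k + l - 2\<close>; for
      \<open>q = lam + k + l\<close> it leaves only \<open>e = 1\<close>, because then
      \<open>q < 2 * (k + l - 2)\<close>.\<close>
    moreover have one: "e = 1 \<and> R = int m - 1 \<and> q = int lam + int k + int l"
      if e1: "e \<ge> 1" and "(int k - 1) * e + (int l - 1) * e \<le> q" for e
    proof -
      define c where "c = int k + int l - 2"
      have c: "c \<ge> 0" "c * e \<le> q" using that(2) kl by (auto simp: c_def algebra_simps)
      have "c \<le> c * e" using mult_left_mono[OF e1 c(1)] by simp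
      then have "q \<noteq> int lam" using c(2) lam' unfolding c_def by linarith
      then have *: "R = int m - 1" "q = int lam + int k + int l" using q_eq by auto
      have "e < 2"
      proof (rule ccontr)
        assume "\<not> e < 2"
        then have "c * 2 \<le> c * e" using c(1) by (intro mult_left_mono) auto
        then have "2 * c \<le> q" using c(2) by linarith
        then show False using * lam' by (simp add: c_def)
      qed
      then show ?thesis using e1 * by simp
    qed
    ultimately show ?thesis
    proof cases
      case 1
      have e1: "e = 1" "R = int m - 1" "q = int lam + int k + int l" using one[of e] 1 e0 \<open>e \<noteq> 0\<close> by auto
      then have "r + 1 = m" using m' by (simp add: R_def)
      then have "interval_shape p k l m lam S"
        using 1 e1 e y S'b ends Ddvd m' kl D
        by (intro interval_shape_adjacent[OF p kl(1,2) peq core per card, of b y D]) (auto simp: algebra_simps)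
      then show ?thesis ..
    next
      case 2
      have e1: "e' = 1" "R = int m - 1" "q = int lam + int k + int l" using one[of e'] 2 by auto
      then have rm: "r + 1 = m" using m' by (simp add: R_def)
      have per': "periodic p {x. (- 1) * x \<in> S}" "periodic p {x. (- 1) * x \<in> S'}"
        using periodic_vimage[OF per(1), of "- 1" 0] periodic_vimage[OF per(2), of "- 1" 0] by auto
      have n1: "\<not> int p dvd - 1" using p prime_gt_1_nat by auto
      have card': "pcard p {x. (- 1) * x \<in> S'} = m" "pcard p {x. (- 1) * x \<in> S} \<le> m + 1"
        using pcard_vimage[OF p per(2) n1, of 0] pcard_vimage[OF p per(1) n1, of 0] card by auto
      have sub: "{x. (- 1) * x \<in> S'} \<subseteq> progression p (- (b + R)) 1 m"
      proof
        fix x assume "x \<in> {x. (- 1) * x \<in> S'}"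
        then obtain i where i: "i < m" "int p dvd - x - (b + int i * 1)"
          using S'b rm by (auto simp: progression_def)
        have "x - (- (b + R) + int (m - 1 - i) * 1) = - (- x - (b + int i * 1))"
          using i e1 by (simp add: of_nat_diff)
        then have "int p dvd x - (- (b + R) + int (m - 1 - i) * 1)" using i(2) by (simp only: dvd_minus_iff)
        then show "x \<in> progression p (- (b + R)) 1 m"
          unfolding progression_def using i by (intro CollectI exI[of _ "m - 1 - i"]) auto
      qed
      have ym: "int p dvd - y - (- (b + R) + int m)"
      proof -
        have "- y - (- (b + R) + int m) = - (y - (b - e'))" using e1 by simp
        then show ?thesis using 2(2) by (simp only: dvd_minus_iff)
      qed
      \<comment> \<open>Reflection exchanges the two parts of the gap, so \<open>D\<close> becomes
        \<open>q + 2 - D\<close>.\<close>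
      have dv: "int p dvd int l * - (b + R) - int k * - (b + R) - int k * (int m - 1) - (q + 2 - D)"
      proof -
        have "int l * - (b + R) - int k * - (b + R) - int k * (int m - 1) - (q + 2 - D)
          = - (int l * b - int k * b - int k * R - D) - int p"
        proof -
          have "int m = R + 1" using e1 by simp
          then show ?thesis unfolding pR by (simp only:) (simp add: algebra_simps)
        qed
        moreover have "int p dvd \<dots>" by (rule dvd_diff[OF iffD2[OF dvd_minus_iff Ddvd] dvd_refl])
        ultimately show ?thesis by (simp only:)
      qed
      have mem: "- (b + R) \<in> {x. (- 1) * x \<in> S'}" "- y \<in> {x. (- 1) * x \<in> S}"
        using ends y by (simp_all add: R_def add.commute)
      have bounds: "int k \<le> q + 2 - D" "q + 2 - D \<le> int lam + int k + 2" "m \<ge> 1"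
        using 2(3,4) e1 m by simp_all
      have "interval_shape p k l m lam {x. (- 1) * x \<in> S}"
        by (rule interval_shape_adjacent[OF p kl(1,2) peq core_scale[OF core] per' card' bounds(3)
              sub mem ym bounds(1,2) dv])
      then show ?thesis ..
    qed
  qed
qed

section \<open>Trivial sets and sets of type 1\<close>

lemma dvd_mod_minus: "int p dvd z mod int p - z"
  by (simp add: mod_eq_dvd_iff[symmetric])

lemma slice_system_of_sum_free:
  assumes p: "prime p" and n: "n \<ge> 1" and kl: "k > l" "l \<ge> 1" "k + l \<ge> 5" and sf: "sum_free p n k l A"
  shows "slice_system p k l (p ^ (n - 1)) (supp A) (\<lambda>x. card (slice p n A x))"
proof
  have A: "A \<subseteq> carrier (Fpn p n)" using sf by (simp only: sum_free_def)
  show "supp A \<subseteq> {0..<int p}" using supp_subset[OF n A] .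
  show "1 \<le> card (slice p n A x)" if "x \<in> supp A" for x
    using that slice_nonempty_iff[OF n A, of x] finite_slice[of p n A x] by (simp add: card_gt_0_iff Suc_le_eq)
  show "card (slice p n A x) \<le> p ^ (n - 1)" for x by (rule card_slice_le)
  fix zs assume zs: "balanced p k l zs" "set zs \<subseteq> supp A"
  have sub: "set (take k zs) \<subseteq> supp A" "set (drop k zs) \<subseteq> supp A"
    using zs(2) set_take_subset[of k zs] set_drop_subset[of k zs] by auto
  have len: "length (take k zs) = k" "length (drop k zs) = l"
    "sum_list (take k zs) mod int p = sum_list (drop k zs) mod int p"
    using zs(1) by (auto simp: balanced_def)
  have k1: "k \<ge> 1" using kl by simp
  show "(\<Sum>z\<leftarrow>zs. real (card (slice p n A z))) < real (p ^ (n - 1)) * (1 + (real (k + l) - 1) / real p)"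
    using sum_card_slices_less[OF p n sf k1 len(1) sub(1) len(2) sub(2) len(3)]
    by (simp only: append_take_drop_id)
  fix i j assume ij: "i < j" "j < k + l"
  then have jz: "j < length zs" using zs(1) by (simp add: balanced_def)
  have "zs ! i \<in> set (take j zs)" using ij jz by (auto simp: in_set_conv_nth intro!: exI[of _ i])
  moreover have "zs ! j \<in> set (drop j zs)" using jz by (metis Cons_nth_drop_Suc list.set_intros(1))
  ultimately show "card (slice p n A (zs ! i)) + card (slice p n A (zs ! j)) \<le> p ^ (n - 1)"
    using card_slices_pair_le[OF p n sf len(1) sub(1) len(2) sub(2) len(3), of "take j zs" "drop j zs"]
    by (simp only: append_take_drop_id)
qed (use p kl in auto)

section \<open>Boxes over intervals and their recognition by size\<close>

definition box :: "nat \<Rightarrow> nat \<Rightarrow> int \<Rightarrow> nat \<Rightarrow> (nat \<Rightarrow> int) set" where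
  "box p n b N = {z \<in> carrier (Fpn p n). z 0 \<in> progression p b 1 N}"

lemma cyc_interval_eq_progression:
  assumes "1 \<le> N" "N \<le> p" "c = b + int N - 1"
  shows "cyc_interval p b c = progression p b 1 N \<inter> {0..<int p}"
proof -
  have m: "(c - b) mod int p = int N - 1" using assms by simp
  show ?thesis
  proof (intro equalityI subsetI)
    fix x assume "x \<in> cyc_interval p b c"
    then obtain i where i: "0 \<le> i" "i \<le> int N - 1" "x = (b + i) mod int p"
      unfolding cyc_interval_def m by auto
    then have "int p dvd x - (b + int (nat i) * 1)" by (simp add: mod_eq_dvd_iff[symmetric])
    moreover have "nat i < N" using i by linarith
    ultimately show "x \<in> progression p b 1 N \<inter> {0..<int p}" using i assms unfolding progression_def by auto
  next
    fix x assume x: "x \<in> progression p b 1 N \<inter> {0..<int p}"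
    then obtain i where i: "i < N" "int p dvd x - (b + int i * 1)" by (auto simp: progression_def)
    then have "x mod int p = (b + int i) mod int p" by (simp add: mod_eq_dvd_iff)
    then have "x = (b + int i) mod int p" using x by simp
    then show "x \<in> cyc_interval p b c" unfolding cyc_interval_def m using i by auto
  qed
qed

lemma cyc_interval_cong:
  "b mod int p = b' mod int p \<Longrightarrow> c - b = c' - b' \<Longrightarrow> cyc_interval p b c = cyc_interval p b' c'"
  unfolding cyc_interval_def by (intro image_cong) (auto intro: mod_add_cong)

lemma Fpn_coord_bounds: "n \<ge> 1 \<Longrightarrow> z \<in> carrier (Fpn p n) \<Longrightarrow> 0 \<le> z 0 \<and> z 0 < int p"
  by (force simp: PiE_iff)

lemma cuboid_eq_box:
  assumes "n \<ge> 1" "1 \<le> N" "N \<le> p" "c = b + int N - 1"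
  shows "cuboid p n (cyc_interval p b c) (carrier (Fpn p (n - 1))) = box p n b N"
  using vtail_closed[OF assms(1)] Fpn_coord_bounds[OF assms(1)]
  unfolding cuboid_def box_def cyc_interval_eq_progression[OF assms(2-4)] vtail_def
  by (auto simp del: carrier_Fpn)

lemma subset_box: "A \<subseteq> carrier (Fpn p n) \<Longrightarrow> supp A \<subseteq> progression p b 1 N \<Longrightarrow> A \<subseteq> box p n b N"
  by (auto simp: box_def supp_def)

lemma card_box:
  assumes p: "prime p" and n: "n \<ge> 1" and N: "N \<le> p"
  shows "card (box p n b N) = N * p ^ (n - 1)"
proof -
  have one: "\<not> int p dvd 1" using p prime_gt_1_nat by auto
  have sub: "box p n b N \<subseteq> carrier (Fpn p n)" by (auto simp: box_def)
  have sl: "slice p n (box p n b N) x = carrier (Fpn p (n - 1))" if "x \<in> progression p b 1 N \<inter> {0..<int p}" for x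
    using that vcons_closed[OF n, of x p] n by (auto simp: slice_def box_def simp del: carrier_Fpn)
  have "supp (box p n b N) = progression p b 1 N \<inter> {0..<int p}"
  proof (intro equalityI subsetI)
    fix x assume "x \<in> supp (box p n b N)"
    then show "x \<in> progression p b 1 N \<inter> {0..<int p}"
      using Fpn_coord_bounds[OF n] by (auto simp: supp_def box_def simp del: carrier_Fpn)
  next
    fix x assume "x \<in> progression p b 1 N \<inter> {0..<int p}"
    then have "slice p n (box p n b N) x \<noteq> {}"
      using sl comm_group_Fpn[OF p, of "n - 1"] by (simp add: PiE_eq_empty_iff)
    then show "x \<in> supp (box p n b N)" using slice_nonempty_iff[OF n sub] by blast
  qed
  then have "card (box p n b N) = (\<Sum>x\<in>progression p b 1 N \<inter> {0..<int p}. card (slice p n (box p n b N) x))"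
    using card_eq_sum_slices[OF n sub] by (simp only:)
  also have "\<dots> = (\<Sum>x\<in>progression p b 1 N \<inter> {0..<int p}. p ^ (n - 1))"
    using sl by (intro sum.cong) (simp_all add: card_Fpn del: carrier_Fpn)
  also have "\<dots> = pcard p (progression p b 1 N) * p ^ (n - 1)" by (simp add: pcard_def)
  finally show ?thesis using pcard_progression[OF p one N] by simp
qed

lemma eq_box:
  assumes p: "prime p" and n: "n \<ge> 1" and N: "N \<le> p" and A: "A \<subseteq> carrier (Fpn p n)"
    and "supp A \<subseteq> progression p b 1 N" "N * p ^ (n - 1) \<le> card A"
  shows "A = box p n b N"
proof (rule card_seteq)
  have "box p n b N \<subseteq> carrier (Fpn p n)" unfolding box_def by blast
  then show "finite (box p n b N)" using finite_Fpn by (rule finite_subset)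
  show "A \<subseteq> box p n b N" using A assms(5) by (rule subset_box)
  show "card (box p n b N) \<le> card A" using assms(6) by (simp only: card_box[OF p n N])
qed

definition scale_vec :: "nat \<Rightarrow> nat \<Rightarrow> int \<Rightarrow> (nat \<Rightarrow> int) \<Rightarrow> nat \<Rightarrow> int" where
  "scale_vec p n u z = (\<lambda>t\<in>{..<n}. if t = 0 then (u * z 0) mod int p else z t)"

lemma sum_delta_coord:
  assumes "t < n" "z \<in> carrier (Fpn p n)"
  shows "(\<Sum>s<n. of_bool (s = t) * z s) = z t" "z t mod int p = z t"
proof -
  have "(\<Sum>s<n. of_bool (s = t) * z s) = (\<Sum>s<n. if s = t then z s else 0)" by (intro sum.cong) auto
  then show "(\<Sum>s<n. of_bool (s = t) * z s) = z t" using assms by simp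
  show "z t mod int p = z t" using assms by (simp add: PiE_iff)
qed

lemma scale_vec_iso:
  assumes p: "prime p" and n: "n \<ge> 1" and u: "\<not> int p dvd u"
  shows "scale_vec p n u \<in> iso (Fpn p n) (Fpn p n)"
proof (rule iso_FpnI[OF p])
  fix z assume z: "z \<in> carrier (Fpn p n)"
  have "(\<Sum>s<n. (if t = 0 then u * of_bool (s = 0) else of_bool (s = t)) * z s) mod int p
      = (if t = 0 then (u * z 0) mod int p else z t)" if "t < n" for t
  proof (cases "t = 0")
    case True
    have "(\<Sum>s<n. u * of_bool (s = 0) * z s) = u * (\<Sum>s<n. of_bool (s = 0) * z s)"
      by (simp only: sum_distrib_left mult.assoc)
    then show ?thesis using sum_delta_coord(1)[of 0 n z p] z n True by simp
  next
    case False
    then show ?thesis using sum_delta_coord[OF that z] by simp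
  qed
  then show "scale_vec p n u z = (\<lambda>t\<in>{..<n}. (\<Sum>s<n. (if t = 0 then u * of_bool (s = 0) else of_bool (s = t)) * z s) mod int p)"
    unfolding scale_vec_def by (intro restrict_ext) simp
next
  fix z w assume zw: "z \<in> carrier (Fpn p n)" "w \<in> carrier (Fpn p n)" "scale_vec p n u z = scale_vec p n u w"
  have eq: "scale_vec p n u z t = scale_vec p n u w t" for t using zw(3) by simp
  have "int p dvd z t - w t" if "t < n" for t
  proof (cases "t = 0")
    case True
    have "(u * z 0) mod int p = (u * w 0) mod int p" using eq[of 0] n by (simp add: scale_vec_def)
    then have "int p dvd u * (z 0 - w 0)" by (simp add: mod_eq_dvd_iff right_diff_distrib)
    then show ?thesis using coprime_prime_int[OF p u] True
      by (simp add: coprime_commute coprime_dvd_mult_right_iff)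
  next
    case False
    then show ?thesis using eq[of t] that by (simp add: scale_vec_def)
  qed
  then show "z = w" using Fpn_eqI zw by blast
qed

lemma iso_subset_carrier:
  "\<phi> \<in> iso (Fpn p n) (Fpn p n) \<Longrightarrow> A \<subseteq> carrier (Fpn p n) \<Longrightarrow> \<phi> ` A \<subseteq> carrier (Fpn p n)"
  unfolding iso_def bij_betw_def by blast

lemma supp_scale_vec:
  assumes "n \<ge> 1" "x \<in> supp (scale_vec p n u ` A)"
  shows "\<exists>y\<in>supp A. x = (u * y) mod int p"
  using assms by (auto simp: supp_def scale_vec_def)

lemma isomorphic_image:
  "\<phi> \<in> iso (Fpn p n) (Fpn p n) \<Longrightarrow> isomorphic_sets p n A (\<phi> ` A)"
  unfolding isomorphic_sets_def by blast

lemma trivial_set_iso: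
  "isomorphic_sets p n A B \<Longrightarrow> trivial_set p n k l m lam B \<Longrightarrow> trivial_set p n k l m lam A"
  unfolding trivial_set_def using isomorphic_sets_trans by blast

lemma prime_dvd_lin:
  assumes "prime p" "\<not> int p dvd c" "int p dvd c * x"
  shows "int p dvd x"
  using coprime_prime_int[OF assms(1,2)] assms(3) by (simp add: coprime_commute coprime_dvd_mult_right_iff)

lemma eq_mult_inverse:
  assumes p: "prime p" and c: "\<not> int p dvd c" and "int p dvd c * b - e"
  shows "b mod int p = (e * modular_inverse (int p) c) mod int p"
proof -
  have "[c * modular_inverse (int p) c = 1] (mod int p)"
    using coprime_prime_int[OF p c] by (rule cong_modular_inverse1)
  then have "int p dvd c * modular_inverse (int p) c - 1" by (simp add: cong_iff_dvd_diff)
  then have "int p dvd e * (c * modular_inverse (int p) c - 1)" by (rule dvd_mult)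
  with assms(3) have "int p dvd (c * b - e) - e * (c * modular_inverse (int p) c - 1)" by (rule dvd_diff)
  moreover have "(c * b - e) - e * (c * modular_inverse (int p) c - 1) = c * (b - e * modular_inverse (int p) c)"
    by (simp add: algebra_simps)
  ultimately have "int p dvd c * (b - e * modular_inverse (int p) c)" by (simp only:)
  then have "int p dvd b - e * modular_inverse (int p) c" using prime_dvd_lin[OF p c] by blast
  then show ?thesis by (simp add: mod_eq_dvd_iff)
qed

text \<open>The start of an extremal interval solves \<open>(k - l) b = - (k m + 1 + j)\<close>
  modulo \<open>p\<close>. The extremal cuboids only have \<open>2 j <= lam\<close>; the other
  values are reached through the reflection of the first coordinate, which replaces \<open>j\<close>
  by \<open>lam - j\<close>.\<close>

lemma trivial_setI:
  assumes p: "prime p" and n: "n \<ge> 1" and kl: "k > l" and peq: "p = (k + l) * m + 2 + lam" and m: "m \<ge> 1"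
    and A: "A \<subseteq> carrier (Fpn p n)" "supp A \<subseteq> progression p b 1 (m + 1)"
    and j: "0 \<le> j" "j \<le> int lam" "int p dvd int l * b - int k * b - int k * int m - (1 + j)"
  shows "trivial_set p n k l m lam A"
proof -
  have kp: "k < p"
  proof -
    have "k \<le> k * m" using m by simp
    then have "k \<le> (k + l) * m" unfolding add_mult_distrib by linarith
    then show ?thesis using peq by linarith
  qed
  have mp: "m + 1 \<le> p"
  proof -
    have "m \<le> (k + l) * m" using kl by simp
    then show ?thesis using peq by linarith
  qed
  have c: "\<not> int p dvd int k - int l"
  proof
    assume "int p dvd int k - int l"
    then have "int p \<le> int k - int l" using kl by (intro zdvd_imp_le) auto
    then show False using kp by simp
  qed
  have half: "trivial_set p n k l m lam A"
    if A: "A \<subseteq> carrier (Fpn p n)" "supp A \<subseteq> progression p b 1 (m + 1)"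
      and j: "0 \<le> j" "2 * j \<le> int lam" "int p dvd int l * b - int k * b - int k * int m - (1 + j)" for A b j
  proof -
    define i where "i = nat j"
    have i: "int i = j" using j by (simp add: i_def)
    have "(int k - int l) * b - (- (int k * int m + 1 + int i)) = - (int l * b - int k * b - int k * int m - (1 + j))"
      by (simp add: i algebra_simps)
    then have "int p dvd (int k - int l) * b - (- (int k * int m + 1 + int i))"
      using j(3) by (simp only: dvd_minus_iff)
    then have "b mod int p = extremal_start p k l m i"
      unfolding extremal_start_def by (rule eq_mult_inverse[OF p c])
    then have "cyc_interval p (extremal_start p k l m i) (extremal_start p k l m i + int m)
        = cyc_interval p b (b + int m)"
      by (intro cyc_interval_cong) (auto simp: extremal_start_def)
    then have "extremal_cuboid p n k l m i = box p n b (m + 1)"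
      unfolding extremal_cuboid_def Let_def using n mp by (simp only:) (rule cuboid_eq_box, auto)
    then have "A \<subseteq> extremal_cuboid p n k l m i" using subset_box[OF A] by simp
    moreover have "isomorphic_sets p n A A"
      using isomorphic_image[of id p n A] by (simp add: iso_def hom_def)
    \<comment> \<open>For a natural number \<open>lam\<close> the bound with the ceiling equals
      \<open>lam div 2\<close>.\<close>
    moreover have "int i \<le> \<lceil>(real lam + 1) / 2\<rceil> - 1"
    proof -
      have "2 * i \<le> lam" using i j(2) by linarith
      then have "real (2 * i) \<le> real lam" by (simp only: of_nat_le_iff)
      then have "int i < \<lceil>(real lam + 1) / 2\<rceil>" unfolding less_ceiling_iff by simp
      then show ?thesis by simp
    qed
    ultimately show ?thesis unfolding trivial_set_def by blast
  qed
  show ?thesis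
  proof (cases "2 * j \<le> int lam")
    case True
    then show ?thesis using half A j by blast
  next
    case False
    have n1: "\<not> int p dvd - 1" using p prime_gt_1_nat by auto
    let ?A = "scale_vec p n (- 1) ` A"
    note iso = scale_vec_iso[OF p n n1]
    have "supp ?A \<subseteq> progression p (- (b + int m)) 1 (m + 1)"
    proof
      fix x assume "x \<in> supp ?A"
      then obtain y where y: "y \<in> supp A" "x = (- 1 * y) mod int p" using supp_scale_vec[OF n] by blast
      then obtain i where i: "i < m + 1" "int p dvd y - (b + int i * 1)" using A(2) by (auto simp: progression_def)
      have "int p dvd x - (- y)" using dvd_mod_minus[of p "- y"] y(2) by (simp only: mult_minus1)
      then have "int p dvd (x - (- y)) - (y - (b + int i * 1))" using i(2) by (rule dvd_diff)
      moreover have "(x - (- y)) - (y - (b + int i * 1)) = x - (- (b + int m) + int (m - i) * 1)"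
        using i(1) by (simp add: of_nat_diff)
      ultimately have "int p dvd x - (- (b + int m) + int (m - i) * 1)" by (simp only:)
      moreover have "m - i < m + 1" by simp
      ultimately show "x \<in> progression p (- (b + int m)) 1 (m + 1)" unfolding progression_def by blast
    qed
    moreover have "int l * - (b + int m) - int k * - (b + int m) - int k * int m - (1 + (int lam - j))
        = - (int l * b - int k * b - int k * int m - (1 + j)) - int p"
      by (simp add: peq algebra_simps)
    then have "int p dvd int l * - (b + int m) - int k * - (b + int m) - int k * int m - (1 + (int lam - j))"
      using dvd_diff[OF iffD2[OF dvd_minus_iff j(3)] dvd_refl] by (simp only:)
    ultimately have "trivial_set p n k l m lam ?A"
      using half[OF iso_subset_carrier[OF iso A(1)], of "- (b + int m)" "int lam - j"] j False by auto
    then show ?thesis using trivial_set_iso[OF isomorphic_image[OF iso]] by blast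
  qed
qed

lemma type1I:
  assumes p: "prime p" and n: "n \<ge> 1" and peq: "p = (k + l) * m + 2 + lam" and m: "m \<ge> 1" and kl: "l \<ge> 1" "k > l"
    and card: "card A = m * p ^ (n - 1)" and iso: "isomorphic_sets p n A (box p n b m)"
    and D: "int p dvd int l * b - int k * b - int k * (int m - 1) - D"
      "(1 \<le> D \<and> D \<le> int l) \<or> (int lam + int l + 2 \<le> D \<and> D \<le> int k)"
  shows "type1 p n k l m lam A"
proof -
  have kp: "k < p" "m \<le> p"
  proof -
    have "k * 1 \<le> (k + l) * m" "1 * m \<le> (k + l) * m" using m kl by (intro mult_mono; simp)+
    then show "k < p" "m \<le> p" using peq by linarith+
  qed
  define a where "a = b mod int p"
  have a: "a \<in> carrier (Fp p)" using kp by (simp add: a_def)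
  have "cyc_interval p a (a + int m - 1) = cyc_interval p b (b + int m - 1)"
    by (rule cyc_interval_cong) (auto simp: a_def)
  then have box: "cuboid p n (cyc_interval p a (a + int m - 1)) (carrier (Fpn p (n - 1))) = box p n b m"
    using cuboid_eq_box[OF n m kp(2) refl] by (simp only:)
  have "(int l * a - int k * (a + int m - 1)) mod int p = (int l * b - int k * (b + int m - 1)) mod int p"
  proof -
    have "int p dvd (int l - int k) * (a - b)"
    proof (rule dvd_mult)
      show "int p dvd a - b" unfolding a_def by (simp add: mod_eq_dvd_iff[symmetric])
    qed
    then show ?thesis by (simp add: mod_eq_dvd_iff algebra_simps)
  qed
  also have "\<dots> = D mod int p"
    using D(1) by (simp add: mod_eq_dvd_iff algebra_simps)
  also have "\<dots> = D" using D(2) kp kl by (intro mod_pos_pos_trivial) auto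
  finally have d: "(int l * a - int k * (a + int m - 1)) mod int p = D" .
  have "D \<in> cyc_interval p 1 (int l) \<or> (lam + l + 2 \<le> k \<and> D \<in> cyc_interval p (int lam + int l + 2) (int k))"
    using D(2)
  proof
    assume *: "1 \<le> D \<and> D \<le> int l"
    have "(int l - 1) mod int p = int l - 1" using kp kl by simp
    moreover have "(1 + (D - 1)) mod int p = D" using * kp kl by simp
    ultimately have "D \<in> cyc_interval p 1 (int l)"
      unfolding cyc_interval_def using * by (intro image_eqI[of _ _ "D - 1"]) auto
    then show ?thesis ..
  next
    assume *: "int lam + int l + 2 \<le> D \<and> D \<le> int k"
    define c where "c = int lam + int l + 2"
    have "(int k - c) mod int p = int k - c" using * kp by (simp add: c_def)
    moreover have "(c + (D - c)) mod int p = D" using * kp by simp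
    ultimately have "D \<in> cyc_interval p c (int k)"
      unfolding cyc_interval_def using * by (intro image_eqI[of _ _ "D - c"]) (auto simp: c_def)
    then show ?thesis using * by (simp add: c_def)
  qed
  then show ?thesis
    unfolding type1_def Let_def using card a iso box d by (intro conjI bexI[of _ a]) simp_all
qed

text \<open>Lengthening the interval of \<open>m\<close> residues on the right lowers
  \<open>D\<close> by \<open>k\<close>, on the left by \<open>l\<close>; a result between 1 and
  \<open>lam + 1\<close> would make the set trivial. What remains are the values allowed in type 1
  and those above \<open>k + lam + 1\<close>, which the reflection \<open>D\<close> to
  \<open>lam + k + l + 2 - D\<close> carries into \<open>[1, l]\<close>.\<close>

lemma normal_interval:
  assumes p: "prime p" and n: "n \<ge> 1" and kl: "k > l" "l \<ge> 1" and peq: "p = (k + l) * m + 2 + lam" and m: "m \<ge> 1"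
    and A: "A \<subseteq> carrier (Fpn p n)" "supp A \<subseteq> progression p b 1 m" and card: "m * p ^ (n - 1) \<le> card A"
    and nontrivial: "\<not> trivial_set p n k l m lam A"
    and D: "1 \<le> D" "D \<le> int lam + int k + int l + 1"
      "int p dvd int l * b - int k * b - int k * (int m - 1) - D"
  shows "type1 p n k l m lam A"
proof -
  have mp: "m \<le> p"
  proof -
    have "m \<le> (k + l) * m" using kl by simp
    then show ?thesis using peq by linarith
  qed
  have eq: "A = box p n b m" using p n mp A card by (rule eq_box)
  have cA: "card A = m * p ^ (n - 1)" unfolding eq by (rule card_box[OF p n mp])
  have iso1: "isomorphic_sets p n A (box p n b m)"
    unfolding eq using isomorphic_image[of id p n] by (simp add: iso_def hom_def)
  have "\<not> (int k + 1 \<le> D \<and> D \<le> int k + int lam + 1)"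
  proof
    assume *: "int k + 1 \<le> D \<and> D \<le> int k + int lam + 1"
    have "supp A \<subseteq> progression p b 1 (m + 1)" using A(2) progression_mono[of m "m + 1" p b 1] by auto
    moreover have "int l * b - int k * b - int k * int m - (1 + (D - int k - 1))
        = int l * b - int k * b - int k * (int m - 1) - D" by (simp add: algebra_simps)
    ultimately have "trivial_set p n k l m lam A"
      using * D(3) by (intro trivial_setI[OF p n kl(1) peq m A(1), of b "D - int k - 1"]) (simp_all only:, simp_all)
    then show False using nontrivial by blast
  qed
  moreover have "\<not> (int l + 1 \<le> D \<and> D \<le> int l + int lam + 1)"
  proof
    assume *: "int l + 1 \<le> D \<and> D \<le> int l + int lam + 1"
    have "progression p b 1 m \<subseteq> progression p (b - 1) 1 (m + 1)"
    proof
      fix x assume "x \<in> progression p b 1 m"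
      then obtain i where i: "i < m" "int p dvd x - (b + int i * 1)" by (auto simp: progression_def)
      moreover have "b - 1 + int (Suc i) * 1 = b + int i * 1" by simp
      ultimately show "x \<in> progression p (b - 1) 1 (m + 1)"
        unfolding progression_def by (intro CollectI exI[of _ "Suc i"]) (simp only:, simp)
    qed
    then have "supp A \<subseteq> progression p (b - 1) 1 (m + 1)" using A(2) by auto
    moreover have "int l * (b - 1) - int k * (b - 1) - int k * int m - (1 + (D - int l - 1))
        = int l * b - int k * b - int k * (int m - 1) - D" by (simp add: algebra_simps)
    ultimately have "trivial_set p n k l m lam A"
      using * D(3) by (intro trivial_setI[OF p n kl(1) peq m A(1), of "b - 1" "D - int l - 1"]) (simp_all only:, simp_all)
    then show False using nontrivial by blast
  qed
  ultimately consider "(1 \<le> D \<and> D \<le> int l) \<or> (int lam + int l + 2 \<le> D \<and> D \<le> int k)"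
    | "int k + int lam + 2 \<le> D" using D(1) by linarith
  then show ?thesis
  proof cases
    case 1
    then show ?thesis using type1I[OF p n peq m kl(2,1) cA iso1 D(3)] by blast
  next
    case 2
    have n1: "\<not> int p dvd - 1" using p prime_gt_1_nat by auto
    let ?A = "scale_vec p n (- 1) ` A"
    note iso = scale_vec_iso[OF p n n1]
    have "supp ?A \<subseteq> progression p (- (b + int m - 1)) 1 m"
    proof
      fix x assume "x \<in> supp ?A"
      then obtain y where y: "y \<in> supp A" "x = (- 1 * y) mod int p" using supp_scale_vec[OF n] by blast
      then obtain i where i: "i < m" "int p dvd y - (b + int i * 1)" using A(2) by (auto simp: progression_def)
      have "int p dvd x - (- y)" using dvd_mod_minus[of p "- y"] y(2) by (simp only: mult_minus1)
      then have "int p dvd (x - (- y)) - (y - (b + int i * 1))" using i(2) by (rule dvd_diff)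
      moreover have "(x - (- y)) - (y - (b + int i * 1)) = x - (- (b + int m - 1) + int (m - 1 - i) * 1)"
        using i(1) by (simp add: of_nat_diff)
      ultimately have "int p dvd x - (- (b + int m - 1) + int (m - 1 - i) * 1)" by (simp only:)
      moreover have "m - 1 - i < m" using m by simp
      ultimately show "x \<in> progression p (- (b + int m - 1)) 1 m" unfolding progression_def by blast
    qed
    then have eq': "?A = box p n (- (b + int m - 1)) m"
      using iso_subset_carrier[OF iso A(1)] card iso_card[OF iso A(1)] by (intro eq_box[OF p n mp]) auto
    have "int l * - (b + int m - 1) - int k * - (b + int m - 1) - int k * (int m - 1) - (int lam + int k + int l + 2 - D)
        = - (int l * b - int k * b - int k * (int m - 1) - D) - int p"
      by (simp add: peq algebra_simps)
    then have "int p dvd int l * - (b + int m - 1) - int k * - (b + int m - 1) - int k * (int m - 1)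
        - (int lam + int k + int l + 2 - D)"
      using dvd_diff[OF iffD2[OF dvd_minus_iff D(3)] dvd_refl] by (simp only:)
    then show ?thesis
      using type1I[OF p n peq m kl(2,1) cA] isomorphic_image[OF iso, of A] 2 D(2) unfolding eq' by fastforce
  qed
qed

section \<open>Sets of type 2\<close>

context comm_group
begin

text \<open>The powers of \<open>B\<close> do not decrease in size, so the hypothesis already gives
  \<open>|B B| = |B|\<close> and hence \<open>B B = v B\<close>. The translate \<open>V\<close> of
  \<open>B\<close> by \<open>inv v\<close> is then closed under multiplication and, being finite, a
  subgroup.\<close>

lemma coset_if_card_lset_mult_le:
  assumes fin: "finite (carrier G)" and B: "B \<subseteq> carrier G" "v \<in> B" and h: "h \<ge> 2"
    and le: "card (lset_mult G (replicate h B)) \<le> card B"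
  shows "\<exists>V. subgroup V G \<and> card V = card B \<and> B = (\<lambda>x. v \<otimes> x) ` V \<and>
    lset_mult G (replicate h B) = (\<lambda>x. v [^] h \<otimes> x) ` V"
proof -
  define W where "W j = lset_mult G (replicate j B)" for j
  have Wc: "W j \<subseteq> carrier G" for j unfolding W_def using B by (intro lset_mult_closed) auto
  have Wfin: "finite (W j)" for j using Wc fin by (rule finite_subset)
  have v: "v \<in> carrier G" using B by auto
  have Wne: "W j \<noteq> {}" for j unfolding W_def using B by (intro lset_mult_nonempty) auto
  have WSuc: "W (Suc j) = B <#> W j" for j by (simp add: W_def)
  have mono: "card (W j) \<le> card (W (Suc j))" for j
    unfolding WSuc set_mult_commute[OF B(1) Wc] using card_set_mult_ge[OF fin Wc B(1)] B(2) by blast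
  have "card (W 2) \<le> card (W h)" using h by (induction rule: dec_induct) (use mono order_trans in auto)
  then have W2: "card (W 2) \<le> card B" using le by (simp add: W_def)
  have W2_eq: "W 2 = B <#> B"
  proof -
    have "B <#> {\<one>} = B" using B by (auto simp: set_mult_def subset_iff)
    then show ?thesis by (simp add: W_def numeral_2_eq_2)
  qed
  have vB: "(\<lambda>x. v \<otimes> x) ` B = B <#> B"
  proof (rule card_seteq)
    show "finite (B <#> B)" using Wfin[of 2] by (simp only: W2_eq)
    show "(\<lambda>x. v \<otimes> x) ` B \<subseteq> B <#> B" using B(2) by (auto simp: set_mult_def)
    show "card (B <#> B) \<le> card ((\<lambda>x. v \<otimes> x) ` B)"
      using W2 card_l_image[OF v B(1)] by (simp only: W2_eq)
  qed
  define V where "V = (\<lambda>x. inv v \<otimes> x) ` B"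
  have Vc: "V \<subseteq> carrier G" using B v by (auto simp: V_def)
  have Veq: "B = (\<lambda>x. v \<otimes> x) ` V"
    unfolding V_def image_image using B v by (force simp: m_assoc[symmetric] subset_iff image_iff)
  have one: "\<one> \<in> V" using B v by (auto simp: V_def intro!: image_eqI[of _ _ v])
  have closed: "x \<otimes> y \<in> V" if "x \<in> V" "y \<in> V" for x y
  proof -
    have "(v \<otimes> x) \<otimes> (v \<otimes> y) \<in> B <#> B" using that Veq by (auto simp: set_mult_def)
    then obtain z where z: "z \<in> B" "(v \<otimes> x) \<otimes> (v \<otimes> y) = v \<otimes> z" using vB by auto
    have xy: "x \<in> carrier G" "y \<in> carrier G" "z \<in> carrier G" using that Vc z B by auto
    have "v \<otimes> (v \<otimes> (x \<otimes> y)) = v \<otimes> z" using z(2) xy v by (simp add: m_ac)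
    then have "v \<otimes> (x \<otimes> y) = z" using xy v by simp
    then have "x \<otimes> y = inv v \<otimes> z" using xy v by (auto simp: m_assoc[symmetric])
    then show ?thesis using z(1) by (auto simp: V_def)
  qed
  have sub: "subgroup V G"
  proof (rule subgroupI)
    show "inv x \<in> V" if x: "x \<in> V" for x
    proof -
      have "(\<lambda>y. x \<otimes> y) ` V \<subseteq> V" using closed x by auto
      moreover have "card ((\<lambda>y. x \<otimes> y) ` V) = card V" using x Vc by (intro card_l_image) auto
      moreover have "finite V" using Vc fin by (rule finite_subset)
      ultimately have "(\<lambda>y. x \<otimes> y) ` V = V" by (intro card_subset_eq)
      then obtain y where "y \<in> V" "x \<otimes> y = \<one>" using one by (metis imageE)
      then show ?thesis using x Vc by (metis comm_inv_char subsetD)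
    qed
  qed (use Vc one closed in auto)
  have cV: "card V = card B" unfolding V_def using v B by (intro card_l_image) auto
  have step: "(\<lambda>x. v \<otimes> x) ` (\<lambda>x. v [^] j \<otimes> x) ` V = (\<lambda>x. v [^] Suc j \<otimes> x) ` V" for j
    unfolding image_image using Vc v by (intro image_cong) (auto simp: m_ac subset_iff)
  have Wsub: "(\<lambda>x. v [^] j \<otimes> x) ` V \<subseteq> W j" if "j \<ge> 1" for j
    using that
  proof (induction j rule: nat_induct_at_least)
    case base
    have "B <#> {\<one>} = B" using B by (auto simp: set_mult_def subset_iff)
    then show ?case using Veq v by (simp add: W_def)
  next
    case (Suc j)
    have "(\<lambda>x. v \<otimes> x) ` (\<lambda>x. v [^] j \<otimes> x) ` V \<subseteq> B <#> W j"
      using Suc B(2) by (auto simp: set_mult_def)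
    then show ?case unfolding step WSuc .
  qed
  have "(\<lambda>x. v [^] h \<otimes> x) ` V = W h"
  proof (rule card_seteq[OF Wfin Wsub])
    show "card (W h) \<le> card ((\<lambda>x. v [^] h \<otimes> x) ` V)"
      using le cV card_l_image[OF nat_pow_closed[OF v] Vc, of h] by (simp add: W_def)
  qed (use h in simp)
  then show ?thesis using sub cV Veq unfolding W_def by metis
qed

end

lemma pow_Fpn:
  assumes "prime p" "v \<in> carrier (Fpn p d)"
  shows "v [^]\<^bsub>Fpn p d\<^esub> (h :: nat) = (\<lambda>i\<in>{..<d}. (int h * v i) mod int p)"
proof -
  interpret H: comm_group "Fpn p d" using assms(1) by (rule comm_group_Fpn)
  have "v [^]\<^bsub>Fpn p d\<^esub> h = lprod (Fpn p d) (replicate h v)" using H.lprod_replicate[OF assms(2)] by simp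
  then show ?thesis unfolding lprod_Fpn by (simp add: sum_list_replicate)
qed

text \<open>Multiplication by a residue is repeated addition, so subgroups are closed under
  scalars.\<close>

lemma linear_subspace_if_subgroup:
  assumes p: "prime p" and V: "subgroup V (Fpn p d)"
  shows "linear_subspace p d V"
  unfolding linear_subspace_def
proof (intro conjI ballI)
  interpret H: comm_group "Fpn p d" using p by (rule comm_group_Fpn)
  fix c v assume c: "c \<in> carrier (Fp p)" and v: "v \<in> V"
  have "v \<in> carrier (Fpn p d)" using v V by (rule subgroup.mem_carrier[rotated])
  then have "(\<lambda>i\<in>{..<d}. c \<otimes>\<^bsub>Fp p\<^esub> v i) = v [^]\<^bsub>Fpn p d\<^esub> (nat c)"
    unfolding pow_Fpn[OF p \<open>v \<in> carrier (Fpn p d)\<close>] using c by simp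
  moreover have "v [^]\<^bsub>Fpn p d\<^esub> h \<in> V" for h :: nat
    using V v by (induction h) (auto simp del: one_Fpn mult_Fpn intro: subgroup.one_closed subgroup.m_closed)
  ultimately show "(\<lambda>i\<in>{..<d}. c \<otimes>\<^bsub>Fp p\<^esub> v i) \<in> V" by (simp only:)
qed (fact V)

text \<open>The slice at \<open>x\<close> is translated by \<open>x\<close> times the vector with
  coordinates \<open>w 1, ..., w (n - 1)\<close>, while positions are kept.\<close>

definition shear_vec :: "nat \<Rightarrow> nat \<Rightarrow> (nat \<Rightarrow> int) \<Rightarrow> (nat \<Rightarrow> int) \<Rightarrow> nat \<Rightarrow> int" where
  "shear_vec p n w z = (\<lambda>t\<in>{..<n}. if t = 0 then z 0 else (z t + w t * z 0) mod int p)"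

lemma shear_vec_iso:
  assumes p: "prime p" and n: "n \<ge> 1"
  shows "shear_vec p n w \<in> iso (Fpn p n) (Fpn p n)"
proof (rule iso_FpnI[OF p])
  fix z assume z: "z \<in> carrier (Fpn p n)"
  have "(\<Sum>s<n. (of_bool (s = t) + (if t = 0 then 0 else w t * of_bool (s = 0))) * z s) mod int p
      = (if t = 0 then z 0 else (z t + w t * z 0) mod int p)" if "t < n" for t
  proof -
    have "(\<Sum>s<n. w t * of_bool (s = 0) * z s) = w t * (\<Sum>s<n. of_bool (s = 0) * z s)"
      by (simp only: sum_distrib_left mult.assoc)
    also have "\<dots> = w t * z 0" using sum_delta_coord(1)[of 0 n z p] z n by simp
    finally show ?thesis
      using sum_delta_coord[OF that z] by (simp only: distrib_right sum.distrib) auto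
  qed
  then show "shear_vec p n w z = (\<lambda>t\<in>{..<n}.
      (\<Sum>s<n. (of_bool (s = t) + (if t = 0 then 0 else w t * of_bool (s = 0))) * z s) mod int p)"
    unfolding shear_vec_def by (intro restrict_ext) simp
next
  fix z z' assume z: "z \<in> carrier (Fpn p n)" "z' \<in> carrier (Fpn p n)" "shear_vec p n w z = shear_vec p n w z'"
  have eq: "shear_vec p n w z t = shear_vec p n w z' t" for t using z(3) by simp
  have z0: "z 0 = z' 0" using eq[of 0] n by (simp add: shear_vec_def)
  have "int p dvd z t - z' t" if "t < n" for t
  proof (cases "t = 0")
    case False
    then have "(z t + w t * z 0) mod int p = (z' t + w t * z 0) mod int p"
      using eq[of t] that z0 by (simp add: shear_vec_def)
    then show ?thesis by (simp add: mod_eq_dvd_iff)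
  qed (use z0 in simp)
  then show "z = z'" using Fpn_eqI z by blast
qed

lemma vtail_shear:
  assumes "n \<ge> 1"
  shows "vtail n (shear_vec p n w z) = vtail n z \<otimes>\<^bsub>Fpn p (n - 1)\<^esub> (\<lambda>i\<in>{..<n - 1}. (w (Suc i) * z 0) mod int p)"
  using assms by (auto simp: vtail_def shear_vec_def mod_simps intro!: restrict_ext)

lemma supp_slice_pos:
  assumes "n \<ge> 1" "A \<subseteq> carrier (Fpn p n)" "x \<in> supp A"
  shows "slice p n A x \<noteq> {}"
  using slice_nonempty_iff[OF assms(1,2)] assms(3) by blast

text \<open>The slices at the two ends satisfy \<open>k B \<inter> C = {}\<close> and \<open>|B| + |C| \<ge> p\<^sup>n\<^sup>-\<^sup>1\<close>, so \<open>|k B| = |B|\<close>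
  and \<open>B\<close> is a coset of a subspace. As the position of \<open>B\<close> is nonzero, a shear moves it to the
  subspace itself.\<close>

lemma normal_two_ends:
  assumes p: "prime p" and n: "n \<ge> 1" and k: "k \<ge> 4" and peq: "p = (k + 1) * m + 2 + lam" and m: "m \<ge> 2"
    and sf: "sum_free p n k 1 A" and S: "supp A \<subseteq> progression p b 1 (m + 1)"
    and ends: "b mod int p \<in> supp A" "(b + int m) mod int p \<in> supp A"
    and b: "int p dvd b - int k * b - int k * int m" and card: "m * p ^ (n - 1) \<le> card A"
  shows "type2 p n k 1 m A"
proof -
  let ?H = "Fpn p (n - 1)"
  let ?P = "p ^ (n - 1)"
  interpret H: comm_group ?H using p by (rule comm_group_Fpn)
  have p0: "p > 0" using p prime_gt_0_nat by simp
  have A: "A \<subseteq> carrier (Fpn p n)" using sf by (simp only: sum_free_def)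
  have mp: "m + 1 < p" "k < p"
  proof -
    have "m \<le> (k + 1) * m" by simp
    then show "m + 1 < p" using peq by linarith
    have "(k + 1) * 1 \<le> (k + 1) * m" by (rule mult_le_mono2) (use m in simp)
    then show "k < p" unfolding mult_1_right using peq by linarith
  qed
  define a where "a = b mod int p"
  define a' where "a' = (b + int m) mod int p"
  have aR: "a \<in> {0..<int p}" "a' \<in> {0..<int p}" using p0 by (auto simp: a_def a'_def)
  have a_dvd: "int p dvd a - b" "int p dvd a' - (b + int m)"
    unfolding a_def a'_def by (rule dvd_mod_minus)+
  \<comment> \<open>Modulo \<open>p\<close> the position of \<open>C\<close> is \<open>k\<close>
    times the position of \<open>B\<close>; this relation ties the two end slices together.\<close>
  have aa': "int p dvd a - int k * a'"
  proof -
    have "a - int k * a' = (a - b) - int k * (a' - (b + int m)) + (b - int k * b - int k * int m)"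
      by (simp add: algebra_simps)
    moreover have "int p dvd \<dots>" by (rule dvd_add[OF dvd_diff[OF a_dvd(1) dvd_mult[OF a_dvd(2)]] b])
    ultimately show ?thesis by (simp only:)
  qed
  have a'm: "a' = (a + int m) mod int p" by (simp add: a_def a'_def mod_simps)
  \<comment> \<open>If \<open>a'\<close> vanished modulo \<open>p\<close>, so would
    \<open>a = k a'\<close> and with it the difference \<open>m\<close> of the two
    positions.\<close>
  have a'ne: "\<not> int p dvd a'"
  proof
    assume *: "int p dvd a'"
    have "int p dvd (a - int k * a') + int k * a'" by (rule dvd_add[OF aa' dvd_mult[OF *]])
    then have "int p dvd a" by simp
    then have "int p dvd (a' - (b + int m)) - a' + (a - (a - b))"
      using a_dvd * by (metis dvd_add dvd_diff)
    then have "int p dvd int m" by simp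
    then show False using zdvd_not_zless[of "int m" "int p"] m mp by simp
  qed
  define B where "B = slice p n A a'"
  define C where "C = slice p n A a"
  have B: "B \<subseteq> carrier ?H" "B \<noteq> {}" and C: "C \<subseteq> carrier ?H" "C \<noteq> {}"
    using slice_subset supp_slice_pos[OF n A] ends unfolding B_def C_def a_def a'_def by blast+
  have finB: "finite B" "finite C" unfolding B_def C_def by (rule finite_slice)+
  define W where "W = lset_mult ?H (replicate k B)"
  have WC: "W \<inter> C = {}"
  proof (rule ccontr)
    assume "W \<inter> C \<noteq> {}"
    then obtain g where "g \<in> W" "g \<in> C" by blast
    then obtain vs where vs: "list_all2 (\<in>) vs (replicate k B)" "lprod ?H vs = g"
      unfolding W_def mem_lset_mult by blast
    have "lprod ?H vs \<noteq> lprod ?H [g]"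
    proof (rule sum_free_slices[OF p n sf])
      show "length (replicate k a') = k" "set (replicate k a') \<subseteq> supp A" "length [a] = 1" "set [a] \<subseteq> supp A"
        using ends by (auto simp: a_def a'_def)
      show "sum_list (replicate k a') mod int p = sum_list [a] mod int p"
        using aa' by (simp add: sum_list_replicate mod_eq_dvd_iff dvd_diff_commute)
      show "list_all2 (\<in>) vs (map (slice p n A) (replicate k a'))" using vs(1) by (simp add: B_def)
      show "list_all2 (\<in>) [g] (map (slice p n A) [a])" using \<open>g \<in> C\<close> by (simp add: C_def)
    qed
    moreover have "lprod ?H [g] = g" using \<open>g \<in> C\<close> C(1) H.r_one by (simp del: one_Fpn mult_Fpn carrier_Fpn add: subset_iff)
    ultimately show False using vs(2) by simp
  qed
  have Wc: "W \<subseteq> carrier ?H" unfolding W_def using B by (intro H.lset_mult_closed) auto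
  have BW: "card B \<le> card W"
    unfolding W_def using B k by (intro H.card_lset_mult_mem_ge[OF finite_Fpn]) auto
  have WCle: "card W + card C \<le> ?P"
  proof -
    have "card W + card C = card (W \<union> C)"
      using WC finB finite_subset[OF Wc finite_Fpn] by (simp add: card_Un_disjoint)
    also have "\<dots> \<le> card (carrier ?H)" using Wc C by (intro card_mono finite_Fpn) auto
    finally show ?thesis by (simp only: card_Fpn)
  qed
  have aa'ne: "a \<noteq> a'"
  proof
    assume "a = a'"
    have "int p dvd (a - b) - (a' - (b + int m))" by (rule dvd_diff[OF a_dvd])
    then have "int p dvd int m" using \<open>a = a'\<close> by simp
    then show False using zdvd_not_zless[of "int m" "int p"] m mp by simp
  qed
  define X where "X = progression p b 1 (m + 1) \<inter> {0..<int p}"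
  have one: "\<not> int p dvd 1" using p prime_gt_1_nat by auto
  have finX: "finite X" by (simp add: X_def)
  have cX: "card X = m + 1"
    unfolding X_def pcard_def[symmetric] using mp by (intro pcard_progression[OF p one]) simp
  have aX: "a \<in> X" "a' \<in> X"
    using ends S aR unfolding X_def a_def a'_def by auto
  have sX: "supp A \<subseteq> X" using S supp_subset[OF n A] by (auto simp: X_def)
  have zero: "slice p n A x = {}" if "x \<notin> supp A" for x using that slice_nonempty_iff[OF n A] by blast
  have cA: "card A = (\<Sum>x\<in>X. card (slice p n A x))"
    unfolding card_eq_sum_slices[OF n A] using zero sX finX by (intro sum.mono_neutral_left) auto
  let ?R = "X - {a, a'}"
  have cA': "card A = card C + card B + (\<Sum>x\<in>?R. card (slice p n A x))"
  proof -
    have "card A = card (slice p n A a) + (\<Sum>x\<in>X - {a}. card (slice p n A x))"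
      unfolding cA using finX aX by (simp add: sum.remove)
    also have "(\<Sum>x\<in>X - {a}. card (slice p n A x)) = card (slice p n A a') + (\<Sum>x\<in>X - {a} - {a'}. card (slice p n A x))"
      using finX aX aa'ne by (intro sum.remove) auto
    also have "X - {a} - {a'} = ?R" by auto
    finally show ?thesis by (simp add: B_def C_def)
  qed
  have cR: "card ?R = m - 1" using cX aX aa'ne finX by (simp add: card_Diff_subset)
  have Rle: "(\<Sum>x\<in>?R. card (slice p n A x)) \<le> (m - 1) * ?P"
    using sum_bounded_above[of ?R "\<lambda>x. card (slice p n A x)" ?P] card_slice_le cR by simp
  have "m * ?P = ?P + (m - 1) * ?P"
  proof -
    have "Suc (m - 1) * ?P = ?P + (m - 1) * ?P" by (rule mult_Suc)
    then show ?thesis using m by simp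
  qed
  \<comment> \<open>The \<open>m - 1\<close> inner slices hold at most \<open>(m - 1) * ?P\<close>
    elements, so the two end slices hold at least \<open>?P\<close>. Combined with
    \<open>|B| <= |W|\<close> and \<open>|W| + |C| <= ?P\<close> this leaves no slack anywhere: the
    inner slices are full and \<open>|W| = |B|\<close>.\<close>
  then have sum: "?P \<le> card C + card B" and Rge: "(m - 1) * ?P \<le> (\<Sum>x\<in>?R. card (slice p n A x))"
      and cAeq: "card A = m * ?P"
    using card WCle BW cA' Rle by linarith+
  have Rfull: "slice p n A x = carrier ?H" if "x \<in> ?R" for x
  proof (rule ccontr)
    assume "slice p n A x \<noteq> carrier ?H"
    then have "card (slice p n A x) < ?P"
      using psubset_card_mono[OF finite_Fpn, of "slice p n A x" p "n - 1"] slice_subset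
      by (metis card_Fpn psubsetI)
    then have "(\<Sum>x\<in>?R. card (slice p n A x)) < (\<Sum>x\<in>?R. ?P)"
      using that finX card_slice_le by (intro sum_strict_mono_ex1) auto
    then show False using Rge cR by simp
  qed
  have "card W \<le> card B" using WCle sum by linarith
  obtain v where v: "v \<in> B" using B by blast
  obtain V where V: "subgroup V ?H" "card V = card B" "B = (\<lambda>x. v \<otimes>\<^bsub>?H\<^esub> x) ` V"
      "W = (\<lambda>x. v [^]\<^bsub>?H\<^esub> k \<otimes>\<^bsub>?H\<^esub> x) ` V"
    using H.coset_if_card_lset_mult_le[OF finite_Fpn B(1) v, of k] \<open>card W \<le> card B\<close> k
    unfolding W_def by auto
  have vc: "v \<in> carrier ?H" using v B by blast
  have Vc: "V \<subseteq> carrier ?H" using V(1) by (rule subgroup.subset)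
  have CW: "C = carrier ?H - W"
  proof (rule card_seteq)
    show "finite (carrier ?H - W)" using finite_Fpn by blast
    show "C \<subseteq> carrier ?H - W" using C WC by blast
    have "card (carrier ?H - W) = ?P - card W"
      using card_Diff_subset[OF finite_subset[OF Wc finite_Fpn] Wc] by (simp only: card_Fpn)
    then show "card (carrier ?H - W) \<le> card C" using BW sum by linarith
  qed
  have Vne: "V \<subset> carrier ?H"
  proof -
    have "card C > 0" using C finB by (simp add: card_gt_0_iff)
    then have "card V < ?P" using WCle BW V(2) by linarith
    then show ?thesis using Vc card_Fpn[of p "n - 1"] by (metis less_irrefl psubsetI)
  qed
  have n2: "n \<ge> 2"
  proof (rule ccontr)
    assume "\<not> ?thesis"
    then have "n - 1 = 0" by simp
    then have "card (carrier ?H) = 1" unfolding card_Fpn by simp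
    moreover have "card V < card (carrier ?H)" using Vne finite_Fpn by (intro psubset_card_mono)
    moreover have "V \<noteq> {}" using subgroup.one_closed[OF V(1)] by blast
    then have "card V > 0" using finite_subset[OF Vc finite_Fpn] by (simp add: card_gt_0_iff)
    ultimately show False by linarith
  qed
  obtain c where c: "int p dvd a' * c - 1"
    using coprime_prime_int[OF p a'ne] by (metis cong_iff_dvd_diff cong_solve_coprime_int)
  \<comment> \<open>As \<open>c\<close> is the inverse of \<open>a'\<close>, the shear moves the
    slice at \<open>a'\<close> by \<open>- v\<close> and the one at \<open>a = k a'\<close> by
    \<open>- k v\<close>. The coset \<open>B\<close> and the coset \<open>W\<close> omitted by
    \<open>C\<close> thus both become \<open>V\<close>.\<close>
  define w where "w t = (case t of 0 \<Rightarrow> 0 | Suc i \<Rightarrow> - v i * c)" for t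
  let ?\<psi> = "shear_vec p n w"
  define A' where "A' = ?\<psi> ` A"
  note iso = shear_vec_iso[OF p n, of w]
  have A'c: "A' \<subseteq> carrier (Fpn p n)" unfolding A'_def using iso A by (rule iso_subset_carrier)
  define s where "s x = (\<lambda>i\<in>{..<n - 1}. (w (Suc i) * x) mod int p)" for x
  have sc: "s x \<in> carrier ?H" for x using p0 by (auto simp: s_def)
  have \<psi>0: "?\<psi> z 0 = z 0" for z using n by (simp add: shear_vec_def)
  have \<psi>t: "vtail n (?\<psi> z) = vtail n z \<otimes>\<^bsub>?H\<^esub> s (z 0)" for z
    unfolding s_def by (rule vtail_shear[OF n])
  have slice': "u \<in> slice p n A' x \<longleftrightarrow> (\<exists>y\<in>slice p n A x. u = y \<otimes>\<^bsub>?H\<^esub> s x)" for u x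
  proof
    assume u: "u \<in> slice p n A' x"
    then obtain z where z: "z \<in> A" "vcons n x u = ?\<psi> z" by (auto simp: slice_def A'_def)
    then have x: "z 0 = x" using \<psi>0[of z] n by (metis vcons_0)
    have "u = vtail n (?\<psi> z)" using z(2) u vtail_vcons slice_subset by (metis subsetD)
    then have "u = vtail n z \<otimes>\<^bsub>?H\<^esub> s x" using \<psi>t x by metis
    moreover have "vtail n z \<in> slice p n A x" using mem_slice[OF n A z(1)] x by (simp only:)
    ultimately show "\<exists>y\<in>slice p n A x. u = y \<otimes>\<^bsub>?H\<^esub> s x" by blast
  next
    assume "\<exists>y\<in>slice p n A x. u = y \<otimes>\<^bsub>?H\<^esub> s x"
    then obtain y where y: "y \<in> carrier ?H" "vcons n x y \<in> A" "u = y \<otimes>\<^bsub>?H\<^esub> s x" by (auto simp: slice_def simp del: carrier_Fpn mult_Fpn)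
    have A'mem: "?\<psi> (vcons n x y) \<in> A'" using y by (simp add: A'_def)
    have "vtail n (?\<psi> (vcons n x y)) = u" using \<psi>t[of "vcons n x y"] vtail_vcons[OF y(1)] y(3) n by (simp del: mult_Fpn)
    then show "u \<in> slice p n A' x"
      using mem_slice[OF n A'c A'mem] \<psi>0[of "vcons n x y"] n by simp
  qed
  have s_a': "s a' = inv\<^bsub>?H\<^esub> v"
  proof -
    have "s a' \<otimes>\<^bsub>?H\<^esub> v = \<one>\<^bsub>?H\<^esub>"
    proof -
      have "(- v i * c * a' mod int p + v i) mod int p = 0" for i
      proof -
        have "- v i * c * a' + v i = - v i * (a' * c - 1)" by (simp add: algebra_simps)
        then have "int p dvd - v i * c * a' + v i" using c by (metis dvd_mult)
        then show ?thesis by (simp add: mod_simps dvd_eq_mod_eq_0[symmetric])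
      qed
      then show ?thesis by (auto simp: s_def w_def intro!: restrict_ext)
    qed
    then show ?thesis using H.inv_equality[OF _ vc sc] by simp
  qed
  have s_a: "s a = inv\<^bsub>?H\<^esub> (v [^]\<^bsub>?H\<^esub> k)"
  proof -
    have "s a \<otimes>\<^bsub>?H\<^esub> v [^]\<^bsub>?H\<^esub> k = \<one>\<^bsub>?H\<^esub>"
    proof -
      have "(- v i * c * a mod int p + int k * v i mod int p) mod int p = 0" for i
      proof -
        have "- v i * c * a + int k * v i = - (v i * c) * (a - int k * a') - (int k * v i) * (a' * c - 1)"
          by (simp add: algebra_simps)
        moreover have "int p dvd \<dots>" by (rule dvd_diff[OF dvd_mult[OF aa'] dvd_mult[OF c]])
        ultimately have "int p dvd - v i * c * a + int k * v i" by (simp only:)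
        then show ?thesis by (simp add: mod_simps dvd_eq_mod_eq_0[symmetric])
      qed
      then show ?thesis unfolding pow_Fpn[OF p vc] by (auto simp: s_def w_def intro!: restrict_ext)
    qed
    then show ?thesis using H.inv_equality[OF _ H.nat_pow_closed[OF vc] sc] by simp
  qed
  have sl_a': "slice p n A' a' = V"
  proof (intro equalityI subsetI)
    fix u assume "u \<in> slice p n A' a'"
    then obtain x where "x \<in> V" "u = (v \<otimes>\<^bsub>?H\<^esub> x) \<otimes>\<^bsub>?H\<^esub> inv\<^bsub>?H\<^esub> v"
      unfolding slice' s_a' B_def[symmetric] V(3) by blast
    moreover from this have "x \<in> carrier ?H" using Vc by blast
    ultimately show "u \<in> V" using vc H.inv_closed[OF vc]
      by (metis H.m_comm H.m_closed H.inv_solve_right)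
  next
    fix u assume u: "u \<in> V"
    then have "u \<in> carrier ?H" using Vc by blast
    then have "u = (v \<otimes>\<^bsub>?H\<^esub> u) \<otimes>\<^bsub>?H\<^esub> inv\<^bsub>?H\<^esub> v"
      using vc H.inv_closed[OF vc] by (metis H.m_comm H.m_closed H.inv_solve_right)
    then show "u \<in> slice p n A' a'"
      unfolding slice' s_a' B_def[symmetric] using u V(3) by blast
  qed
  have sl_a: "slice p n A' a = carrier ?H - V"
  proof (intro equalityI subsetI)
    let ?y = "v [^]\<^bsub>?H\<^esub> k"
    have y: "?y \<in> carrier ?H" using vc by (rule H.nat_pow_closed)
    {
      fix u assume "u \<in> slice p n A' a"
      then obtain x where x: "x \<in> C" "u = x \<otimes>\<^bsub>?H\<^esub> inv\<^bsub>?H\<^esub> ?y"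
        unfolding slice' s_a C_def[symmetric] by blast
      have xc: "x \<in> carrier ?H" using x C by blast
      have uc: "u \<in> carrier ?H" using x(2) xc y by (simp only: H.m_closed H.inv_closed)
      have "x = ?y \<otimes>\<^bsub>?H\<^esub> u" using x(2) xc y uc by (metis H.m_comm H.inv_solve_right)
      then have "u \<notin> V" using x(1) CW V(4) by blast
      then show "u \<in> carrier ?H - V" using uc by blast
    next
      fix u assume u: "u \<in> carrier ?H - V"
      then have uc: "u \<in> carrier ?H" by blast
      have yu: "?y \<otimes>\<^bsub>?H\<^esub> u \<in> carrier ?H" using y uc by (rule H.m_closed)
      have "?y \<otimes>\<^bsub>?H\<^esub> u \<notin> W"
      proof
        assume "?y \<otimes>\<^bsub>?H\<^esub> u \<in> W"
        then obtain x where "x \<in> V" "?y \<otimes>\<^bsub>?H\<^esub> u = ?y \<otimes>\<^bsub>?H\<^esub> x" unfolding V(4) by blast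
        moreover from this have "x \<in> carrier ?H" using Vc by blast
        ultimately have "u = x" using y uc yu by (metis H.inv_solve_left)
        then show False using u \<open>x \<in> V\<close> by blast
      qed
      then have "?y \<otimes>\<^bsub>?H\<^esub> u \<in> C" using CW yu by blast
      moreover have "u = (?y \<otimes>\<^bsub>?H\<^esub> u) \<otimes>\<^bsub>?H\<^esub> inv\<^bsub>?H\<^esub> ?y"
        using y uc yu by (metis H.m_comm H.inv_solve_right)
      ultimately show "u \<in> slice p n A' a" unfolding slice' s_a C_def[symmetric] by blast
    }
  qed
  have sl_R: "slice p n A' x = carrier ?H" if "x \<in> ?R" for x
  proof (intro equalityI subsetI)
    fix u assume u: "u \<in> carrier ?H"
    then have "u \<otimes>\<^bsub>?H\<^esub> inv\<^bsub>?H\<^esub> s x \<in> carrier ?H" using sc by (simp only: H.m_closed H.inv_closed)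
    moreover have "u = (u \<otimes>\<^bsub>?H\<^esub> inv\<^bsub>?H\<^esub> s x) \<otimes>\<^bsub>?H\<^esub> s x" using u sc by (metis H.inv_solve_right calculation)
    ultimately show "u \<in> slice p n A' x" unfolding slice' Rfull[OF that] by blast
  qed (use slice_subset in blast)
  have sl_out: "slice p n A' x = {}" if "x \<notin> X" for x
    using that zero sX unfolding set_eq_iff slice' by blast
  have X_eq: "X = insert a (insert a' (progression p (a + 1) 1 (m - 1) \<inter> {0..<int p}))"
    "a \<notin> progression p (a + 1) 1 (m - 1)" "a' \<notin> progression p (a + 1) 1 (m - 1)"
  proof -
    have pm: "x \<in> progression p b 1 (m + 1) \<longleftrightarrow> int p dvd x - a \<or> int p dvd x - a' \<or> x \<in> progression p (a + 1) 1 (m - 1)" for x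
    proof
      assume "x \<in> progression p b 1 (m + 1)"
      then obtain i where i: "i < m + 1" "int p dvd x - (b + int i * 1)" by (auto simp: progression_def)
      consider "i = 0" | "i = m" | "0 < i" "i < m" using i(1) by linarith
      then show "int p dvd x - a \<or> int p dvd x - a' \<or> x \<in> progression p (a + 1) 1 (m - 1)"
      proof cases
        case 1
        have "int p dvd (x - (b + int i * 1)) - (a - b)" by (rule dvd_diff[OF i(2) a_dvd(1)])
        then show ?thesis using 1 by simp
      next
        case 2
        have "int p dvd (x - (b + int i * 1)) - (a' - (b + int m))" by (rule dvd_diff[OF i(2) a_dvd(2)])
        then show ?thesis using 2 by simp
      next
        case 3
        have "int p dvd (x - (b + int i * 1)) - (a - b)" by (rule dvd_diff[OF i(2) a_dvd(1)])
        moreover have "(x - (b + int i * 1)) - (a - b) = x - (a + 1 + int (i - 1) * 1)" using 3 by (simp add: of_nat_diff)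
        ultimately have "int p dvd x - (a + 1 + int (i - 1) * 1)" by (simp only:)
        moreover have "i - 1 < m - 1" using 3 by simp
        ultimately show ?thesis unfolding progression_def by blast
      qed
    next
      assume "int p dvd x - a \<or> int p dvd x - a' \<or> x \<in> progression p (a + 1) 1 (m - 1)"
      then consider "int p dvd x - a" | "int p dvd x - a'" | i where "i < m - 1" "int p dvd x - (a + 1 + int i * 1)"
        unfolding progression_def by blast
      then show "x \<in> progression p b 1 (m + 1)"
      proof cases
        case 1
        from dvd_add[OF this a_dvd(1)] have "int p dvd x - b" by simp
        then show ?thesis unfolding progression_def by (intro CollectI exI[of _ 0]) simp
      next
        case 2
        then have "int p dvd (x - a') + (a' - (b + int m))" by (rule dvd_add[OF _ a_dvd(2)])
        also have "(x - a') + (a' - (b + int m)) = x - (b + int m)" by simp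
        finally have "int p dvd x - (b + int m)" .
        then show ?thesis unfolding progression_def by (intro CollectI exI[of _ m]) simp
      next
        case 3
        have "int p dvd (x - (a + 1 + int i * 1)) + (a - b)" using 3(2) a_dvd(1) by (rule dvd_add)
        also have "(x - (a + 1 + int i * 1)) + (a - b) = x - (b + int (Suc i) * 1)" by simp
        finally have "int p dvd x - (b + int (Suc i) * 1)" .
        moreover have "Suc i < m + 1" using 3(1) by simp
        ultimately show ?thesis unfolding progression_def by blast
      qed
    qed
    have eqR: "int p dvd x - y \<longleftrightarrow> x = y" if "x \<in> {0..<int p}" "y \<in> {0..<int p}" for x y
      using that mod_eq_dvd_iff[of x "int p" y] by auto
    show "X = insert a (insert a' (progression p (a + 1) 1 (m - 1) \<inter> {0..<int p}))"
      unfolding X_def using pm aR eqR by auto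
    have no: "\<not> int p dvd t" if "0 < t" "t < int p" for t using that zdvd_not_zless by blast
    show "a \<notin> progression p (a + 1) 1 (m - 1)"
    proof
      assume "a \<in> progression p (a + 1) 1 (m - 1)"
      then obtain i where i: "i < m - 1" "int p dvd a - (a + 1 + int i * 1)" by (auto simp: progression_def)
      have "a - (a + 1 + int i * 1) = - (int i + 1)" by simp
      then have "int p dvd int i + 1" using i(2) by (simp only: dvd_minus_iff)
      then show False using no[of "int i + 1"] i(1) mp by simp
    qed
    show "a' \<notin> progression p (a + 1) 1 (m - 1)"
    proof
      assume "a' \<in> progression p (a + 1) 1 (m - 1)"
      then obtain i where i: "i < m - 1" "int p dvd a' - (a + 1 + int i * 1)" by (auto simp: progression_def)
      have "int p dvd (a' - (a + 1 + int i * 1)) - (a' - (b + int m)) + (a - b)"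
        by (rule dvd_add[OF dvd_diff[OF i(2) a_dvd(2)] a_dvd(1)])
      also have "(a' - (a + 1 + int i * 1)) - (a' - (b + int m)) + (a - b) = int m - 1 - int i" by simp
      finally have "int p dvd int m - 1 - int i" .
      then show False using no[of "int m - 1 - int i"] i(1) mp by simp
    qed
  qed
  let ?cub = "cuboid p n {a} (carrier ?H - V) \<union>
      cuboid p n (cyc_interval p (a + 1) (a + int m - 1)) (carrier ?H) \<union> cuboid p n {(a + int m) mod int p} V"
  have cyc: "cyc_interval p (a + 1) (a + int m - 1) = progression p (a + 1) 1 (m - 1) \<inter> {0..<int p}"
    using m mp by (intro cyc_interval_eq_progression) (auto simp: of_nat_diff)
  have memA': "z \<in> A' \<longleftrightarrow> z \<in> carrier (Fpn p n) \<and> vtail n z \<in> slice p n A' (z 0)" for z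
  proof
    assume "z \<in> A'"
    then show "z \<in> carrier (Fpn p n) \<and> vtail n z \<in> slice p n A' (z 0)" using A'c mem_slice[OF n A'c] by blast
  next
    assume "z \<in> carrier (Fpn p n) \<and> vtail n z \<in> slice p n A' (z 0)"
    then show "z \<in> A'" using vcons_vtail[OF n] by (force simp: slice_def simp del: carrier_Fpn)
  qed
  have "A' = ?cub"
  proof (rule Set.set_eqI)
    fix z
    show "z \<in> A' \<longleftrightarrow> z \<in> ?cub"
    proof (cases "z \<in> carrier (Fpn p n)")
      case False
      then show ?thesis using A'c by (auto simp: cuboid_def simp del: carrier_Fpn)
    next
      case True
      have t: "vtail n z \<in> carrier ?H" using vtail_closed[OF n True] .
      have cub: "z \<in> cuboid p n Y Z \<longleftrightarrow> z 0 \<in> Y \<and> vtail n z \<in> Z" for Y Z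
        using True by (simp add: cuboid_def vtail_def del: carrier_Fpn)
      show ?thesis
        unfolding memA' Un_iff cub cyc a'm[symmetric]
        using True t X_eq sl_a sl_a' sl_R sl_out aa'ne by (cases "z 0 \<in> X") auto
    qed
  qed
  then have isoA: "isomorphic_sets p n A ?cub" using isomorphic_image[OF iso, of A] by (simp only: A'_def)
  have aeq: "(int m * int k * modular_inverse (int p) (int 1 - int k)) mod int p = a"
  proof -
    have "\<not> int p dvd int 1 - int k"
    proof
      assume "int p dvd int 1 - int k"
      then have "int p dvd int k - 1" by (simp add: dvd_diff_commute)
      then show False using zdvd_imp_le[of "int p" "int k - 1"] mp k by simp
    qed
    moreover have "int p dvd (int 1 - int k) * b - int m * int k" using b by (simp add: algebra_simps)
    ultimately show ?thesis unfolding a_def by (rule eq_mult_inverse[OF p, symmetric])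
  qed
  show ?thesis
    unfolding type2_def Let_def aeq
    using cAeq n2 linear_subspace_if_subgroup[OF p V(1)] Vne isoA by blast
qed

section \<open>The classification\<close>

lemma interval_support:
  assumes p: "prime p" and n: "n \<ge> 1" and kl: "k > l" "l \<ge> 1" "k + l \<ge> 5" and lam: "lam \<le> k + l - 5"
    and peq: "p = (k + l) * m + 2 + lam" and m: "m \<ge> 14" "m \<ge> k + l + lam + 4"
    and T: "5 * T_fun (1 / real (k + l)) \<le> ennreal (real m)"
    and eta: "\<eta> \<ge> 0" "real (k + l) * \<eta> ^ (k + l - 2) \<le> 1" "real (k + l + lam + 4) \<le> \<eta> * real m"
    and sf: "sum_free p n k l A" and card: "m * p ^ (n - 1) \<le> card A"
  shows "\<exists>\<phi>\<in>iso (Fpn p n) (Fpn p n). interval_shape p k l m lam {x. x mod int p \<in> supp (\<phi> ` A)}"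
proof -
  have p0: "p > 0" using p prime_gt_0_nat by simp
  have A: "A \<subseteq> carrier (Fpn p n)" using sf by (simp only: sum_free_def)
  have dense: "real (p ^ n) - real (card A) \<le> real (k + l) * real (card A)"
  proof -
    have pn: "p ^ n = p * p ^ (n - 1)" using n by (simp add: power_eq_if)
    \<comment> \<open>This needs \<open>lam + 2 <= m\<close>, and shows that \<open>A\<close> has
      density at least \<open>1 / (k + l + 1)\<close>.\<close>
    have "p \<le> (k + l + 1) * m" unfolding peq using m by (simp add: algebra_simps)
    then have "p ^ n \<le> ((k + l + 1) * m) * p ^ (n - 1)" unfolding pn by (rule mult_right_mono) simp
    also have "\<dots> = (k + l + 1) * (m * p ^ (n - 1))" by (rule mult.assoc)
    also have "\<dots> \<le> (k + l + 1) * card A" using card by (rule mult_le_mono2)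
    finally have "real (p ^ n) \<le> real ((k + l + 1) * card A)" by (simp only: of_nat_le_iff)
    then show ?thesis by (simp add: algebra_simps)
  qed
  obtain \<phi> x where \<phi>: "\<phi> \<in> iso (Fpn p n) (Fpn p n)"
      "(1 + \<eta>) * real (card A) \<le> real p * real (card (slice p n (\<phi> ` A) x))"
    using exists_iso_large_slice[OF p n sf _ dense eta(1,2)] kl by auto
  define A1 where "A1 = \<phi> ` A"
  have sf1: "sum_free p n k l A1" unfolding A1_def using p \<phi>(1) sf by (rule iso_sum_free)
  have A1: "A1 \<subseteq> carrier (Fpn p n)" unfolding A1_def using \<phi>(1) A by (rule iso_subset_carrier)
  have card1: "card A1 = card A" unfolding A1_def using \<phi>(1) A by (rule iso_card)
  define a where "a x = card (slice p n A1 x)" for x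
  interpret slice_system p k l "p ^ (n - 1)" "supp A1" a
    unfolding a_def by (rule slice_system_of_sum_free[OF p n kl sf1])
  have cardA: "card A = (\<Sum>x\<in>supp A1. a x)"
    unfolding card1[symmetric] card_eq_sum_slices[OF n A1] a_def ..
  have P0: "p ^ (n - 1) > 0" using p0 by simp
  have N: "m * p ^ (n - 1) \<le> (\<Sum>x\<in>supp A1. a x)" using card cardA by simp
  have "supp A1 \<noteq> {}"
  proof
    assume "supp A1 = {}"
    then show False using N P0 m by simp
  qed
  then have "Max (a ` supp A1) \<in> a ` supp A1" using finite_S by (intro Max_in) auto
  then obtain x0 where "x0 \<in> supp A1" "a x0 = Max (a ` supp A1)" by (metis imageE)
  then have x0: "x0 \<in> supp A1" "\<And>x. x \<in> supp A1 \<Longrightarrow> a x \<le> a x0"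
    using finite_S by auto
  have "a x \<le> a x0"
  proof (cases "x \<in> supp A1")
    case False
    then have "slice p n A1 x = {}" using slice_nonempty_iff[OF n A1] by blast
    then show ?thesis by (simp add: a_def)
  qed (rule x0(2))
  then have "real p * real (a x) \<le> real p * real (a x0)" by (intro mult_left_mono) auto
  then have four: "(1 + \<eta>) * (\<Sum>x\<in>supp A1. real (a x)) \<le> real p * real (a x0)"
    using \<phi>(2) cardA unfolding A1_def[symmetric] a_def[symmetric] by simp
  have big: "real (k + l) * real (p ^ (n - 1)) \<le> 2 * (real (k + l) - 1) * real (a x0)"
    by (rule max_slice_large[OF peq lam m(1) x0 P0 N four eta(1,3)])
  have c1: "card (supp A1) \<le> m + 1"
    by (rule card_supp_le[OF peq lam m(1) x0 P0 N big])
  have p2: "2 * (k + l) \<le> p"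
  proof -
    have "(k + l) * 2 \<le> (k + l) * m" using m by (intro mult_le_mono2) simp
    then show ?thesis using peq by linarith
  qed
  obtain S' where S': "S' \<subseteq> supp A1" "card S' = m"
    and core0: "\<And>zs i j. balanced p k l zs \<Longrightarrow> set zs \<subseteq> supp A1 \<Longrightarrow> i < j \<Longrightarrow> j < k + l \<Longrightarrow>
      zs ! i \<in> S' \<Longrightarrow> zs ! j \<in> S' \<Longrightarrow> False"
  proof -
    have "m \<ge> 1" using m by simp
    from exists_core[OF this p2 P0 N c1] that show ?thesis by metis
  qed
  define S where "S = {x. x mod int p \<in> supp A1}"
  define Q where "Q = {x. x mod int p \<in> S'}"
  have modcong: "y mod int p = x mod int p" if "int p dvd y - x" for x y
    using that by (simp add: mod_eq_dvd_iff)
  have per: "periodic p S" "periodic p Q"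
    unfolding S_def Q_def by (auto intro!: periodicI dest: modcong)
  have R: "supp A1 \<subseteq> {0..<int p}" using supp_subset[OF n A1] .
  have hull: "{x. x mod int p \<in> Y} \<inter> {0..<int p} = Y" if "Y \<subseteq> {0..<int p}" for Y
    using that by (force simp: subset_iff)
  have pc: "pcard p Q = m" "pcard p S \<le> m + 1"
    unfolding pcard_def S_def Q_def hull[OF R] hull[OF order_trans[OF S'(1) R]] using S' c1 by auto
  have core: "core p k l S Q"
    unfolding core_def
  proof (intro conjI allI impI notI)
    show "Q \<subseteq> S" using S'(1) by (auto simp: S_def Q_def)
    fix zs i j
    assume zs: "balanced p k l zs" "set zs \<subseteq> S" and ij: "i < j" "j < k + l" "zs ! i \<in> Q" "zs ! j \<in> Q"
    have len: "length zs = k + l" using zs(1) by (simp add: balanced_def)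
    have sm: "sum_list (map (\<lambda>x. x mod int p) xs) mod int p = sum_list xs mod int p" for xs
    proof (induction xs)
      case (Cons x xs)
      then show ?case by simp (metis mod_add_eq mod_mod_trivial)
    qed simp
    have "balanced p k l (map (\<lambda>x. x mod int p) zs)"
      using zs(1) unfolding balanced_def take_map drop_map sm by simp
    moreover have "set (map (\<lambda>x. x mod int p) zs) \<subseteq> supp A1" using zs(2) by (auto simp: S_def)
    ultimately show False using core0[of "map (\<lambda>x. x mod int p) zs" i j] ij len by (auto simp: Q_def)
  qed
  have k2: "k \<ge> 2" using kl by simp
  have dbl: "pcard p (Q + Q) \<le> 2 * m + 1"
    using m by (intro pcard_double_le[OF p kl peq lam _ per(2) pc(1) core_zero_notin[OF core k2]]) simp
  have cov: "real m \<le> 1 / real (k + l) * real p"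
  proof -
    have "real ((k + l) * m) \<le> real p" unfolding of_nat_le_iff using peq by simp
    then show ?thesis using kl by (simp add: field_simps)
  qed
  obtain b0 d0 where d0: "\<not> int p dvd d0" "Q \<subseteq> progression p b0 d0 (m + 2)"
    using covered_by_progression[OF p per(2) pc(1) _ dbl cov T] m by auto
  obtain b1 where b1: "{x. d0 * x \<in> progression p b0 d0 (m + 2)} = progression p b1 1 (m + 2)"
    using scale_progression[OF p d0(1)] by blast
  have perd: "periodic p {x. d0 * x \<in> S}" "periodic p {x. d0 * x \<in> Q}"
    using periodic_vimage[OF per(1), of d0 0] periodic_vimage[OF per(2), of d0 0] by auto
  have pcd: "pcard p {x. d0 * x \<in> Q} = m" "pcard p {x. d0 * x \<in> S} \<le> m + 1"
    using pcard_vimage[OF p per(1) d0(1), of 0] pcard_vimage[OF p per(2) d0(1), of 0] pc by auto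
  have "{x. d0 * x \<in> Q} \<subseteq> progression p b1 1 (m + 2)" using d0(2) b1 by blast
  then have "interval_shape p k l m lam {x. d0 * x \<in> S} \<or>
      interval_shape p k l m lam {x. (- 1) * x \<in> {x. d0 * x \<in> S}}"
    by (rule interval_shape_if_core[OF p kl peq lam m(2) core_scale[OF core] perd pcd])
  moreover have "{x. (- 1) * x \<in> {x. d0 * x \<in> S}} = {x. (- d0) * x \<in> S}" by simp
  ultimately obtain d where d: "\<not> int p dvd d" "interval_shape p k l m lam {x. d * x \<in> S}"
    using d0(1) by (metis dvd_minus_iff)
  \<comment> \<open>The dilation that straightens the support is realized by an automorphism:
    pulling back along \<open>d\<close> amounts to scaling the first coordinate by the inverse
    \<open>u\<close>.\<close>
  obtain u where u: "int p dvd d * u - 1"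
    using coprime_prime_int[OF p d(1)] by (metis cong_iff_dvd_diff cong_solve_coprime_int)
  have u_ne: "\<not> int p dvd u"
  proof
    assume "int p dvd u"
    then have "int p dvd d * u" by simp
    then have "int p dvd d * u - (d * u - 1)" using u by (rule dvd_diff)
    then show False using p prime_gt_1_nat by auto
  qed
  let ?\<psi> = "scale_vec p n u"
  have ud: "(u * (d * x)) mod int p = x mod int p" "(d * (u * x)) mod int p = x mod int p" for x
  proof -
    have "int p dvd (d * u - 1) * x" using u by simp
    moreover have "u * (d * x) - x = (d * u - 1) * x" "d * (u * x) - x = (d * u - 1) * x"
      by (simp_all add: algebra_simps)
    ultimately show "(u * (d * x)) mod int p = x mod int p" "(d * (u * x)) mod int p = x mod int p"
      by (simp_all only: mod_eq_dvd_iff)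
  qed
  have "{x. x mod int p \<in> supp (?\<psi> ` A1)} = {x. d * x \<in> S}"
  proof (intro equalityI subsetI)
    fix x assume "x \<in> {x. x mod int p \<in> supp (?\<psi> ` A1)}"
    then obtain y where y: "y \<in> supp A1" "x mod int p = (u * y) mod int p"
      using supp_scale_vec[OF n] by blast
    have "(d * x) mod int p = (d * (u * y)) mod int p" using y(2) by (metis mod_mult_right_eq)
    also have "\<dots> = y" unfolding ud using y(1) R by auto
    finally show "x \<in> {x. d * x \<in> S}" using y(1) by (simp add: S_def)
  next
    fix x assume "x \<in> {x. d * x \<in> S}"
    then have "(d * x) mod int p \<in> supp A1" by (simp add: S_def)
    then obtain z where z: "z \<in> A1" "z 0 = (d * x) mod int p" by (auto simp: supp_def)
    have "?\<psi> z 0 = x mod int p" using n ud(1)[of x] z(2) by (simp add: scale_vec_def mod_mult_right_eq)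
    moreover have "?\<psi> z 0 \<in> supp (?\<psi> ` A1)" unfolding supp_def using z(1) by blast
    ultimately show "x \<in> {x. x mod int p \<in> supp (?\<psi> ` A1)}" by simp
  qed
  then have "interval_shape p k l m lam {x. x mod int p \<in> supp ((?\<psi> \<circ> \<phi>) ` A)}"
    using d(2) by (simp only: image_comp[symmetric] A1_def)
  moreover have "?\<psi> \<circ> \<phi> \<in> iso (Fpn p n) (Fpn p n)"
    using \<phi>(1) scale_vec_iso[OF p n u_ne] by (rule iso_set_trans)
  ultimately show ?thesis by blast
qed

text \<open>The witness is \<eta> = \<open>1 / y\<close> with
  \<open>y = q powr (1 / (q - 2))\<close>, the size of the Fourier coefficient relative to the set.
  As \<open>ln q >= 1\<close>, the exponential gives \<open>y >= 1 + 1 / (q - 2)\<close>, and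
  \<open>(q + 4) (1 + 1 / q) (1 + 1 / (q - 2))\<close> exceeds 13 for \<open>q >= 5\<close>.\<close>

lemma root_bounds:
  fixes q m lam :: nat
  assumes q: "q \<ge> 5" and m: "real (q + lam + 4) * (1 + 1 / real q) * real q powr (1 / (real q - 2)) \<le> real m"
  shows "m \<ge> 14" "m \<ge> q + lam + 4"
    and "\<exists>\<eta>\<ge>0. real q * \<eta> ^ (q - 2) \<le> 1 \<and> real (q + lam + 4) \<le> \<eta> * real m"
proof -
  define s where "s = real q - 2"
  define y where "y = real q powr (1 / s)"
  have s3: "s \<ge> 3" using q by (simp add: s_def)
  have y1: "1 + 1 / s \<le> y"
  proof -
    have "exp 1 \<le> (3::real)" by (rule exp_le)
    then have "exp 1 \<le> real q" using q by linarith
    then have "1 \<le> ln (real q)" using q by (subst ln_ge_iff) auto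
    then have "1 / s \<le> 1 / s * ln (real q)" using s3 by (simp add: field_simps)
    then have "1 + 1 / s \<le> exp (1 / s * ln (real q))" using exp_ge_add_one_self[of "1 / s * ln (real q)"] by linarith
    also have "\<dots> = y" using q by (simp add: y_def powr_def)
    finally show ?thesis .
  qed
  have y0: "y \<ge> 1" using y1 s3 by (simp add: add_increasing order_trans[OF _ y1])
  have my: "real (q + lam + 4) * (1 + 1 / real q) * y \<le> real m" using m by (simp add: y_def s_def)
  have base: "real (q + lam + 4) * 1 \<le> real (q + lam + 4) * (1 + 1 / real q)"
    using q by (intro mult_left_mono) auto
  have b1: "real (q + lam + 4) * y \<le> real m"
  proof -
    have "real (q + lam + 4) * 1 * y \<le> real (q + lam + 4) * (1 + 1 / real q) * y"
      using base y0 by (intro mult_right_mono) auto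
    then show ?thesis using my unfolding mult_1_right by linarith
  qed
  have "real (q + lam + 4) * 1 \<le> real (q + lam + 4) * y" using y0 by (intro mult_left_mono) auto
  then have "real (q + lam + 4) \<le> real m" using b1 unfolding mult_1_right by linarith
  then show "m \<ge> q + lam + 4" by (simp only: of_nat_le_iff)
  have "real (q + 4) * (1 + 1 / real q) * (1 + 1 / s) \<le> real (q + lam + 4) * (1 + 1 / real q) * y"
    using y1 s3 q by (intro mult_mono) auto
  then have "real (q + 4) * (1 + 1 / real q) * (1 + 1 / s) \<le> real m" using my by linarith
  moreover have "13 < real (q + 4) * (1 + 1 / real q) * (1 + 1 / s)"
  proof -
    \<comment> \<open>Expanding around the smallest value 5 of \<open>q\<close> makes all
      coefficients of the difference of the two polynomials positive.\<close>
    define t where "t = real q - 5"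
    have t: "t \<ge> 0" "real q = t + 5" "s = t + 3" "real (q + 4) = t + 9" using q by (auto simp: t_def s_def)
    have "13 * ((t + 5) * (t + 3)) < (t + 9) * (t + 6) * (t + 4)"
    proof -
      have "(t + 9) * (t + 6) * (t + 4) - 13 * ((t + 5) * (t + 3)) = t * t * t + 6 * (t * t) + 10 * t + 21"
        by (simp add: algebra_simps)
      moreover have "t * t * t \<ge> 0" "t * t \<ge> 0" using t(1) by simp_all
      ultimately show ?thesis using t(1) by linarith
    qed
    moreover have "real (q + 4) * (1 + 1 / real q) * (1 + 1 / s) = ((t + 9) * (t + 6) * (t + 4)) / ((t + 5) * (t + 3))"
      unfolding t(2,3,4) using t(1) by (simp add: field_simps)
    moreover have "0 < (t + 5) * (t + 3)" using t(1) by simp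
    ultimately show ?thesis by (simp only: pos_less_divide_eq)
  qed
  ultimately have "13 < real m" by linarith
  then show "m \<ge> 14" by simp
  define \<eta> where "\<eta> = 1 / y"
  have "y ^ (q - 2) = real q"
  proof -
    have "y ^ (q - 2) = y powr real (q - 2)" using y0 by (simp add: powr_realpow)
    also have "real (q - 2) = s" using q by (simp add: s_def of_nat_diff)
    also have "y powr s = real q" unfolding y_def powr_powr using s3 by simp
    finally show ?thesis .
  qed
  then have "real q * \<eta> ^ (q - 2) \<le> 1" using q by (simp add: \<eta>_def power_divide)
  moreover have "real (q + lam + 4) \<le> \<eta> * real m" using b1 y0 by (simp add: \<eta>_def field_simps)
  moreover have "\<eta> \<ge> 0" using y0 by (simp add: \<eta>_def)
  ultimately show "\<exists>\<eta>\<ge>0. real q * \<eta> ^ (q - 2) \<le> 1 \<and> real (q + lam + 4) \<le> \<eta> * real m" by blast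
qed

theorem theorem1p5:
  fixes k l lam m n p :: nat and A :: "(nat \<Rightarrow> int) set"
  assumes "k > l" and "l \<ge> 1" and "k + l \<ge> 5"
    and "lam \<le> k + l - 5"
    and "ennreal (real m) \<ge>
           max (5 * T_fun (1 / real (k + l)))
               (ennreal (real (k + l + lam + 4) * (1 + 1 / real (k + l)) *
                  real (k + l) powr (1 / (real (k + l) - 2))))"
    and "p = (k + l) * m + 2 + lam" and "prime p"
    and "n \<ge> 1"
    and "sum_free p n k l A" and "\<not> trivial_set p n k l m lam A"
    and "card A \<ge> m * p ^ (n - 1)"
  shows "normal_set p n k l m lam A"
proof -
  note kl = assms(1-3) and lam = assms(4) and peq = assms(6) and p = assms(7) and n = assms(8)
    and sf = assms(9) and nontrivial = assms(10) and card = assms(11)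
  have T: "5 * T_fun (1 / real (k + l)) \<le> ennreal (real m)" using assms(5) by simp
  have "real (k + l + lam + 4) * (1 + 1 / real (k + l)) * real (k + l) powr (1 / (real (k + l) - 2)) \<le> real m"
    using assms(5) by (simp add: ennreal_le_iff)
  note mb = root_bounds[OF kl(3) this]
  obtain \<eta> where eta: "\<eta> \<ge> 0" "real (k + l) * \<eta> ^ (k + l - 2) \<le> 1" "real (k + l + lam + 4) \<le> \<eta> * real m"
    using mb(3) by blast
  obtain \<phi> where \<phi>: "\<phi> \<in> iso (Fpn p n) (Fpn p n)"
    and shape: "interval_shape p k l m lam {x. x mod int p \<in> supp (\<phi> ` A)}"
    using interval_support[OF p n kl lam peq mb(1,2) T eta sf card] by blast
  let ?A = "\<phi> ` A"
  have A: "A \<subseteq> carrier (Fpn p n)" using sf by (simp only: sum_free_def)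
  have A': "?A \<subseteq> carrier (Fpn p n)" using \<phi> A by (rule iso_subset_carrier)
  have card': "card ?A = card A" using \<phi> A by (rule iso_card)
  have iso: "isomorphic_sets p n A ?A" using \<phi> by (rule isomorphic_image)
  have nt: "\<not> trivial_set p n k l m lam ?A" using trivial_set_iso[OF iso] nontrivial by blast
  have m: "m \<ge> 1" "m \<ge> 2" using mb(1) by auto
  have sub: "supp ?A \<subseteq> {x. x mod int p \<in> supp ?A}"
    using supp_subset[OF n A'] by (auto simp: subset_iff)
  have "normal_set p n k l m lam ?A"
    using shape unfolding interval_shape_def
  proof (elim disjE exE conjE)
    fix b j assume "{x. x mod int p \<in> supp ?A} \<subseteq> progression p b 1 (m + 1)" "0 \<le> j" "j \<le> int lam"
      "int p dvd int l * b - int k * b - int k * int m - (1 + j)"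
    then show ?thesis using trivial_setI[OF p n kl(1) peq m(1) A'] sub nt by blast
  next
    fix b D assume "{x. x mod int p \<in> supp ?A} \<subseteq> progression p b 1 m" "1 \<le> D"
      "D \<le> int lam + int k + int l + 1" "int p dvd int l * b - int k * b - int k * (int m - 1) - D"
    moreover from this have "supp ?A \<subseteq> progression p b 1 m" using sub by blast
    moreover have "m * p ^ (n - 1) \<le> card ?A" using card card' by simp
    ultimately have "type1 p n k l m lam ?A"
      using normal_interval[OF p n kl(1,2) peq m(1) A' _ _ nt] by blast
    then show ?thesis by (simp add: normal_set_def)
  next
    fix b assume l1: "l = 1" and b: "{x. x mod int p \<in> supp ?A} \<subseteq> progression p b 1 (m + 1)"
      "b \<in> {x. x mod int p \<in> supp ?A}" "b + int m \<in> {x. x mod int p \<in> supp ?A}"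
      "int p dvd b - int k * b - int k * int m"
    have "type2 p n k 1 m ?A"
    proof (rule normal_two_ends[OF p n])
      show "k \<ge> 4" using kl l1 by simp
      show "sum_free p n k 1 ?A" using iso_sum_free[OF p \<phi> sf] l1 by simp
    qed (use b sub peq l1 m card card' in auto)
    then show ?thesis using l1 by (simp add: normal_set_def)
  qed
  then show ?thesis
    \<comment> \<open>Both types depend on the set only through its size and its isomorphism class,
      so they pass back from the image to \<open>A\<close>.\<close>
    unfolding normal_set_def type1_def type2_def Let_def card'
    using isomorphic_sets_trans[OF iso] by blast
qed

end
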